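(* Let $K$ be an algebraically closed field of characteristic zero and let $C\subset\mathbb{P}^2(K)$ be a non-singular projective plane curve of degree $d\geq 4$. Then $C$ admits an automorphism of order $d(d-2)$ if and only if it is isomorphic to $X^d+Y^{d-1}Z+YZ^{d-1}=0$. In particular, in this case $Aut(C)$ is a central extension of $D_{2(d-2)}$ by $\mathbb{Z}/d$ if $d\neq 4,6$, a central extension of $S_4$ by $\mathbb{Z}/d$ if $d=6$, and isomorphic to $(\mathbb{Z}/4)^2\rtimes S_3$ if $d=4$.
   Context: $Aut(C)$ is the full automorphism group of $C$ over $K$, identified with the finite subgroup of $PGL_3(K)$ preserving the defining equation of $C$. $D_{2n}$ denotes the dihedral group of order $2n$. *)

theory Defs
  imports
    "HOL-Analysis.Cartesian_Space"
    "HOL-Library.Poly_Mapping"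
    "HOL-Computational_Algebra.Polynomial"
    "HOL-Algebra.Elementary_Groups"
    "HOL-Algebra.Sym_Groups"
    "HOL-Algebra.Multiplicative_Group"
begin

section \<open>Plane curves given by ternary forms\<close>

text \<open>The variables \<open>X\<close>, \<open>Y\<close>, \<open>Z\<close> are indexed by the elements \<open>1\<close>, \<open>2\<close>, \<open>3\<close> of the
  three-element type \<open>3\<close> (in which \<open>3 = 0\<close>).\<close>

type_synonym 'k ternary = "(3 \<Rightarrow>\<^sub>0 nat) \<Rightarrow>\<^sub>0 'k"

definition Const :: "'k::zero \<Rightarrow> 'k ternary" where
  "Const c = Poly_Mapping.single 0 c"

definition Var :: "3 \<Rightarrow> 'k::zero_neq_one ternary" where
  "Var i = Poly_Mapping.single (Poly_Mapping.single i 1) 1"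

definition eval_at :: "'k::field ternary \<Rightarrow> 'k^3 \<Rightarrow> 'k" where
  "eval_at F v =
     (\<Sum>m\<in>Poly_Mapping.keys F. Poly_Mapping.lookup F m *
        (\<Prod>i\<in>UNIV. (v $ i) ^ Poly_Mapping.lookup m i))"

definition partial :: "3 \<Rightarrow> 'k::field ternary \<Rightarrow> 'k ternary" where
  "partial i F =
     (\<Sum>m\<in>Poly_Mapping.keys F. Poly_Mapping.single (m - Poly_Mapping.single i 1)
        (of_nat (Poly_Mapping.lookup m i) * Poly_Mapping.lookup F m))"

definition homogeneous :: "nat \<Rightarrow> 'k::field ternary \<Rightarrow> bool" where
  "homogeneous d F \<longleftrightarrow>
     (\<forall>m\<in>Poly_Mapping.keys F. (\<Sum>i\<in>UNIV. Poly_Mapping.lookup m i) = d)"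

definition nonsingular :: "'k::field ternary \<Rightarrow> bool" where
  "nonsingular F \<longleftrightarrow>
     \<not> (\<exists>v. v \<noteq> 0 \<and> eval_at F v = 0 \<and> (\<forall>i. eval_at (partial i F) v = 0))"

text \<open>A plane curve is represented by its defining equation.  Over an algebraically closed field
  a nonsingular form of positive degree is automatically irreducible, so the curve is integral
  and determines the form up to a nonzero scalar.\<close>

definition nonsingular_plane_curve :: "nat \<Rightarrow> 'k::field ternary \<Rightarrow> bool" where
  "nonsingular_plane_curve d F \<longleftrightarrow> F \<noteq> 0 \<and> homogeneous d F \<and> nonsingular F"

text \<open>The form \<open>F(A v)\<close>, where \<open>v = (X, Y, Z)\<close>.\<close>

definition lin_subst :: "'k::field^3^3 \<Rightarrow> 'k ternary \<Rightarrow> 'k ternary" where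
  "lin_subst A F =
     (\<Sum>m\<in>Poly_Mapping.keys F. Const (Poly_Mapping.lookup F m) *
        (\<Prod>i\<in>UNIV. (\<Sum>j\<in>UNIV. Const (A $ i $ j) * Var j) ^ Poly_Mapping.lookup m i))"

text \<open>The projectivity of \<open>A\<close> carries the curve \<open>G = 0\<close> onto the curve \<open>F = 0\<close>.\<close>

definition carries :: "'k::field^3^3 \<Rightarrow> 'k ternary \<Rightarrow> 'k ternary \<Rightarrow> bool" where
  "carries A G F \<longleftrightarrow> invertible A \<and> (\<exists>c. c \<noteq> 0 \<and> lin_subst A F = Const c * G)"

text \<open>Isomorphisms between nonsingular plane curves of degree at least 4 are induced by projectivities
  of the plane.  Accordingly, isomorphisms, and below automorphisms, are taken to be the elements
  of \<open>PGL(3,K)\<close> that transform one defining equation into the other.\<close>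

definition isomorphic_curves :: "'k::field ternary \<Rightarrow> 'k ternary \<Rightarrow> bool" where
  "isomorphic_curves G F \<longleftrightarrow> (\<exists>A. carries A G F)"

definition Xd_plus_YZ_form :: "nat \<Rightarrow> 'k::field ternary" where
  "Xd_plus_YZ_form d = Var 1 ^ d + Var 2 ^ (d - 1) * Var 3 + Var 2 * Var 3 ^ (d - 1)"


section \<open>The projective linear group and the automorphism group of a plane curve\<close>

definition GL3 :: "('k::field^3^3) monoid" where
  "GL3 = \<lparr>carrier = {A. invertible A}, monoid.mult = (**), one = mat 1\<rparr>"

definition scalar_matrices :: "('k::field^3^3) set" where
  "scalar_matrices = {mat c | c. c \<noteq> 0}"

definition PGL3 :: "('k::field^3^3) set monoid" where
  "PGL3 = GL3 Mod scalar_matrices"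

definition Aut_curve :: "'k::field ternary \<Rightarrow> ('k^3^3) set monoid" where
  "Aut_curve F = PGL3\<lparr>carrier := {S \<in> carrier PGL3. \<exists>A\<in>S. carries A F F}\<rparr>"


section \<open>Group extensions\<close>

text \<open>\<open>E\<close> is an extension of \<open>Q\<close> by \<open>N\<close>, i.e. \<open>1 \<rightarrow> N \<rightarrow> E \<rightarrow> Q \<rightarrow> 1\<close> is exact, with the image
  of \<open>N\<close> central in \<open>E\<close>.\<close>

definition central_extension ::
    "('e, 'x) monoid_scheme \<Rightarrow> ('q, 'y) monoid_scheme \<Rightarrow> ('n, 'z) monoid_scheme \<Rightarrow> bool" where
  "central_extension E Q N \<longleftrightarrow>
     group E \<and> group Q \<and> group N \<and>
     (\<exists>f g. f \<in> mon N E \<and> g \<in> epi E Q \<and> kernel E Q g = f ` carrier N \<and>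
        (\<forall>n\<in>carrier N. \<forall>x\<in>carrier E. f n \<otimes>\<^bsub>E\<^esub> x = x \<otimes>\<^bsub>E\<^esub> f n))"

text \<open>\<open>N \<rtimes> H\<close>, where \<open>\<phi>\<close> is a left action of \<open>H\<close> on \<open>N\<close> by automorphisms.\<close>

definition semidirect_product ::
    "('n, 'x) monoid_scheme \<Rightarrow> ('h, 'y) monoid_scheme \<Rightarrow> ('h \<Rightarrow> 'n \<Rightarrow> 'n) \<Rightarrow> ('n \<times> 'h) monoid" where
  "semidirect_product N H \<phi> =
     \<lparr>carrier = carrier N \<times> carrier H,
      monoid.mult = (\<lambda>(n, h) (n', h'). (n \<otimes>\<^bsub>N\<^esub> \<phi> h n', h \<otimes>\<^bsub>H\<^esub> h')),
      one = (\<one>\<^bsub>N\<^esub>, \<one>\<^bsub>H\<^esub>)\<rparr>"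

text \<open>The dihedral group of order \<open>2 * n\<close>.\<close>

definition dihedral_group :: "nat \<Rightarrow> (int \<times> int) monoid" where
  "dihedral_group n =
     semidirect_product (integer_mod_group n) (integer_mod_group 2)
       (\<lambda>s x. if s = 0 then x else inv\<^bsub>integer_mod_group n\<^esub> x)"

text \<open>The action of \<open>S\<^sub>3\<close> in \<open>(\<int>/n)\<^sup>2 \<rtimes> S\<^sub>3\<close> is the permutation of the homogeneous coordinates:
  the pair \<open>(a, b)\<close> stands for the class of \<open>(a, b, 0)\<close> in \<open>(\<int>/n)\<^sup>3\<close> modulo the diagonal, that is,
  for \<open>diag(\<zeta>\<^sup>a, \<zeta>\<^sup>b, 1)\<close> modulo scalars, \<open>\<zeta>\<close> being a primitive \<open>n\<close>-th root of unity.\<close>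

definition coordinate_action :: "nat \<Rightarrow> (nat \<Rightarrow> nat) \<Rightarrow> int \<times> int \<Rightarrow> int \<times> int" where
  "coordinate_action n \<sigma> = (\<lambda>(a, b).
     let v = (\<lambda>i. if i = 1 then a else if i = 2 then b else 0);
         w = (\<lambda>i. v (Hilbert_Choice.inv \<sigma> i))
     in ((w 1 - w 3) mod int n, (w 2 - w 3) mod int n))"

definition Zn2_semidirect_S3 :: "nat \<Rightarrow> ((int \<times> int) \<times> (nat \<Rightarrow> nat)) monoid" where
  "Zn2_semidirect_S3 n =
     semidirect_product (integer_mod_group n \<times>\<times> integer_mod_group n) (sym_group 3)
       (coordinate_action n)"

end

theory Submission
  imports Defs
begin

text \<open>An automorphism whose order is \<open>d (d - 2)\<close> can be diagonalized.  Smoothness at the three coordinate points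
  forces monomials \<open>X\<^sub>i\<^sup>d\<^sup>-\<^sup>1 X\<^sub>j\<close> in the equation, one for each \<open>i\<close>; comparing the weights of these monomials
  with the order leaves only the shape \<open>X\<^sup>d, Y\<^sup>d\<^sup>-\<^sup>1 Z, Y Z\<^sup>d\<^sup>-\<^sup>1\<close>, and no further monomial has the right weight.

  For \<open>d \<ge> 5\<close> the point \<open>(1 : 0 : 0)\<close> is the only one at which the polar of this form is a power of a line, so
  every automorphism fixes it together with the line \<open>X = 0\<close>, and is given by a binary substitution preserving
  \<open>Y Z (Y\<^sup>n + Z\<^sup>n)\<close> with \<open>n = d - 2\<close>.  Comparing coefficients of low degree shows that this
  substitution is monomial, which gives the dihedral group, unless \<open>n = 4\<close>, when the zeros form an octahedron.  The quartic is
  projectively equivalent to the Fermat quartic, whose automorphisms permute the coordinate axes for the same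
  reason.\<close>


section \<open>Ternary forms as polynomial functions\<close>

text \<open>Over an infinite field a form is determined by its values, so \<open>carries\<close>
  becomes a pointwise identity, and derivatives enter only as linear coefficients along lines, where
  the chain rule is mere substitution. The parameter \<open>e\<close> in the normal form is there
  for the sextic: with \<open>e = -1\<close> the zeros of \<open>Y^5 Z - Y Z^5\<close> are 0,
  infinity and the fourth roots of unity, a standard octahedron on which the generators have simple
  matrices. The exceptional value \<open>n = 4\<close> comes from a single equation between binomial
  coefficients, \<open>m choose 3 = m choose 2\<close> with \<open>m = n + 1\<close>. The quartic
  escapes the polar argument because \<open>Y Z (Y^2 + Z^2)\<close> is equivalent to
  \<open>Y^4 + Z^4\<close>, so that two further polars are cubes. Elements of \<open>PGL3\<close>
  being classes, homomorphisms out of the automorphism group are described on matrices and shown to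
  be blind to scalars.\<close>

abbreviation "lookup \<equiv> Poly_Mapping.lookup"

abbreviation "keys \<equiv> Poly_Mapping.keys"

definition monom_at :: "(3 \<Rightarrow>\<^sub>0 nat) \<Rightarrow> 'a::comm_semiring_1 ^ 3 \<Rightarrow> 'a" where
  "monom_at m v = (\<Prod>i\<in>UNIV. (v $ i) ^ lookup m i)"

lemma monom_at_add: "monom_at (m + m') v = monom_at m v * monom_at m' v"
  by (simp add: monom_at_def lookup_add power_add prod.distrib)

lemma monom_at_0 [simp]: "monom_at 0 v = 1"
  by (simp add: monom_at_def)

lemma prod_3: "prod f (UNIV :: 3 set) = f 1 * f 2 * f 3"
  unfolding UNIV_3 by (simp add: mult.assoc)

lemma eval_at_superset:
  assumes "finite S" "keys F \<subseteq> S"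
  shows "eval_at F v = (\<Sum>m\<in>S. lookup F m * monom_at m v)"
  unfolding eval_at_def monom_at_def
  by (rule sum.mono_neutral_left) (use assms in \<open>auto simp: in_keys_iff\<close>)

lemma eval_at_single: "eval_at (Poly_Mapping.single m c) v = c * monom_at m v"
  by (subst eval_at_superset[of "{m}"]) auto

lemma eval_at_0 [simp]: "eval_at 0 v = 0"
  by (simp add: eval_at_def)

lemma eval_at_add [simp]: "eval_at (F + G) v = eval_at F v + eval_at G v"
proof -
  let ?S = "keys F \<union> keys G"
  have "keys (F + G) \<subseteq> ?S" by (rule keys_add)
  then show ?thesis
    by (subst (1 2 3) eval_at_superset[of ?S]) (auto simp: lookup_add algebra_simps sum.distrib)
qed

lemma eval_at_sum [simp]: "eval_at (sum f S) v = (\<Sum>x\<in>S. eval_at (f x) v)"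
  by (induction S rule: infinite_finite_induct) auto

lemma sum_single_lookup: "(\<Sum>m\<in>keys F. Poly_Mapping.single m (lookup F m)) = F"
proof (rule poly_mapping_eqI)
  fix k
  have "lookup (\<Sum>m\<in>keys F. Poly_Mapping.single m (lookup F m)) k
    = (\<Sum>m\<in>keys F. lookup F m when m = k)"
    by (simp add: lookup_sum lookup_single)
  also have "\<dots> = lookup F k"
    by (simp add: when_def sum.delta' in_keys_iff)
  finally show "lookup (\<Sum>m\<in>keys F.
      Poly_Mapping.single m (lookup F m)) k = lookup F k" .
qed

lemma eval_at_mult [simp]: "eval_at (F * G) v = eval_at F v * eval_at G v"
proof -
  let ?s = "\<lambda>H m. Poly_Mapping.single m (lookup H m)"
  have "F * G = (\<Sum>m\<in>keys F. ?s F m) * (\<Sum>m\<in>keys G. ?s G m)"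
    by (simp only: sum_single_lookup)
  also have "\<dots> = (\<Sum>m\<in>keys F. \<Sum>m'\<in>keys G.
      Poly_Mapping.single (m + m') (lookup F m * lookup G m'))"
    by (simp add: sum_product mult_single)
  finally have "eval_at (F * G) v = (\<Sum>m\<in>keys F. \<Sum>m'\<in>keys G.
      lookup F m * monom_at m v * (lookup G m' * monom_at m' v))"
    by (simp add: eval_at_single monom_at_add mult_ac)
  then show ?thesis
    by (simp add: eval_at_def monom_at_def sum_product)
qed

lemma eval_at_Const [simp]: "eval_at (Const c) v = c"
  by (simp add: Const_def eval_at_single)

lemma eval_at_1 [simp]: "eval_at 1 v = 1"
  using eval_at_Const[of 1 v] by (simp add: Const_def)

lemma monom_at_single: "monom_at (Poly_Mapping.single i n) v = (v $ i) ^ n"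
  by (simp add: monom_at_def lookup_single when_def if_distrib prod.delta' cong: if_cong)

lemma eval_at_Var [simp]: "eval_at (Var i) v = v $ i"
  by (simp add: Var_def eval_at_single monom_at_single)

lemma eval_at_power [simp]: "eval_at (F ^ n) v = eval_at F v ^ n"
  by (induction n) auto

lemma eval_at_prod [simp]: "eval_at (prod f S) v = (\<Prod>x\<in>S. eval_at (f x) v)"
  by (induction S rule: infinite_finite_induct) auto

lemma eval_at_lin_subst [simp]: "eval_at (lin_subst A F) v = eval_at F (A *v v)"
  by (simp add: lin_subst_def eval_at_def[of F] matrix_vector_mult_def)

section \<open>Forms are determined by their values\<close>

lemma digits_inj:
  fixes a b c a' b' c' N :: nat
  assumes "a < N" "a' < N" "b < N" "b' < N" "a + N * (b + N * c) = a' + N * (b' + N * c')"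
  shows "a = a' \<and> b = b' \<and> c = c'"
proof -
  have modN: "(x + N * y) mod N = x" if "x < N" for x y
    using that by simp
  have 1: "a = a'"
    using modN[of a "b + N * c"] modN[of a' "b' + N * c'"] assms by metis
  with assms have 2: "b + N * c = b' + N * c'" by simp
  then have "b = b'"
    using modN[of b c] modN[of b' c'] assms by metis
  with 1 2 assms show ?thesis by simp
qed

text \<open>Kronecker substitution \<open>X = t\<close>, \<open>Y = t^N\<close>, \<open>Z = t^(N^2)\<close> separates the monomials of
  exponents below \<open>N\<close>.\<close>

lemma eval_at_eq_0_imp:
  fixes F :: "'k::{field_char_0} ternary"
  assumes "\<And>v. eval_at F v = 0"
  shows "F = 0"
proof -
  let ?K = "keys F"
  \<comment> \<open>The sum of all exponents of all monomials is a crude bound for each single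
    exponent; \<open>Suc\<close> makes it strict, as needed for digits in base
    \<open>N\<close>.\<close>
  define N where "N = Suc (\<Sum>m\<in>?K. \<Sum>i\<in>UNIV. lookup m i)"
  have less: "lookup m i < N" if "m \<in> ?K" for m i
  proof -
    have "lookup m i \<le> (\<Sum>i\<in>UNIV. lookup m i)"
      by (rule member_le_sum) auto
    also have "\<dots> \<le> (\<Sum>m\<in>?K. \<Sum>i\<in>UNIV. lookup m i)"
      by (rule member_le_sum) (use that in auto)
    finally show ?thesis by (simp add: N_def)
  qed
  define e where "e m = lookup m 1 + N * (lookup m 2 + N * lookup m 3)"
    for m :: "3 \<Rightarrow>\<^sub>0 nat"
  have inj: "inj_on e ?K"
  proof (rule inj_onI)
    fix m m' assume m: "m \<in> ?K" "m' \<in> ?K" "e m = e m'"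
    have "lookup m 1 = lookup m' 1 \<and> lookup m 2 = lookup m' 2
      \<and> lookup m 3 = lookup m' 3"
      by (rule digits_inj[where N = N]) (use m less in \<open>auto simp: e_def\<close>)
    then show "m = m'"
      by (intro poly_mapping_eqI) (metis exhaust_3)
  qed
  define p where "p = (\<Sum>m\<in>?K. Polynomial.monom (lookup F m) (e m))"
  have "poly p t = 0" for t
  proof -
    let ?v = "(\<chi> i. if i = 1 then t else if i = 2 then t ^ N else t ^ (N * N)) :: 'k^3"
    have "monom_at m ?v = t ^ e m" for m
      by (simp add: monom_at_def prod_3 e_def power_add power_mult algebra_simps)
    then have "eval_at F ?v = poly p t"
      by (simp add: p_def poly_sum poly_monom eval_at_superset[of ?K])
    with assms show ?thesis by simp
  qed
  then have "p = 0"
    using poly_eq_poly_eq_iff[of p 0] by auto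
  have "lookup F m = 0" for m
  proof (cases "m \<in> ?K")
    case True
    have "Polynomial.coeff p (e m) = (\<Sum>m'\<in>?K. if m' = m then lookup F m else 0)"
      unfolding p_def coeff_sum
      by (intro sum.cong refl) (use inj True in \<open>auto simp: inj_on_def\<close>)
    with True \<open>p = 0\<close> show ?thesis by simp
  qed (simp add: in_keys_iff)
  then show ?thesis
    by (intro poly_mapping_eqI) simp
qed

lemma eval_at_diff [simp]: "eval_at (F - G) v = eval_at F v - eval_at G v"
proof -
  have "eval_at F v = eval_at (F - G) v + eval_at G v"
    by (metis eval_at_add diff_add_cancel)
  then show ?thesis by simp
qed

lemma eval_at_inject:
  fixes F :: "'k::{field_char_0} ternary"
  shows "(\<forall>v. eval_at F v = eval_at G v) \<longleftrightarrow> F = G"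
  using eval_at_eq_0_imp[of "F - G"] by auto

text \<open>Trades the equality of forms for an equality of values; every later argument about
  automorphisms starts from this version.\<close>

lemma carries_iff:
  fixes F :: "'k::{field_char_0} ternary"
  shows "carries A G F \<longleftrightarrow> invertible A \<and> (\<exists>c. c \<noteq> 0 \<and> (\<forall>v. eval_at F (A *v v) = c * eval_at G v))"
  by (simp add: carries_def eval_at_inject[symmetric])

lemma monom_at_scale: "monom_at m (s *s v) = s ^ (\<Sum>i\<in>UNIV. lookup m i) * monom_at m v"
  by (simp add: monom_at_def power_mult_distrib prod.distrib power_sum)

lemma homogeneous_eval_at:
  assumes "homogeneous d F"
  shows "eval_at F (s *s v) = s ^ d * eval_at F v"
proof -
  have "eval_at F (s *s v) = (\<Sum>m\<in>keys F. s ^ d * (lookup F m * monom_at m v))"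
    unfolding eval_at_superset[OF finite_keys order_refl]
    by (intro sum.cong refl) (use assms in \<open>simp add: monom_at_scale homogeneous_def\<close>)
  then show ?thesis
    by (simp add: eval_at_superset[OF finite_keys order_refl] sum_distrib_left)
qed

text \<open>Distinct monomials are linearly independent as functions, so weights \<open>h\<close>
  that act on \<open>F\<close> as one scalar are constant on the monomials that occur. The weights
  used are powers of 2 recording the degree and the characters of diagonal matrices.\<close>

lemma eval_at_scale_coeffs:
  fixes F :: "'k::field_char_0 ternary" and h :: "(3 \<Rightarrow>\<^sub>0 nat) \<Rightarrow> 'k"
  assumes "\<And>v. (\<Sum>m\<in>keys F. h m * lookup F m * monom_at m v) = c * eval_at F v"
    and "m \<in> keys F"
  shows "h m = c"
proof -
  define G where "G = (\<Sum>m\<in>keys F. Poly_Mapping.single m ((h m - c) * lookup F m))"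
  have "eval_at G v = 0" for v
    using assms(1)[of v]
    by (simp add: G_def eval_at_single eval_at_superset[OF finite_keys order_refl, of F]
        algebra_simps sum_subtractf sum_distrib_left)
  then have "G = 0" by (rule eval_at_eq_0_imp)
  have "lookup G m = (h m - c) * lookup F m"
    using assms(2) by (simp add: G_def lookup_sum lookup_single when_def sum.delta')
  with \<open>G = 0\<close> assms(2) show ?thesis
    by (auto simp: in_keys_iff)
qed

text \<open>The single scalar \<open>s = 2\<close> suffices: its powers are distinct in
  characteristic zero, so they reveal the degree of each monomial.\<close>

lemma homogeneousI:
  fixes F :: "'k::field_char_0 ternary"
  assumes "\<And>s v. eval_at F (s *s v) = s ^ d * eval_at F v"
  shows "homogeneous d F"
  unfolding homogeneous_def
proof
  fix m assume m: "m \<in> keys F"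
  have "(2::'k) ^ (\<Sum>i\<in>UNIV. lookup m i) = 2 ^ d"
  proof (rule eval_at_scale_coeffs[where h = "\<lambda>m. 2 ^ (\<Sum>i\<in>UNIV. lookup m i)", OF _ m])
    fix v :: "'k^3"
    show "(\<Sum>m\<in>keys F. 2 ^ (\<Sum>i\<in>UNIV. lookup m i) * lookup F m * monom_at m v)
      = 2 ^ d * eval_at F v"
      unfolding assms[symmetric] eval_at_superset[OF finite_keys order_refl, of F "2 *s v"]
      by (simp add: monom_at_scale mult_ac)
  qed
  then have "of_nat (2 ^ (\<Sum>i\<in>UNIV. lookup m i)) = (of_nat (2 ^ d) :: 'k)"
    by simp
  then have "(2::nat) ^ (\<Sum>i\<in>UNIV. lookup m i) = 2 ^ d"
    by (simp only: of_nat_eq_iff)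
  then show "(\<Sum>i\<in>UNIV. lookup m i) = d"
    by simp
qed

text \<open>The polynomial \<open>F(v + t w)\<close> in \<open>t\<close>, whose linear coefficient is the derivative of \<open>F\<close>
  at \<open>v\<close> in the direction \<open>w\<close>.\<close>

definition on_line :: "'k::field ternary \<Rightarrow> 'k^3 \<Rightarrow> 'k^3 \<Rightarrow> 'k poly" where
  "on_line F v w = (\<Sum>m\<in>keys F. Polynomial.smult (lookup F m)
     (\<Prod>i\<in>UNIV. [:v $ i, w $ i:] ^ lookup m i))"

lemma poly_on_line: "poly (on_line F v w) t = eval_at F (v + t *s w)"
  by (simp add: on_line_def eval_at_def poly_sum poly_prod)

lemma lookup_minus_single:
  "lookup (m - Poly_Mapping.single j 1) i = (if i = j then lookup m i - 1 else lookup m i)"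
  for m :: "3 \<Rightarrow>\<^sub>0 nat"
  by (simp add: lookup_minus lookup_single when_def)

lemma eval_at_partial:
  "eval_at (partial i F) v = (\<Sum>m\<in>keys F.
     of_nat (lookup m i) * lookup F m * monom_at (m - Poly_Mapping.single i 1) v)"
  by (simp add: partial_def eval_at_single)

lemma coeff_1_mult: "Polynomial.coeff (p * q) 1 = Polynomial.coeff p 0 * Polynomial.coeff q 1 + Polynomial.coeff p 1 * Polynomial.coeff q 0"
  by (simp add: coeff_mult atMost_Suc add.commute)

lemma coeff_1_linear_power:
  "Polynomial.coeff ([:a, b:] ^ n) 1 = of_nat n * a ^ (n - 1) * b" for a :: "'a::comm_ring_1"
  by (cases n) (simp_all add: coeff_linear_poly_power mult_ac del: power_Suc)

lemma coeff_on_line: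
  "Polynomial.coeff (on_line F v w) 1 = (\<Sum>i\<in>UNIV. w $ i * eval_at (partial i F) v)"
proof -
  have "Polynomial.coeff (\<Prod>i\<in>UNIV. [:v $ i, w $ i:] ^ lookup m i) 1
    = (\<Sum>i\<in>UNIV. w $ i * of_nat (lookup m i) * monom_at (m - Poly_Mapping.single i 1) v)" for m
    by (simp add: prod_3 sum_3 monom_at_def coeff_1_mult lookup_minus_single coeff_mult_0 coeff_0_power coeff_1_linear_power algebra_simps
        del: mult_pCons_left mult_pCons_right One_nat_def)
  then show ?thesis
    by (simp add: on_line_def coeff_sum eval_at_partial sum_distrib_left sum.swap[of _ UNIV] mult_ac
        del: One_nat_def)
qed

text \<open>Axis directions recover the single partial derivatives. This coordinate-free version of
  the condition is the one that linear substitutions transport.\<close>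

lemma nonsingular_iff:
  "nonsingular F \<longleftrightarrow> (\<forall>v. v \<noteq> 0 \<longrightarrow> eval_at F v = 0 \<longrightarrow> (\<exists>w. Polynomial.coeff (on_line F v w) 1 \<noteq> 0))"
proof -
  have "(\<exists>w. Polynomial.coeff (on_line F v w) 1 \<noteq> 0) \<longleftrightarrow> (\<exists>i. eval_at (partial i F) v \<noteq> 0)" for v
  proof
    assume "\<exists>i. eval_at (partial i F) v \<noteq> 0"
    then obtain i where "eval_at (partial i F) v \<noteq> 0" by blast
    moreover have "Polynomial.coeff (on_line F v (axis i 1)) 1 = eval_at (partial i F) v"
      unfolding coeff_on_line
      by (simp add: axis_def if_distrib[of "\<lambda>x. x * _"] cong: if_cong)
    ultimately show "\<exists>w. Polynomial.coeff (on_line F v w) 1 \<noteq> 0" by metis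
  next
    assume "\<exists>w. Polynomial.coeff (on_line F v w) 1 \<noteq> 0"
    then show "\<exists>i. eval_at (partial i F) v \<noteq> 0"
      unfolding coeff_on_line by (metis (no_types, lifting) mult_zero_right sum.neutral)
  qed
  then show ?thesis
    unfolding nonsingular_def by blast
qed

text \<open>A linear map sends the line through \<open>v\<close> with direction \<open>w\<close> to
  the line through \<open>A v\<close> with direction \<open>A w\<close>. This takes the place of the
  chain rule.\<close>

lemma on_line_substitution:
  fixes F G :: "'k::field_char_0 ternary"
  assumes "\<And>v. eval_at F (A *v v) = c * eval_at G v"
  shows "on_line F (A *v v) (A *v w) = Polynomial.smult c (on_line G v w)"
  unfolding poly_eq_poly_eq_iff[symmetric]
  by (rule ext) (simp add: poly_on_line assms[symmetric] matrix_vector_right_distrib vector_scalar_commute)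

lemma carries_nonsingular:
  fixes F G :: "'k::field_char_0 ternary"
  assumes "carries A G F" "nonsingular F"
  shows "nonsingular G"
  unfolding nonsingular_iff
proof (intro allI impI)
  fix v :: "'k^3" assume v: "v \<noteq> 0" "eval_at G v = 0"
  obtain c where c: "invertible A" "c \<noteq> 0" "\<And>v. eval_at F (A *v v) = c * eval_at G v"
    using assms(1) unfolding carries_iff by blast
  obtain B where B: "B ** A = mat 1" "A ** B = mat 1"
    using c(1) unfolding invertible_def by blast
  have "A *v v \<noteq> 0"
    using v(1) B(1) by (metis matrix_vector_mul_assoc matrix_vector_mul_lid matrix_vector_mult_0_right)
  moreover have "eval_at F (A *v v) = 0" using c v by simp
  ultimately obtain w where w: "Polynomial.coeff (on_line F (A *v v) w) 1 \<noteq> 0"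
    using assms(2) unfolding nonsingular_iff by blast
  have "on_line F (A *v v) (A *v (B *v w)) = Polynomial.smult c (on_line G v (B *v w))"
    using c(3) by (rule on_line_substitution)
  then have "Polynomial.coeff (on_line F (A *v v) w) 1 = c * Polynomial.coeff (on_line G v (B *v w)) 1"
    using B(2) by (simp add: matrix_vector_mul_assoc)
  with w show "\<exists>w. Polynomial.coeff (on_line G v w) 1 \<noteq> 0" by auto
qed

lemma carries_homogeneous:
  fixes F G :: "'k::field_char_0 ternary"
  assumes "carries A G F" "homogeneous d F"
  shows "homogeneous d G"
proof (rule homogeneousI)
  fix s v
  obtain c where c: "invertible A" "c \<noteq> 0" "\<And>v. eval_at F (A *v v) = c * eval_at G v"
    using assms(1) unfolding carries_iff by blast
  have "c * eval_at G (s *s v) = c * (s ^ d * eval_at G v)"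
    by (simp add: c(3)[symmetric] vector_scalar_commute homogeneous_eval_at[OF assms(2)])
  with c(2) show "eval_at G (s *s v) = s ^ d * eval_at G v" by simp
qed

text \<open>Only pure powers of \<open>X_i\<close> survive at the \<open>i\<close>-th coordinate
  point. If \<open>F\<close> vanishes there, some partial derivative does not, and the monomial
  responsible is \<open>X_i^(d-1) X_j\<close>; otherwise \<open>X_i^d\<close> occurs, which is the
  case \<open>j = i\<close>.\<close>

lemma nonsingular_coordinate_point:
  fixes F :: "'k::field_char_0 ternary"
  assumes F: "homogeneous d F" "nonsingular F" and d: "d \<ge> 1"
  obtains j where "Poly_Mapping.single i (d - 1) + Poly_Mapping.single j 1 \<in> keys F"
proof -
  let ?e = "axis i 1 :: 'k^3"
  have key: "m = Poly_Mapping.single i (\<Sum>j\<in>UNIV. lookup m j)" if "monom_at m ?e \<noteq> 0" for m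
  proof -
    have z: "lookup m j = 0" if "j \<noteq> i" for j
      using \<open>monom_at m ?e \<noteq> 0\<close> that by (auto simp: monom_at_def axis_def power_0_left split: if_splits)
    have "(\<Sum>j\<in>UNIV. lookup m j) = lookup m i"
      by (subst sum.remove[of _ i]) (auto intro!: sum.neutral z)
    then show ?thesis
      by (intro poly_mapping_eqI) (auto simp: lookup_single when_def z)
  qed
  show thesis
  proof (cases "eval_at F ?e = 0")
    case True
    have "?e \<noteq> 0" by (simp add: axis_eq_0_iff)
    with True F(2) obtain j where "eval_at (partial j F) ?e \<noteq> 0"
      unfolding nonsingular_def by blast
    then obtain m where m: "m \<in> keys F"
      and nz: "of_nat (lookup m j) * lookup F m * monom_at (m - Poly_Mapping.single j 1) ?e \<noteq> 0"
      unfolding eval_at_partial by (metis (no_types, lifting) sum.neutral)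
    then have mj: "lookup m j \<noteq> 0" "monom_at (m - Poly_Mapping.single j 1) ?e \<noteq> 0"
      by auto
    have split: "m = (m - Poly_Mapping.single j 1) + Poly_Mapping.single j 1"
      by (rule poly_mapping_eqI) (use mj in \<open>auto simp: lookup_add lookup_minus lookup_single when_def\<close>)
    have "(\<Sum>k\<in>UNIV. lookup m k) = d"
      using F(1) m by (simp add: homogeneous_def)
    then have "(\<Sum>k\<in>UNIV. lookup (m - Poly_Mapping.single j 1) k) = d - 1"
      by (subst (asm) split) (simp add: lookup_add sum.distrib lookup_single when_def sum.delta')
    with key[OF mj(2)] split have "m = Poly_Mapping.single i (d - 1) + Poly_Mapping.single j 1"
      by simp
    with m that show thesis by blast
  next
    case False
    then obtain m where m: "m \<in> keys F" "monom_at m ?e \<noteq> 0"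
      unfolding eval_at_superset[OF finite_keys order_refl]
      by (metis (no_types, lifting) mult_zero_right sum.neutral)
    have "(\<Sum>k\<in>UNIV. lookup m k) = d"
      using F(1) m by (simp add: homogeneous_def)
    with key[OF m(2)] have "m = Poly_Mapping.single i d" by simp
    also have "\<dots> = Poly_Mapping.single i (d - 1) + Poly_Mapping.single i 1"
      using d by (simp flip: single_add)
    finally show thesis using m that by blast
  qed
qed


section \<open>The automorphism group as a group of matrices modulo scalars\<close>

lemma mat_mult_left: "mat c ** A = (\<chi> i j. c * A $ i $ j)" for A :: "'a::comm_ring_1^'n^'n"
  by (simp add: matrix_matrix_mult_def mat_def vec_eq_iff if_distrib[of "\<lambda>x. x * _"] cong: if_cong)

lemma mat_mult_right: "A ** mat c = mat c ** A" for A :: "'a::comm_ring_1^'n^'n"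
  unfolding mat_mult_left
  by (simp add: matrix_matrix_mult_def mat_def vec_eq_iff if_distrib[of "\<lambda>x. _ * x"] mult.commute cong: if_cong)

lemma mat_mult_mat: "mat a ** mat b = (mat (a * b) :: 'a::comm_ring_1^'n^'n)"
  unfolding mat_mult_left by (simp add: mat_def vec_eq_iff)

lemma mat_mult_vector: "(mat c ** A) *v v = c *s (A *v v)" for A :: "'a::comm_ring_1^'n^'n"
  by (simp add: mat_mult_left matrix_vector_mult_def vec_eq_iff sum_distrib_left mult.assoc)

lemma invertible_mat: "c \<noteq> 0 \<Longrightarrow> invertible (mat c :: 'a::field^'n^'n)"
  unfolding invertible_def by (rule exI[of _ "mat (inverse c)"]) (simp add: mat_mult_mat)

lemma matrix_eq_if_mult_vector_eq: "(\<And>v. A *v v = B *v v) \<Longrightarrow> A = B" for A :: "'a::comm_ring_1^'n^'m"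
  by (simp add: matrix_eq)

lemma GL3_simps [simp]:
  "carrier GL3 = {A. invertible A}" "monoid.mult GL3 = (**)" "one GL3 = mat 1"
  by (simp_all add: GL3_def)

lemma group_GL3: "group (GL3 :: ('k::field^3^3) monoid)"
proof (rule groupI)
  fix A :: "'k^3^3" assume "A \<in> carrier GL3"
  then obtain B where "B ** A = mat 1" "A ** B = mat 1"
    by (auto simp: invertible_def)
  then show "\<exists>B\<in>carrier GL3. B \<otimes>\<^bsub>GL3\<^esub> A = \<one>\<^bsub>GL3\<^esub>"
    by (auto simp: invertible_def)
qed (simp_all add: invertible_mult matrix_mul_assoc invertible_mat)

lemma normal_scalar_matrices: "scalar_matrices \<lhd> (GL3 :: ('k::field^3^3) monoid)"
proof -
  interpret group "GL3 :: ('k^3^3) monoid" by (rule group_GL3)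
  have inv_mat: "inv\<^bsub>GL3\<^esub> mat c = (mat (inverse c) :: 'k^3^3)" if "c \<noteq> 0" for c :: 'k
    by (rule inv_equality) (use that in \<open>auto simp: mat_mult_mat invertible_mat\<close>)
  have "subgroup scalar_matrices (GL3 :: ('k^3^3) monoid)"
  proof (rule subgroupI)
    fix a :: "'k^3^3" assume "a \<in> scalar_matrices"
    then obtain c where c: "a = mat c" "c \<noteq> 0" by (auto simp: scalar_matrices_def)
    then show "inv\<^bsub>GL3\<^esub> a \<in> scalar_matrices"
      unfolding c(1) inv_mat[OF c(2)]
      unfolding scalar_matrices_def by (intro CollectI exI[of _ "inverse c"]) auto
  next
    fix a b :: "'k^3^3" assume "a \<in> scalar_matrices" "b \<in> scalar_matrices"
    then show "a \<otimes>\<^bsub>GL3\<^esub> b \<in> scalar_matrices"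
      by (auto simp: scalar_matrices_def mat_mult_mat intro: mult_not_zero)
  qed (auto simp: scalar_matrices_def invertible_mat intro: exI[of _ 1])
  then show ?thesis
    unfolding normal_inv_iff
  proof (intro conjI ballI)
    fix x h :: "'k^3^3" assume x: "x \<in> carrier GL3" and h: "h \<in> scalar_matrices"
    then have "x \<otimes>\<^bsub>GL3\<^esub> h \<otimes>\<^bsub>GL3\<^esub> inv\<^bsub>GL3\<^esub> x = h \<otimes>\<^bsub>GL3\<^esub> (x \<otimes>\<^bsub>GL3\<^esub> inv\<^bsub>GL3\<^esub> x)"
      by (auto simp: scalar_matrices_def mat_mult_right matrix_mul_assoc)
    also have "\<dots> = h" using x by (subst r_inv) auto
    finally show "x \<otimes>\<^bsub>GL3\<^esub> h \<otimes>\<^bsub>GL3\<^esub> inv\<^bsub>GL3\<^esub> x \<in> scalar_matrices" using h by simp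
  qed
qed

definition proj_class :: "'k::field^3^3 \<Rightarrow> ('k^3^3) set" where
  "proj_class A = scalar_matrices #>\<^bsub>GL3\<^esub> A"

lemma proj_class_eq: "proj_class A = {mat c ** A | c. c \<noteq> 0}"
  by (auto simp: proj_class_def r_coset_def scalar_matrices_def)

lemma self_in_proj_class: "A \<in> proj_class A"
  unfolding proj_class_eq by (auto intro!: exI[of _ 1])

lemma proj_class_scale: "c \<noteq> 0 \<Longrightarrow> proj_class (mat c ** A) = proj_class A"
  unfolding proj_class_eq
  apply (auto simp: matrix_mul_assoc mat_mult_mat)
  subgoal for b by (rule exI[of _ "b / c"]) (auto simp: matrix_mul_assoc mat_mult_mat)
  done

lemma proj_class_eq_iff: "proj_class A = proj_class B \<longleftrightarrow> (\<exists>c. c \<noteq> 0 \<and> A = mat c ** B)"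
proof
  assume "proj_class A = proj_class B"
  then have "A \<in> proj_class B" using self_in_proj_class by blast
  then show "\<exists>c. c \<noteq> 0 \<and> A = mat c ** B" by (auto simp: proj_class_eq)
qed (auto simp: proj_class_scale)

lemma carrier_PGL3: "carrier PGL3 = proj_class ` {A. invertible A}"
  by (auto simp: PGL3_def FactGroup_def RCOSETS_def proj_class_def)

lemma mult_PGL3:
  assumes "invertible A" "invertible B"
  shows "proj_class A \<otimes>\<^bsub>PGL3\<^esub> proj_class B = proj_class (A ** B)"
  using normal.rcos_sum[OF normal_scalar_matrices, of A B] assms
  by (simp add: PGL3_def FactGroup_def proj_class_def)

lemma one_PGL3: "\<one>\<^bsub>PGL3\<^esub> = proj_class (mat 1)"
  by (auto simp: PGL3_def FactGroup_def proj_class_eq scalar_matrices_def)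

text \<open>The preimage of the automorphism group in \<open>GL3\<close>, scalars included.
  Computations take place here and descend to classes afterwards.\<close>

definition auts :: "'k::field ternary \<Rightarrow> ('k^3^3) set" where
  "auts F = {A. carries A F F}"

lemma carries_mult:
  fixes F G H :: "'k::field_char_0 ternary"
  assumes "carries A G F" "carries B H G"
  shows "carries (A ** B) H F"
proof -
  obtain c where "invertible A" "c \<noteq> 0" "\<And>v. eval_at F (A *v v) = c * eval_at G v"
    using assms(1) unfolding carries_iff by blast
  moreover obtain c' where "invertible B" "c' \<noteq> 0" "\<And>v. eval_at G (B *v v) = c' * eval_at H v"
    using assms(2) unfolding carries_iff by blast
  ultimately show ?thesis
    unfolding carries_iff
    by (auto simp: invertible_mult simp flip: matrix_vector_mul_assoc intro!: exI[of _ "c * c'"])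
qed

lemma carries_inverse:
  fixes F G :: "'k::field_char_0 ternary"
  assumes "carries A G F" "A ** B = mat 1"
  shows "carries B F G"
proof -
  obtain c where c: "invertible A" "c \<noteq> 0" "\<And>v. eval_at F (A *v v) = c * eval_at G v"
    using assms(1) unfolding carries_iff by blast
  have "invertible B"
    using assms(2) matrix_left_right_inverse[of A B] unfolding invertible_def by blast
  moreover have "eval_at G (B *v v) = inverse c * eval_at F v" for v
    using c(2) c(3)[of "B *v v"] assms(2) by (simp add: matrix_vector_mul_assoc)
  ultimately show ?thesis
    unfolding carries_iff using c(2) by (intro conjI exI[of _ "inverse c"]) auto
qed

lemma mat_in_auts:
  fixes F :: "'k::field_char_0 ternary"
  assumes "homogeneous d F" "c \<noteq> 0"
  shows "mat c \<in> auts F"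
proof -
  have "mat c *v v = c *s v" for v :: "'k^3"
    using mat_mult_vector[of c "mat 1" v] by simp
  then show ?thesis
    unfolding auts_def carries_iff
    using assms by (auto simp: invertible_mat homogeneous_eval_at intro!: exI[of _ "c ^ d"])
qed

lemma auts_invertible: "A \<in> auts F \<Longrightarrow> invertible A"
  by (simp add: auts_def carries_def)

lemma auts_mult: "A \<in> auts F \<Longrightarrow> B \<in> auts F \<Longrightarrow> A ** B \<in> auts F"
  for F :: "'k::field_char_0 ternary"
  unfolding auts_def using carries_mult by blast

lemma carries_id: "carries (mat 1) F F" for F :: "'k::field_char_0 ternary"
  unfolding carries_iff by (auto simp: invertible_mat intro!: exI[of _ 1])

lemma carrier_Aut_curve: "carrier (Aut_curve F) = proj_class ` auts F"
proof -
  have "\<exists>A\<in>auts F. S = proj_class A" if S: "S \<in> carrier PGL3" "A \<in> S" "carries A F F" for S A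
  proof -
    obtain B where B: "S = proj_class B" "invertible B" using S(1) by (auto simp: carrier_PGL3)
    then have "A \<in> proj_class B" using S by simp
    then obtain c where "c \<noteq> 0" "A = mat c ** B" by (auto simp: proj_class_eq)
    then have "proj_class A = S" using B by (simp add: proj_class_scale)
    with S show ?thesis by (auto simp: auts_def)
  qed
  moreover have "proj_class A \<in> carrier PGL3 \<and> A \<in> proj_class A" if "A \<in> auts F" for A
    using that auts_invertible by (auto simp: carrier_PGL3 self_in_proj_class)
  ultimately have "S \<in> carrier (Aut_curve F) \<longleftrightarrow> S \<in> proj_class ` auts F" for S
    unfolding Aut_curve_def auts_def by auto
  then show ?thesis by blast
qed

lemma mult_Aut_curve:
  assumes "A \<in> auts F" "B \<in> auts F"
  shows "proj_class A \<otimes>\<^bsub>Aut_curve F\<^esub> proj_class B = proj_class (A ** B)"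
  using mult_PGL3[of A B] assms by (simp add: Aut_curve_def auts_invertible)

lemma one_Aut_curve: "\<one>\<^bsub>Aut_curve F\<^esub> = proj_class (mat 1)"
  by (simp add: Aut_curve_def one_PGL3)

lemma group_Aut_curve: "group (Aut_curve F)" for F :: "'k::field_char_0 ternary"
proof (rule groupI)
  fix x y assume "x \<in> carrier (Aut_curve F)" "y \<in> carrier (Aut_curve F)"
  then show "x \<otimes>\<^bsub>Aut_curve F\<^esub> y \<in> carrier (Aut_curve F)"
    by (auto simp: carrier_Aut_curve mult_Aut_curve auts_mult)
next
  show "\<one>\<^bsub>Aut_curve F\<^esub> \<in> carrier (Aut_curve F)"
    by (auto simp: one_Aut_curve carrier_Aut_curve auts_def carries_id)
next
  fix x y z
  assume "x \<in> carrier (Aut_curve F)" "y \<in> carrier (Aut_curve F)" "z \<in> carrier (Aut_curve F)"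
  then show "x \<otimes>\<^bsub>Aut_curve F\<^esub> y \<otimes>\<^bsub>Aut_curve F\<^esub> z = x \<otimes>\<^bsub>Aut_curve F\<^esub> (y \<otimes>\<^bsub>Aut_curve F\<^esub> z)"
    by (auto simp: carrier_Aut_curve mult_Aut_curve auts_mult matrix_mul_assoc)
next
  fix x assume "x \<in> carrier (Aut_curve F)"
  then show "\<one>\<^bsub>Aut_curve F\<^esub> \<otimes>\<^bsub>Aut_curve F\<^esub> x = x"
    by (auto simp: carrier_Aut_curve mult_Aut_curve one_Aut_curve auts_def carries_id)
next
  fix x assume "x \<in> carrier (Aut_curve F)"
  then obtain A where A: "x = proj_class A" "A \<in> auts F" by (auto simp: carrier_Aut_curve)
  then obtain B where B: "B ** A = mat 1" "A ** B = mat 1"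
    using auts_invertible[of A F] by (auto simp: invertible_def)
  then have "B \<in> auts F" using A carries_inverse by (auto simp: auts_def)
  then show "\<exists>y\<in>carrier (Aut_curve F). y \<otimes>\<^bsub>Aut_curve F\<^esub> x = \<one>\<^bsub>Aut_curve F\<^esub>"
    using A B by (intro bexI[of _ "proj_class B"]) (auto simp: carrier_Aut_curve mult_Aut_curve one_Aut_curve)
qed

lemma invertible_pow_GL3: "invertible A \<Longrightarrow> invertible (A [^]\<^bsub>GL3\<^esub> (n::nat))"
  using monoid.nat_pow_closed[OF group.is_monoid[OF group_GL3], of A n] by simp

lemma pow_auts: "A \<in> auts F \<Longrightarrow> A [^]\<^bsub>GL3\<^esub> (n::nat) \<in> auts F" for F :: "'k::field_char_0 ternary"
  by (induction n) (auto simp: auts_mult auts_def carries_id carries_mult)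

lemma pow_Aut_curve:
  fixes F :: "'k::field_char_0 ternary"
  assumes "A \<in> auts F"
  shows "proj_class A [^]\<^bsub>Aut_curve F\<^esub> (n::nat) = proj_class (A [^]\<^bsub>GL3\<^esub> n)"
  by (induction n) (auto simp: assms one_Aut_curve mult_Aut_curve pow_auts)

text \<open>The order in \<open>PGL3\<close> is governed by the powers of a representative that are
  scalar; this is how the order hypothesis turns into divisibility.\<close>

lemma proj_class_pow_eq_one_iff:
  fixes F :: "'k::field_char_0 ternary"
  assumes "A \<in> auts F"
  shows "group.ord (Aut_curve F) (proj_class A) dvd n \<longleftrightarrow> (\<exists>c. c \<noteq> 0 \<and> A [^]\<^bsub>GL3\<^esub> n = mat c)"
proof -
  have "proj_class A \<in> carrier (Aut_curve F)"
    using assms by (auto simp: carrier_Aut_curve)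
  from group.pow_eq_id[OF group_Aut_curve this, of n] show ?thesis
    by (simp add: pow_Aut_curve assms one_Aut_curve proj_class_eq_iff)
qed

lemma isomorphic_Aut_curve:
  fixes F G :: "'k::field_char_0 ternary"
  assumes "carries A G F"
  shows "Aut_curve G \<cong> Aut_curve F"
proof -
  obtain B where B: "B ** A = mat 1" "A ** B = mat 1"
    using assms unfolding carries_def invertible_def by blast
  have inv: "invertible A" "invertible B" using B unfolding invertible_def by blast+
  have BF: "carries B F G" using carries_inverse[OF assms B(2)] .
  \<comment> \<open>Conjugation, multiplied out in \<open>PGL3\<close> itself, so that no
    representative of the class \<open>S\<close> has to be chosen.\<close>
  define h where "h P Q S = proj_class P \<otimes>\<^bsub>PGL3\<^esub> S \<otimes>\<^bsub>PGL3\<^esub> proj_class Q" for P Q :: "'k^3^3" and S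
  have h: "h P Q (proj_class X) = proj_class (P ** X ** Q)" if "invertible P" "invertible Q" "invertible X" for P Q X
    using that by (simp add: h_def mult_PGL3 invertible_mult)
  have hA: "A ** X ** B \<in> auts F" if "X \<in> auts G" for X
    using that carries_mult[OF carries_mult[OF assms] BF] by (auto simp: auts_def)
  have hB: "B ** X ** A \<in> auts G" if "X \<in> auts F" for X
    using that carries_mult[OF carries_mult[OF BF] assms] by (auto simp: auts_def)
  have cancel: "A ** (B ** X) = X" "B ** (A ** X) = X" for X :: "'k^3^3"
    using B by (simp_all add: matrix_mul_assoc)
  have "h A B \<in> iso (Aut_curve G) (Aut_curve F)"
  proof (rule isoI)
    show "h A B \<in> hom (Aut_curve G) (Aut_curve F)"
    proof (rule homI)
      fix x y assume "x \<in> carrier (Aut_curve G)" "y \<in> carrier (Aut_curve G)"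
      then obtain X Y where X: "x = proj_class X" "X \<in> auts G" and Y: "y = proj_class Y" "Y \<in> auts G"
        by (auto simp: carrier_Aut_curve)
      have "A ** (X ** Y) ** B = A ** X ** B ** (A ** Y ** B)"
        by (simp add: cancel flip: matrix_mul_assoc)
      moreover have "invertible X" "invertible Y" "invertible (X ** Y)"
        using X Y by (auto simp: auts_invertible invertible_mult)
      ultimately show "h A B (x \<otimes>\<^bsub>Aut_curve G\<^esub> y) = h A B x \<otimes>\<^bsub>Aut_curve F\<^esub> h A B y"
        using X Y hA by (simp add: mult_Aut_curve h inv)
    qed (auto simp: carrier_Aut_curve h inv auts_invertible hA)
    have "h B A (h A B x) = x" if "x \<in> carrier (Aut_curve G)" for x
    proof -
      obtain X where X: "x = proj_class X" "X \<in> auts G"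
        using \<open>x \<in> carrier (Aut_curve G)\<close> by (auto simp: carrier_Aut_curve)
      have "B ** (A ** X ** B) ** A = X"
        by (simp add: cancel B flip: matrix_mul_assoc)
      then show ?thesis
        using X auts_invertible[OF hA[OF X(2)]] by (simp add: h inv auts_invertible)
    qed
    moreover have "h A B (h B A x) = x" if "x \<in> carrier (Aut_curve F)" for x
    proof -
      obtain X where X: "x = proj_class X" "X \<in> auts F"
        using \<open>x \<in> carrier (Aut_curve F)\<close> by (auto simp: carrier_Aut_curve)
      have "A ** (B ** X ** A) ** B = X"
        by (simp add: cancel B flip: matrix_mul_assoc)
      then show ?thesis
        using X auts_invertible[OF hB[OF X(2)]] by (simp add: h inv auts_invertible)
    qed
    ultimately show "bij_betw (h A B) (carrier (Aut_curve G)) (carrier (Aut_curve F))"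
      by (intro bij_betw_byWitness[where f' = "h B A"])
        (auto simp: carrier_Aut_curve h inv auts_invertible hA hB)
  qed
  then show ?thesis by (auto simp: is_iso_def)
qed

lemma central_extension_iso:
  assumes "central_extension E Q N" "E \<cong> E'" "group E'"
  shows "central_extension E' Q N"
proof -
  have E: "group E" "group Q" "group N" using assms(1) by (simp_all add: central_extension_def)
  obtain f g where fg: "f \<in> mon N E \<and> g \<in> epi E Q \<and> kernel E Q g = f ` carrier N \<and>
      (\<forall>n\<in>carrier N. \<forall>x\<in>carrier E. f n \<otimes>\<^bsub>E\<^esub> x = x \<otimes>\<^bsub>E\<^esub> f n)"
    using assms(1) unfolding central_extension_def
    by (elim conjE exE) (rule that, intro conjI)
  then have f: "f \<in> mon N E" and g: "g \<in> epi E Q" and ker: "kernel E Q g = f ` carrier N"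
    by simp_all
  have com: "f n \<otimes>\<^bsub>E\<^esub> x = x \<otimes>\<^bsub>E\<^esub> f n" if "n \<in> carrier N" "x \<in> carrier E" for n x
    using fg that by simp
  obtain h where h: "h \<in> iso E E'" using assms(2) by (auto simp: is_iso_def)
  let ?k = "inv_into (carrier E) h"
  have k: "?k \<in> iso E' E" using group.iso_set_sym[OF E(1) h] .
  have hom: "f \<in> hom N E" "g \<in> hom E Q" "h \<in> hom E E'" "?k \<in> hom E' E"
    using f g h k by (auto simp: mon_def epi_def iso_def)
  have bij: "bij_betw h (carrier E) (carrier E')" "bij_betw ?k (carrier E') (carrier E)"
    using h k by (auto simp: iso_def)
  have kh: "?k (h x) = x" if "x \<in> carrier E" for x
    using that bij(1) by (simp add: bij_betw_def)
  have hk: "h (?k x) = x" if "x \<in> carrier E'" for x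
    using that bij(1) by (simp add: bij_betw_def f_inv_into_f)
  have fN: "f n \<in> carrier E" if "n \<in> carrier N" for n
    using hom(1) that by (auto simp: hom_def)
  have kE: "?k x \<in> carrier E" if "x \<in> carrier E'" for x
    using hom(4) that by (auto simp: hom_def)
  have hE: "h x \<in> carrier E'" if "x \<in> carrier E" for x
    using hom(3) that by (auto simp: hom_def)
  have "f ` carrier N \<subseteq> carrier E" using fN by blast
  then have "inj_on h (f ` carrier N)"
    using bij_betw_imp_inj_on[OF bij(1)] by (rule inj_on_subset[rotated])
  moreover have "inj_on f (carrier N)" using f by (simp add: mon_def)
  ultimately have "inj_on (h \<circ> f) (carrier N)" by (simp add: comp_inj_on)
  then have 1: "h \<circ> f \<in> mon N E'"
    using hom_compose[OF hom(1,3)] by (simp add: mon_def)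
  have "(g \<circ> ?k) ` carrier E' = g ` carrier E"
    using bij_betw_imp_surj_on[OF bij(2)] by (simp only: image_comp[symmetric])
  then have 2: "g \<circ> ?k \<in> epi E' Q"
    using g hom_compose[OF hom(4,2)] by (simp add: epi_def)
  have 3: "kernel E' Q (g \<circ> ?k) = (h \<circ> f) ` carrier N"
  proof -
    have "kernel E' Q (g \<circ> ?k) = h ` kernel E Q g"
    proof (intro equalityI subsetI)
      fix x assume "x \<in> kernel E' Q (g \<circ> ?k)"
      then have "x = h (?k x)" "?k x \<in> kernel E Q g"
        using hk kE by (auto simp: kernel_def)
      then show "x \<in> h ` kernel E Q g" by blast
    next
      fix x assume "x \<in> h ` kernel E Q g"
      then show "x \<in> kernel E' Q (g \<circ> ?k)"
        using kh hE by (auto simp: kernel_def)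
    qed
    then show ?thesis by (simp add: ker image_comp)
  qed
  have 4: "(h \<circ> f) n \<otimes>\<^bsub>E'\<^esub> x = x \<otimes>\<^bsub>E'\<^esub> (h \<circ> f) n" if "n \<in> carrier N" "x \<in> carrier E'" for n x
  proof -
    have "h (f n \<otimes>\<^bsub>E\<^esub> ?k x) = h (?k x \<otimes>\<^bsub>E\<^esub> f n)"
      using com that kE by simp
    then show ?thesis
      using that hom(3) kE fN hk by (simp add: hom_mult)
  qed
  show ?thesis
    unfolding central_extension_def
    by (intro conjI E(2,3) assms(3) exI[of _ "h \<circ> f"] exI[of _ "g \<circ> ?k"] ballI 1 2 3 4)
qed

text \<open>Reduces an extension of classes to conditions on matrices: \<open>\<Phi>\<close> is a
  homomorphism on the preimage that ignores scalars, and \<open>\<psi>\<close> lifts the central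
  subgroup to matrices, injectively even modulo scalars. The dihedral and the octahedral case both
  go through it.\<close>

lemma central_extension_Aut_curve:
  fixes F :: "'k::field_char_0 ternary" and \<Phi> :: "'k^3^3 \<Rightarrow> 'q" and \<psi> :: "'n \<Rightarrow> 'k^3^3"
  assumes hom_F: "homogeneous d F" and groups: "group Q" "group N"
    and \<Phi>_closed: "\<And>A. A \<in> auts F \<Longrightarrow> \<Phi> A \<in> carrier Q"
    and \<Phi>_mult: "\<And>A B. A \<in> auts F \<Longrightarrow> B \<in> auts F \<Longrightarrow> \<Phi> (A ** B) = \<Phi> A \<otimes>\<^bsub>Q\<^esub> \<Phi> B"
    and \<Phi>_scale: "\<And>A c. A \<in> auts F \<Longrightarrow> c \<noteq> 0 \<Longrightarrow> \<Phi> (mat c ** A) = \<Phi> A"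
    and \<Phi>_onto: "\<And>q. q \<in> carrier Q \<Longrightarrow> \<exists>A\<in>auts F. \<Phi> A = q"
    and \<psi>_auts: "\<And>n. n \<in> carrier N \<Longrightarrow> \<psi> n \<in> auts F"
    and \<psi>_mult: "\<And>m n. m \<in> carrier N \<Longrightarrow> n \<in> carrier N \<Longrightarrow> \<psi> (m \<otimes>\<^bsub>N\<^esub> n) = \<psi> m ** \<psi> n"
    and \<psi>_inj: "\<And>m n c. m \<in> carrier N \<Longrightarrow> n \<in> carrier N \<Longrightarrow> \<psi> m = mat c ** \<psi> n \<Longrightarrow> m = n"
    and \<psi>_central: "\<And>n A. n \<in> carrier N \<Longrightarrow> A \<in> auts F \<Longrightarrow> \<psi> n ** A = A ** \<psi> n"
    and kernel: "\<And>A. A \<in> auts F \<Longrightarrow> \<Phi> A = \<one>\<^bsub>Q\<^esub> \<longleftrightarrow> (\<exists>n\<in>carrier N. \<exists>c. c \<noteq> 0 \<and> A = mat c ** \<psi> n)"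
  shows "central_extension (Aut_curve F) Q N"
proof -
  \<comment> \<open>An arbitrary representative is picked; \<open>\<Phi>_scale\<close> makes the
    value independent of the choice.\<close>
  define g where "g S = \<Phi> (SOME A. S = proj_class A \<and> A \<in> auts F)" for S
  have g: "g (proj_class A) = \<Phi> A" if "A \<in> auts F" for A
  proof -
    define B where "B = (SOME B. proj_class A = proj_class B \<and> B \<in> auts F)"
    have B: "proj_class A = proj_class B \<and> B \<in> auts F"
      unfolding B_def by (rule someI[of _ A]) (simp add: that)
    then obtain c where "c \<noteq> 0" "A = mat c ** B"
      unfolding proj_class_eq_iff by blast
    then have "\<Phi> A = \<Phi> B" using B \<Phi>_scale by simp
    then show ?thesis by (simp add: g_def B_def)
  qed
  let ?f = "\<lambda>n. proj_class (\<psi> n)"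
  have "?f \<in> mon N (Aut_curve F)"
    using \<psi>_inj by (auto simp: mon_def hom_def carrier_Aut_curve mult_Aut_curve \<psi>_auts \<psi>_mult inj_on_def proj_class_eq_iff)
  moreover have "g \<in> epi (Aut_curve F) Q"
  proof -
    have "g \<in> hom (Aut_curve F) Q"
      by (rule homI) (auto simp: carrier_Aut_curve mult_Aut_curve g \<Phi>_closed \<Phi>_mult auts_mult)
    moreover have "g ` carrier (Aut_curve F) = carrier Q"
      using \<Phi>_onto \<Phi>_closed g by (force simp: carrier_Aut_curve)
    ultimately show ?thesis by (simp add: epi_def)
  qed
  moreover have "kernel (Aut_curve F) Q g = ?f ` carrier N"
  proof -
    have "S \<in> kernel (Aut_curve F) Q g \<longleftrightarrow> S \<in> ?f ` carrier N" for S
    proof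
      assume "S \<in> kernel (Aut_curve F) Q g"
      then obtain A where "S = proj_class A" "A \<in> auts F" "\<Phi> A = \<one>\<^bsub>Q\<^esub>"
        by (auto simp: kernel_def carrier_Aut_curve g)
      then show "S \<in> ?f ` carrier N"
        using kernel by (auto simp: proj_class_scale)
    next
      assume "S \<in> ?f ` carrier N"
      then obtain n where n: "n \<in> carrier N" "S = proj_class (\<psi> n)" by blast
      have "\<exists>m\<in>carrier N. \<exists>c. c \<noteq> 0 \<and> \<psi> n = mat c ** \<psi> m"
        by (rule bexI[OF _ n(1)], rule exI[of _ 1]) simp
      then have "\<Phi> (\<psi> n) = \<one>\<^bsub>Q\<^esub>"
        by (simp only: kernel[OF \<psi>_auts[OF n(1)]])
      then show "S \<in> kernel (Aut_curve F) Q g"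
        using n \<psi>_auts[OF n(1)] by (simp add: kernel_def carrier_Aut_curve g)
    qed
    then show ?thesis by blast
  qed
  moreover have "?f n \<otimes>\<^bsub>Aut_curve F\<^esub> x = x \<otimes>\<^bsub>Aut_curve F\<^esub> ?f n"
    if "n \<in> carrier N" "x \<in> carrier (Aut_curve F)" for n x
    using that by (auto simp: carrier_Aut_curve mult_Aut_curve \<psi>_auts \<psi>_central)
  ultimately show ?thesis
    unfolding central_extension_def
    by (intro conjI groups group_Aut_curve exI[of _ ?f] exI[of _ g] ballI) simp_all
qed


section \<open>Roots of unity and diagonalization\<close>

text \<open>Multiplicative order exactly \<open>n\<close>, expressed through divisibility because
  orders are compared in this form throughout.\<close>

definition primitive_root :: "nat \<Rightarrow> 'a::field \<Rightarrow> bool" where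
  "primitive_root n w \<longleftrightarrow> (\<forall>k. w ^ k = 1 \<longleftrightarrow> n dvd k)"

lemma primitive_rootD: "primitive_root n w \<Longrightarrow> w ^ k = 1 \<longleftrightarrow> n dvd k"
  by (simp add: primitive_root_def)

lemma primitive_root_nz: "primitive_root n w \<Longrightarrow> n > 0 \<Longrightarrow> w \<noteq> 0"
  using primitive_rootD[of n w n] by (auto simp: power_0_left)

lemma prime_dvd_of_power_eq_1:
  fixes x :: "'a::field"
  assumes "prime p" "x ^ p = 1" "x \<noteq> 1" "x ^ j = 1"
  shows "p dvd j"
proof (rule ccontr)
  assume "\<not> p dvd j"
  with assms(1) have "gcd p j = 1" by (intro coprime_imp_gcd_eq_1 prime_imp_coprime)
  moreover obtain a b where "p * a = j * b + gcd p j"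
    using bezout_nat[of p j] assms(1) by (auto simp: prime_gt_0_nat)
  ultimately have "x ^ (p * a) = x ^ (j * b) * x" by simp
  with assms show False by (simp add: power_mult)
qed

text \<open>A zero of \<open>1 + x + ... + x^(p-1)\<close> works: the geometric sum gives
  \<open>x^p = 1\<close>, and at \<open>x = 1\<close> the sum is \<open>p\<close>, nonzero in
  characteristic zero.\<close>

lemma primitive_prime_root_exists:
  assumes "prime p"
  obtains w :: "'a::{alg_closed_field, field_char_0}" where "w ^ p = 1" "w \<noteq> 1"
proof -
  obtain q where q: "p = Suc q" "q > 0"
    using prime_gt_1_nat[OF assms] by (metis Suc_lessE less_Suc_eq_0_disj not_less_zero gr0I One_nat_def)
  obtain x :: 'a where x: "(\<Sum>k\<le>q. 1 * x ^ k) = 0"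
    using alg_closed[of q "\<lambda>_. 1"] q by auto
  have "(x - 1) * (\<Sum>k<p. x ^ k) = x ^ p - 1" by (rule power_diff_1_eq[symmetric])
  with x q have "x ^ p = 1" by (simp add: lessThan_Suc_atMost)
  moreover have "x \<noteq> 1"
  proof
    assume "x = 1"
    with x have "of_nat (Suc q) = (0::'a)" by simp
    then show False by (simp only: of_nat_eq_0_iff)
  qed
  ultimately show thesis using that by blast
qed

text \<open>Induction along \<open>n = p * m\<close> with \<open>p\<close> prime: a
  \<open>p\<close>-th root \<open>y\<close> of a primitive \<open>m\<close>-th root of unity has
  order \<open>n\<close> as soon as \<open>y^m\<close> is not 1, since \<open>y^m\<close> is then a
  nontrivial \<open>p\<close>-th root of unity.\<close>

lemma primitive_root_exists:
  assumes "n > 0"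
  obtains w :: "'a::{alg_closed_field, field_char_0}" where "primitive_root n w"
proof -
  have "\<exists>w :: 'a. primitive_root n w"
    using assms
  proof (induction n rule: less_induct)
    case (less n)
    show ?case
    proof (cases "n = 1")
      case True
      then show ?thesis by (intro exI[of _ 1]) (simp add: primitive_root_def)
    next
      case False
      then obtain p where p: "prime p" "p dvd n" using prime_factor_nat by blast
      then obtain m where m: "n = p * m" by blast
      have "m > 0" "m < n"
        using less.prems m prime_gt_1_nat[OF p(1)] by auto
      then obtain z :: 'a where z: "primitive_root m z" using less.IH by blast
      obtain y0 where y0: "y0 ^ p = z" using nth_root_exists prime_gt_0_nat[OF p(1)] by blast
      obtain w :: 'a where w: "w ^ p = 1" "w \<noteq> 1" using primitive_prime_root_exists[OF p(1)] .
      \<comment> \<open>If \<open>p\<close> divides \<open>m\<close>, every \<open>p\<close>-th root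
        of \<open>z\<close> qualifies; otherwise a bad one is corrected by a nontrivial
        \<open>p\<close>-th root of unity.\<close>
      have "\<exists>y. y ^ p = z \<and> y ^ m \<noteq> 1"
      proof (cases "p dvd m")
        case True
        then obtain l where l: "m = p * l" by blast
        have "y0 ^ m = z ^ l" by (simp add: l power_mult y0)
        moreover have "\<not> m dvd l"
          using l \<open>m > 0\<close> prime_gt_1_nat[OF p(1)] by (auto dest: dvd_imp_le)
        ultimately show ?thesis using y0 primitive_rootD[OF z] by metis
      next
        case False
        then have "w ^ m \<noteq> 1" using prime_dvd_of_power_eq_1[OF p(1) w] by blast
        then show ?thesis
          using y0 w by (cases "y0 ^ m = 1") (auto simp: power_mult_distrib intro: exI[of _ "y0 * w"])
      qed
      then obtain y where y: "y ^ p = z" "y ^ m \<noteq> 1" by blast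
      have zm: "z ^ m = 1" using primitive_rootD[OF z] by simp
      have "y ^ k = 1 \<longleftrightarrow> n dvd k" for k
      proof
        assume k: "y ^ k = 1"
        have "z ^ k = (y ^ k) ^ p" unfolding y(1)[symmetric] by (metis power_mult mult.commute)
        with k have "m dvd k" using primitive_rootD[OF z] by simp
        then obtain j where j: "k = m * j" by blast
        have "(y ^ m) ^ p = 1" by (metis power_mult mult.commute y(1) zm)
        with y(2) k j have "p dvd j"
          using prime_dvd_of_power_eq_1[OF p(1), of "y ^ m" j] by (simp add: power_mult)
        with j m show "n dvd k" by auto
      next
        assume "n dvd k"
        then obtain j where "k = n * j" by blast
        then have "y ^ k = (z ^ m) ^ j" by (simp add: m y(1) power_mult)
        then show "y ^ k = 1" by (simp add: zm)
      qed
      then show ?thesis by (auto simp: primitive_root_def)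
    qed
  qed
  then show thesis using that by blast
qed

lemma primitive_root_inj:
  assumes "primitive_root n w" "i < n" "j < n" "w ^ i = w ^ j"
  shows "i = j"
proof -
  have *: "i = j" if "i \<le> j" "j < n" "w ^ i = w ^ j" for i j
  proof -
    have "w \<noteq> 0" using primitive_root_nz assms(1) that by fastforce
    then have "w ^ (j - i) = 1" using that by (simp add: power_diff)
    then have "n dvd j - i" using primitive_rootD[OF assms(1)] by blast
    with that show ?thesis by (cases "j - i = 0") (auto dest: dvd_imp_le)
  qed
  show ?thesis using *[of i j] *[of j i] assms by (metis nat_le_linear)
qed

text \<open>Counting: the \<open>n\<close> distinct powers of \<open>w\<close> exhaust the at most
  \<open>n\<close> zeros of \<open>x^n - 1\<close>.\<close>

lemma primitive_root_power_of_unity: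
  fixes w :: "'a::field"
  assumes w: "primitive_root n w" and n: "n > 0" and x: "x ^ n = 1"
  obtains k where "k < n" "x = w ^ k"
proof -
  let ?p = "Polynomial.monom 1 n - 1 :: 'a poly"
  let ?R = "{x :: 'a. x ^ n = 1}" and ?W = "(\<lambda>k. w ^ k) ` {..<n}"
  have "Polynomial.coeff ?p n = 1" using n by simp
  then have p: "?p \<noteq> 0" by (metis coeff_0 zero_neq_one)
  have deg: "Polynomial.degree ?p \<le> n"
    by (rule degree_diff_le) (simp_all add: degree_monom_le)
  have R: "?R = {x. poly ?p x = 0}" by (simp add: poly_monom)
  have fin: "finite ?R" unfolding R using p by (rule poly_roots_finite)
  have "card ?R \<le> n" unfolding R using card_poly_roots_bound[OF p] deg by linarith
  moreover have "?W \<subseteq> ?R"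
    using primitive_rootD[OF w, of n] by (auto simp: power_mult power_mult[symmetric] mult.commute[of _ n])
  moreover have "card ?W = n"
    using primitive_root_inj[OF w] by (subst card_image) (auto simp: inj_on_def)
  ultimately have "?W = ?R" using fin card_mono[OF fin, of ?W] by (intro card_subset_eq) simp_all
  with x that show thesis by blast
qed

lemma sum_primitive_root_powers:
  fixes w :: "'a::field"
  assumes w: "primitive_root n w" and k: "\<not> n dvd k"
  shows "(\<Sum>j<n. (w ^ k) ^ j) = 0"
proof -
  have "(w ^ k - 1) * (\<Sum>j<n. (w ^ k) ^ j) = (w ^ k) ^ n - 1" by (rule power_diff_1_eq[symmetric])
  also have "(w ^ k) ^ n = 1" using primitive_rootD[OF w, of "k * n"] by (simp add: power_mult)
  finally show ?thesis using primitive_rootD[OF w, of k] k by simp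
qed

section \<open>Diagonal matrices and diagonalization of matrices with a scalar power\<close>

definition diag_matrix :: "('n \<Rightarrow> 'a) \<Rightarrow> 'a::zero^'n^'n" where
  "diag_matrix a = (\<chi> i j. if i = j then a i else 0)"

lemma diag_matrix_mult_vector: "diag_matrix a *v v = (\<chi> i. a i * v $ i)" for a :: "'n::finite \<Rightarrow> 'a::semiring_1"
  by (simp add: diag_matrix_def matrix_vector_mult_def if_distrib[of "\<lambda>x. x * _"] cong: if_cong)

lemma diag_matrix_mult: "diag_matrix a ** diag_matrix b = diag_matrix (\<lambda>i. a i * b i)"
  for a :: "'n::finite \<Rightarrow> 'a::comm_ring_1"
  by (rule matrix_eq_if_mult_vector_eq)
    (simp add: diag_matrix_mult_vector mult.assoc flip: matrix_vector_mul_assoc)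

lemma diag_matrix_const: "diag_matrix (\<lambda>_. c) = mat c"
  by (simp add: diag_matrix_def mat_def)

lemma diag_matrix_inject: "diag_matrix a = diag_matrix b \<longleftrightarrow> a = b"
  by (auto simp: diag_matrix_def vec_eq_iff fun_eq_iff split: if_splits)

lemma pow_diag_matrix: "diag_matrix a [^]\<^bsub>GL3\<^esub> (n::nat) = diag_matrix (\<lambda>i. a i ^ n)"
  by (induction n) (simp_all add: diag_matrix_mult diag_matrix_const mult.commute)

lemma invertible_diag_matrix:
  fixes a :: "'n::finite \<Rightarrow> 'a::field"
  shows "invertible (diag_matrix a) \<longleftrightarrow> (\<forall>i. a i \<noteq> 0)"
proof
  assume "\<forall>i. a i \<noteq> 0"
  then show "invertible (diag_matrix a)"
    unfolding invertible_def
    by (intro exI[of _ "diag_matrix (\<lambda>i. inverse (a i))"]) (simp add: diag_matrix_mult flip: diag_matrix_const)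
next
  assume "invertible (diag_matrix a)"
  then obtain B where B: "B ** diag_matrix a = mat 1" by (auto simp: invertible_def)
  show "\<forall>i. a i \<noteq> 0"
  proof (intro allI notI)
    fix i assume "a i = 0"
    then have "diag_matrix a *v axis i 1 = 0"
      by (simp add: diag_matrix_mult_vector vec_eq_iff axis_def)
    then have "mat 1 *v axis i 1 = (0 :: 'a^'n)"
      by (simp flip: B matrix_vector_mul_assoc)
    then show False by (simp add: axis_eq_0_iff)
  qed
qed

text \<open>Discrete Fourier decomposition: for each \<open>m\<close>-th root \<open>r w^j\<close>
  of \<open>c\<close>, the vector \<open>u j\<close>, the sum of \<open>(r w^j)^(-k) A^k v\<close>
  over \<open>k < m\<close>, is mapped by \<open>A\<close> to \<open>r w^j\<close> times itself. By
  orthogonality the \<open>u j\<close> add up to \<open>m v\<close>, and \<open>m\<close> is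
  invertible in characteristic zero.\<close>

lemma eigenvector_sum:
  fixes A :: "'k::{alg_closed_field, field_char_0}^3^3" and m :: nat
  assumes A: "A [^]\<^bsub>GL3\<^esub> m = mat c" and m: "m > 0" and c: "c \<noteq> 0"
  shows "v \<in> vec.span {v. \<exists>\<mu>. A *v v = \<mu> *s v}"
proof -
  obtain w :: 'k where w: "primitive_root m w" using primitive_root_exists[OF m] .
  obtain r :: 'k where r: "r ^ m = c" using nth_root_exists[OF m] by blast
  have nz: "w \<noteq> 0" "r \<noteq> 0" using primitive_root_nz[OF w m] r c m by (auto simp: power_0_left)
  define P where "P k = A [^]\<^bsub>GL3\<^esub> k *v v" for k :: nat
  have AP: "A *v P k = P (Suc k)" for k
  proof -
    have "A ** A [^]\<^bsub>GL3\<^esub> k = A [^]\<^bsub>GL3\<^esub> k ** A"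
      by (induction k) (simp_all add: matrix_mul_assoc)
    then show ?thesis by (simp add: P_def matrix_vector_mul_assoc)
  qed
  define s where "s j = inverse (r * w ^ j)" for j
  have s: "s j \<noteq> 0" for j using nz by (simp add: s_def)
  have s_m: "s j ^ m = inverse c" for j
    using primitive_rootD[OF w, of "j * m"] by (simp add: s_def power_inverse r power_mult_distrib power_mult)
  define u where "u j = (\<Sum>k<m. s j ^ k *s P k)" for j
  have P_m: "P m = c *s v"
    using mat_mult_vector[of c "mat 1" v] by (simp add: P_def A)
  have "A *v u j = inverse (s j) *s u j" for j
  proof -
    have "s j *s (A *v u j) = (\<Sum>k<m. s j ^ Suc k *s P (Suc k))"
      by (simp add: u_def vec.linear_sum[OF matrix_vector_mul_linear_gen] vector_scalar_commute AP vec.scale_sum_right)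
    also have "\<dots> = u j + s j ^ m *s P m - P 0"
      using sum.lessThan_Suc_shift[of "\<lambda>k. s j ^ k *s P k" m] by (simp add: u_def)
    also have "s j ^ m *s P m = P 0" using c by (simp add: s_m P_m) (simp add: P_def)
    finally have "s j *s (A *v u j) = u j" by simp
    then have "inverse (s j) *s (s j *s (A *v u j)) = inverse (s j) *s u j" by simp
    then show ?thesis using s[of j] by simp
  qed
  then have u: "u j \<in> vec.span {v. \<exists>\<mu>. A *v v = \<mu> *s v}" for j
    by (intro vec.span_base) blast
  have "(\<Sum>j<m. s j ^ k) = 0" if "k < m" "k \<noteq> 0" for k
  proof -
    have "\<not> m dvd k" using that by (auto dest: dvd_imp_le)
    have "primitive_root m (inverse w)"
      using primitive_rootD[OF w] by (simp add: primitive_root_def power_inverse)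
    from sum_primitive_root_powers[OF this \<open>\<not> m dvd k\<close>]
    have "inverse r ^ k * (\<Sum>j<m. (inverse w ^ k) ^ j) = 0" by simp
    also have "inverse r ^ k * (\<Sum>j<m. (inverse w ^ k) ^ j) = (\<Sum>j<m. s j ^ k)"
      by (simp add: s_def sum_distrib_left power_mult_distrib power_inverse mult.commute flip: power_mult)
    finally show ?thesis .
  qed
  then have sums: "(\<Sum>j<m. s j ^ k) = (if k = 0 then of_nat m else 0)" if "k < m" for k
    using that by simp
  have "(\<Sum>j<m. u j) = (\<Sum>k<m. \<Sum>j<m. s j ^ k *s P k)"
    unfolding u_def by (rule sum.swap)
  also have "\<dots> = (\<Sum>k<m. (if k = 0 then of_nat m else 0) *s P k)"
    by (intro sum.cong refl) (simp add: sums flip: vec.scale_sum_left)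
  also have "\<dots> = (\<Sum>k<m. if k = 0 then of_nat m *s P 0 else 0)"
    by (intro sum.cong) auto
  also have "\<dots> = of_nat m *s v"
    using m by (simp add: P_def)
  finally have v_eq: "v = inverse (of_nat m) *s (\<Sum>j<m. u j)"
    using m by simp
  show ?thesis
    by (subst v_eq) (intro vec.span_scale vec.span_sum u)
qed

text \<open>Eigenvectors span the space, so a maximal independent set of them is a basis; its
  members are the columns of \<open>P\<close>.\<close>

lemma diagonalizable:
  fixes A :: "'k::{alg_closed_field, field_char_0}^3^3" and m :: nat
  assumes "A [^]\<^bsub>GL3\<^esub> m = mat c" "m > 0" "c \<noteq> 0"
  obtains P :: "'k^3^3" and a where "invertible P" "A ** P = P ** diag_matrix a"
proof -
  let ?E = "{v. \<exists>\<mu>. A *v v = \<mu> *s v}"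
  obtain B where B: "B \<subseteq> ?E" "vec.independent B" "?E \<subseteq> vec.span B"
    using vec.maximal_independent_subset[of ?E] .
  have "vec.span ?E = UNIV" using eigenvector_sum[OF assms] by blast
  then have span: "vec.span B = UNIV"
    using B(3) vec.span_minimal[OF B(3) vec.subspace_span] by blast
  have "card B = vec.dim (UNIV :: ('k^3) set)"
    by (rule vec.basis_card_eq_dim) (use B span in auto)
  then have card: "card B = card (UNIV :: 3 set)" by (simp only: vec_dim_card)
  then have "finite B" by (intro card_ge_0_finite) simp
  then obtain f where f: "bij_betw f (UNIV :: 3 set) B"
    using card finite_same_card_bij[of "UNIV :: 3 set" B] by auto
  define P where "P = (\<chi> i j. f j $ i)"
  have col: "column j P = f j" for j by (simp add: column_def P_def vec_eq_iff)
  then have "columns P = B" using f by (auto simp: columns_def bij_betw_def)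
  then have inv: "invertible P"
    using span matrix_right_invertible_span_columns[of P] invertible_right_inverse by metis
  have "f j \<in> ?E" for j using f B(1) by (auto simp: bij_betw_def)
  then have "\<forall>j. \<exists>\<mu>. A *v f j = \<mu> *s f j" by blast
  then obtain a where a: "\<And>j. A *v f j = a j *s f j" by metis
  have "(A ** P) $ i $ j = (P ** diag_matrix a) $ i $ j" for i j
  proof -
    have "(A ** P) $ i $ j = (A *v f j) $ i"
      by (simp add: matrix_matrix_mult_def matrix_vector_mult_def P_def)
    also have "\<dots> = (P ** diag_matrix a) $ i $ j"
      by (simp add: a matrix_matrix_mult_def diag_matrix_def P_def if_distrib[of "\<lambda>x. _ * x"] mult.commute cong: if_cong)
    finally show ?thesis .
  qed
  then have "A ** P = P ** diag_matrix a" by (simp add: vec_eq_iff)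
  with inv that show thesis by blast
qed


section \<open>Curves with an automorphism of order \<open>d (d - 2)\<close>\<close>

lemma eval_at_Xd_plus_YZ_form:
  "eval_at (Xd_plus_YZ_form d) v = (v $ 1) ^ d + (v $ 2) ^ (d - 1) * v $ 3 + v $ 2 * (v $ 3) ^ (d - 1)"
  by (simp add: Xd_plus_YZ_form_def)

lemma invertible_if_ker_trivial:
  fixes A :: "'a::field^'n^'n"
  assumes "\<And>v. A *v v = 0 \<Longrightarrow> v = 0"
  shows "invertible A"
  using assms matrix_left_invertible_ker[of A] invertible_left_inverse[of A] by blast

text \<open>Here \<open>1, x, y\<close> is the diagonal of an automorphism multiplying the equation of the curve by
  \<open>c\<close>; the hypotheses list the possible shapes of the map sending each variable \<open>X\<close> to a variable
  \<open>Y\<close> such that \<open>X^(d - 1) Y\<close> occurs in the equation.  With \<open>e = d - 2\<close>, all shapes but one are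
  excluded by the order \<open>(e + 2) e\<close>.\<close>

lemma excluded_shapes:
  fixes x y c :: "'a::field" and e :: nat
  assumes e: "e \<ge> 2" and ord: "\<And>n. x ^ n = 1 \<Longrightarrow> y ^ n = 1 \<Longrightarrow> (e + 2) * e dvd n"
  shows "c = 1 \<Longrightarrow> x ^ (e + 1) * x = c \<Longrightarrow> y ^ (e + 1) * y = c \<Longrightarrow> False"
    and "c = 1 \<Longrightarrow> x ^ (e + 1) * x = c \<Longrightarrow> y ^ (e + 1) = c \<Longrightarrow> False"
    and "c = 1 \<Longrightarrow> x ^ (e + 1) = c \<Longrightarrow> y ^ (e + 1) = c \<Longrightarrow> False"
    and "c = 1 \<Longrightarrow> x ^ (e + 1) = c \<Longrightarrow> y ^ (e + 1) * x = c \<Longrightarrow> False"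
    and "x \<noteq> 0 \<Longrightarrow> x = c \<Longrightarrow> x ^ (e + 1) * y = c \<Longrightarrow> y ^ (e + 1) = c \<Longrightarrow> False"
    and "x \<noteq> 0 \<Longrightarrow> x = c \<Longrightarrow> x ^ (e + 1) = c \<Longrightarrow> y ^ (e + 1) = c \<Longrightarrow> False"
proof -
  have small: False if "x ^ n = 1" "y ^ n = 1" "n > 0" "n < (e + 2) * e" for n
    using ord[OF that(1,2)] that(3,4) by (auto dest: dvd_imp_le)
  have pm: "z ^ n = 1 \<Longrightarrow> z ^ (n * m) = 1" for z :: 'a and n m :: nat
    by (simp add: power_mult)
  have ee: "4 \<le> e * e" using mult_le_mono[OF e e] by simp
  show False if "c = 1" "x ^ (e + 1) * x = c" "y ^ (e + 1) * y = c"
    by (rule small[of "e + 2"]) (use that e ee in \<open>auto simp: mult.commute add_mult_distrib\<close>)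
  \<comment> \<open>The orders of \<open>x\<close> and \<open>y\<close> divide \<open>e + 2\<close>
    and \<open>e + 1\<close>, so \<open>(e + 2) * e\<close> divides the product of these two and
    \<open>e\<close> would divide \<open>e + 1\<close>.\<close>
  show False if "c = 1" "x ^ (e + 1) * x = c" "y ^ (e + 1) = c"
  proof -
    have "x ^ (e + 2) = 1" "y ^ (e + 1) = 1" using that by (simp_all add: mult.commute)
    then have "(e + 2) * e dvd (e + 2) * (e + 1)"
      using pm[of x "e + 2" "e + 1"] pm[of y "e + 1" "e + 2"] by (intro ord) (simp_all add: mult.commute)
    then have "e dvd e + 1" by (subst (asm) dvd_times_left_cancel_iff) auto
    then have "e dvd 1" by (simp only: dvd_add_right_iff[OF dvd_refl])
    with e show False by simp
  qed
  show False if "c = 1" "x ^ (e + 1) = c" "y ^ (e + 1) = c"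
    by (rule small[of "e + 1"]) (use that e ee in \<open>auto simp: algebra_simps\<close>)
  \<comment> \<open>Here \<open>(e + 1)^2\<close> annihilates both, and it exceeds the required
    order \<open>(e + 2) * e\<close> by exactly one.\<close>
  show False if "c = 1" "x ^ (e + 1) = c" "y ^ (e + 1) * x = c"
  proof -
    have "x ^ ((e + 1) * (e + 1)) = 1" using that pm by metis
    moreover have "y ^ ((e + 1) * (e + 1)) = 1"
    proof -
      have "(y ^ (e + 1) * x) ^ (e + 1) = y ^ ((e + 1) * (e + 1)) * x ^ (e + 1)"
        by (simp only: power_mult_distrib power_mult)
      then show ?thesis by (simp only: that power_one mult_1_right)
    qed
    ultimately have "(e + 2) * e dvd (e + 1) * (e + 1)" by (rule ord)
    also have "(e + 1) * (e + 1) = (e + 2) * e + 1" by (simp add: algebra_simps)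
    finally have "(e + 2) * e dvd 1" by (simp only: dvd_add_right_iff[OF dvd_refl])
    with e show False by simp
  qed
  \<comment> \<open>The three-cycle, the shape of Klein's curve: the order divides
    \<open>e^2 + e + 1 = d^2 - 3 d + 3\<close>, which is below \<open>(e + 2) * e\<close> for
    \<open>e \<ge> 2\<close>.\<close>
  show False if "x \<noteq> 0" "x = c" "x ^ (e + 1) * y = c" "y ^ (e + 1) = c"
  proof (rule small[of "(e + 1) * e + 1"])
    have xy: "x ^ e * y = 1" and yx: "y ^ (e + 1) = x" using that by (simp_all add: mult.assoc)
    have "y ^ ((e + 1) * e + 1) = (y ^ (e + 1)) ^ e * y" by (simp only: power_add power_mult power_one_right)
    then show y: "y ^ ((e + 1) * e + 1) = 1" by (simp only: yx xy)
    have "x ^ ((e + 1) * e + 1) = (y ^ ((e + 1) * e + 1)) ^ (e + 1)"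
      by (subst yx[symmetric]) (simp only: mult.commute flip: power_mult)
    then show "x ^ ((e + 1) * e + 1) = 1" by (simp only: y power_one)
  qed (use e ee in \<open>auto simp: algebra_simps\<close>)
  show False if "x \<noteq> 0" "x = c" "x ^ (e + 1) = c" "y ^ (e + 1) = c"
  proof (rule small[of "(e + 1) * e"])
    have xe: "x ^ e = 1" and yx: "y ^ (e + 1) = x" using that by simp_all
    then show "y ^ ((e + 1) * e) = 1" by (simp only: power_mult)
    show "x ^ ((e + 1) * e) = 1" using xe by (subst mult.commute) (simp only: power_mult power_one)
  qed (use e in auto)
qed

text \<open>The exponents of \<open>Y\<close> and \<open>Z\<close> are \<open>j\<close> and
  \<open>k\<close>; with \<open>y = x^(-(e+1))\<close> and \<open>x\<close> of order
  \<open>(e + 2) * e\<close>, the divisibility says that the monomial has the right weight. Modulo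
  \<open>e + 2\<close> it forces \<open>j + k\<close> to be 0 or \<open>e + 2\<close>; in the second
  case \<open>e\<close> divides \<open>1 - k\<close>, which leaves \<open>k = 1\<close> and
  \<open>k = e + 1\<close>.\<close>

lemma surviving_monomials:
  fixes e j k :: nat
  assumes e: "e \<ge> 2" and le: "j + k \<le> e + 2" and dvd: "(int e + 2) * int e dvd int j - (int e + 1) * int k"
  shows "j = 0 \<and> k = 0 \<or> j = e + 1 \<and> k = 1 \<or> j = 1 \<and> k = e + 1"
proof -
  have split: "int j - (int e + 1) * int k = int (j + k) - (int e + 2) * int k" by (simp add: algebra_simps)
  have "int e + 2 dvd int (j + k) - (int e + 2) * int k"
    using dvd_mult_left[OF dvd] by (simp only: split)
  from dvd_add[OF this dvd_triv_left[of "int e + 2" "int k"]]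
  have "int (e + 2) dvd int (j + k)" by (simp add: algebra_simps)
  then have "e + 2 dvd j + k" by (simp only: of_nat_dvd_iff)
  with le consider "j + k = 0" | "j + k = e + 2"
    using dvd_imp_le[of "e + 2" "j + k"] by linarith
  then show ?thesis
  proof cases
    case 2
    have "int j - (int e + 1) * int k = (int e + 2) * (1 - int k)"
      unfolding split 2 by (simp add: algebra_simps)
    with dvd have "int e dvd 1 - int k" by simp
    then obtain t where t: "1 - int k = int e * t" by blast
    have "k \<le> e + 2" using 2 by simp
    have "t \<le> 0"
    proof (rule ccontr)
      assume "\<not> t \<le> 0"
      then have "int e * t \<ge> int e * 1" by (intro mult_left_mono) auto
      with t e show False by simp
    qed
    moreover have "t \<ge> -1"
    proof (rule ccontr)
      assume "\<not> t \<ge> -1"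
      then have "int e * t \<le> int e * (-2)" by (intro mult_left_mono) auto
      with t \<open>k \<le> e + 2\<close> e show False by simp
    qed
    ultimately have "t = 0 \<or> t = -1" by linarith
    with t 2 show ?thesis by auto
  qed simp
qed

lemma monom_at_diag_matrix:
  "monom_at m (diag_matrix a *v v) = monom_at m (\<chi> i. a i) * monom_at m v" for a :: "3 \<Rightarrow> 'a::comm_ring_1"
  by (simp add: monom_at_def diag_matrix_mult_vector power_mult_distrib prod.distrib)

text \<open>A diagonal substitution multiplies each monomial separately, so no two monomials can
  compensate each other.\<close>

lemma monom_at_diagonal_automorphism:
  fixes F :: "'k::field_char_0 ternary"
  assumes "diag_matrix a \<in> auts F"
  obtains c where "c \<noteq> 0" "\<And>m. m \<in> keys F \<Longrightarrow> monom_at m (\<chi> i. a i) = c"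
proof -
  obtain c where c: "c \<noteq> 0" "\<And>v. eval_at F (diag_matrix a *v v) = c * eval_at F v"
    using assms unfolding auts_def carries_iff by blast
  have "monom_at m (\<chi> i. a i) = c" if "m \<in> keys F" for m
  proof (rule eval_at_scale_coeffs[where h = "\<lambda>m. monom_at m (\<chi> i. a i)", OF _ that])
    fix v :: "'k^3"
    show "(\<Sum>m\<in>keys F. monom_at m (\<chi> i. a i) * lookup F m * monom_at m v) = c * eval_at F v"
      unfolding c(2)[symmetric] eval_at_superset[OF finite_keys order_refl, of F "diag_matrix a *v v"]
      by (simp add: monom_at_diag_matrix mult_ac)
  qed
  with c(1) that show thesis by blast
qed

text \<open>Up to renaming, a three-element set has seven self-maps. The last alternative, a fixed
  point and a two-cycle, is the one realized by \<open>X^d, Y^(d-1) Z, Y Z^(d-1)\<close>.\<close>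

lemma shape_of_map_on_3:
  fixes f :: "3 \<Rightarrow> 3"
  obtains i j k where "UNIV = {i, j, k}" "i \<noteq> j" "i \<noteq> k" "j \<noteq> k"
    "f i = i \<and> f j = j \<and> f k = k \<or> f i = i \<and> f j = j \<and> f k = i \<or> f i = i \<and> f j = i \<and> f k = i \<or>
     f i = i \<and> f j = i \<and> f k = j \<or> f i = j \<and> f j = k \<and> f k = i \<or> f i = j \<and> f j = i \<and> f k = i \<or>
     f i = i \<and> f j = k \<and> f k = j"
proof -
  let ?Q = "\<lambda>i j k. f i = i \<and> f j = j \<and> f k = k \<or> f i = i \<and> f j = j \<and> f k = i \<or> f i = i \<and> f j = i \<and> f k = i \<or>
     f i = i \<and> f j = i \<and> f k = j \<or> f i = j \<and> f j = k \<and> f k = i \<or> f i = j \<and> f j = i \<and> f k = i \<or>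
     f i = i \<and> f j = k \<and> f k = j"
  have U: "UNIV = {1,2,3::3}" "UNIV = {1,3,2::3}" "UNIV = {2,1,3::3}" "UNIV = {2,3,1::3}" "UNIV = {3,1,2::3}" "UNIV = {3,2,1::3}"
    using UNIV_3 by auto
  have ne: "(1::3) \<noteq> 2" "(1::3) \<noteq> 3" "(2::3) \<noteq> 3" "(2::3) \<noteq> 1" "(3::3) \<noteq> 1" "(3::3) \<noteq> 2" by auto
  have "?Q 1 2 3 \<or> ?Q 1 3 2 \<or> ?Q 2 1 3 \<or> ?Q 2 3 1 \<or> ?Q 3 1 2 \<or> ?Q 3 2 1"
    using exhaust_3[of "f 1"] exhaust_3[of "f 2"] exhaust_3[of "f 3"]
    by (elim disjE) simp_all
  then show thesis
    using that[OF U(1)] that[OF U(2)] that[OF U(3)] that[OF U(4)] that[OF U(5)] that[OF U(6)] ne by argo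
qed

lemma isomorphic_curves_if_carries:
  fixes F G :: "'k::field_char_0 ternary"
  assumes "carries A G F"
  shows "isomorphic_curves F G"
proof -
  obtain B where "A ** B = mat 1"
    using assms unfolding carries_def invertible_def by blast
  with assms carries_inverse show ?thesis
    unfolding isomorphic_curves_def by blast
qed

text \<open>Renaming and rescaling the coordinates absorbs all three coefficients.\<close>

lemma isomorphic_if_three_monomials:
  fixes F :: "'k::{alg_closed_field, field_char_0} ternary"
  assumes ijk: "UNIV = {i, j, k :: 3}" "i \<noteq> j" "i \<noteq> k" "j \<noteq> k" and d: "d \<ge> 4"
    and nz: "\<alpha> \<noteq> 0" "\<beta> \<noteq> 0" "\<gamma> \<noteq> 0"
    and F: "\<And>v. eval_at F v = \<alpha> * (v $ i) ^ d + \<beta> * ((v $ j) ^ (d - 1) * v $ k) + \<gamma> * (v $ j * (v $ k) ^ (d - 1))"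
  shows "isomorphic_curves F (Xd_plus_YZ_form d)"
proof -
  define e where "e = d - 2"
  have de: "d = e + 2" "d - 1 = e + 1" and e: "e \<ge> 2" using d by (auto simp: e_def)
  obtain p where p: "p ^ d = inverse \<alpha>" using nth_root_exists[of d "inverse \<alpha>"] d by auto
  \<comment> \<open>The scalings of \<open>Y\<close> and \<open>Z\<close> have to satisfy
    \<open>\<beta> q^(e+1) r = 1\<close> and \<open>\<gamma> q r^(e+1) = 1\<close>. Eliminating
    \<open>r\<close> leaves this equation, the exponent being \<open>(e + 1)^2 - 1\<close>.\<close>
  obtain q where q: "q ^ ((e + 2) * e) = \<gamma> / \<beta> ^ (e + 1)"
    using nth_root_exists[of "(e + 2) * e" "\<gamma> / \<beta> ^ (e + 1)"] e by auto
  have p0: "p \<noteq> 0" using p nz d by (auto simp: power_0_left)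
  have q0: "q \<noteq> 0" using q nz e by (auto simp: power_0_left)
  define r where "r = inverse (\<beta> * q ^ (e + 1))"
  have r0: "r \<noteq> 0" using nz q0 by (simp add: r_def)
  have q1: "q ^ (e + 1) \<noteq> 0" using q0 by simp
  have 1: "\<beta> * (q ^ (e + 1) * r) = 1"
    unfolding r_def using nz(2) q1 by (simp only: inverse_mult_distrib mult_ac) (simp add: field_simps del: power_Suc)
  have "(e + 1) * (e + 1) = (e + 2) * e + 1" by (simp add: algebra_simps)
  then have "(q ^ (e + 1)) ^ (e + 1) = q ^ ((e + 2) * e + 1)"
    by (simp only: flip: power_mult)
  also have "\<dots> = \<gamma> / \<beta> ^ (e + 1) * q"
    by (simp only: power_add power_one_right q)
  finally have "(\<beta> * q ^ (e + 1)) ^ (e + 1) = \<gamma> * q"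
    using nz by (simp only: power_mult_distrib) simp
  then have "r ^ (e + 1) = inverse (\<gamma> * q)"
    unfolding r_def by (simp only: power_inverse)
  then have 2: "\<gamma> * (q * r ^ (e + 1)) = 1" using nz q0 by (simp only: inverse_mult_distrib) (simp add: field_simps)
  define Q :: "'k^3^3" where
    "Q = (\<chi> l m. if l = i then (if m = 1 then p else 0) else if l = j then (if m = 2 then q else 0) else (if m = 3 then r else 0))"
  have Qv: "(Q *v v) $ i = p * v $ 1" "(Q *v v) $ j = q * v $ 2" "(Q *v v) $ k = r * v $ 3" for v
    using ijk by (simp_all add: Q_def matrix_vector_mult_def sum_3)
  have "invertible Q"
  proof (rule invertible_if_ker_trivial)
    fix v assume "Q *v v = 0"
    then have "v $ 1 = 0" "v $ 2 = 0" "v $ 3 = 0" using Qv[of v] p0 q0 r0 by simp_all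
    then show "v = 0" by (simp add: vec_eq_iff forall_3)
  qed
  moreover have "eval_at F (Q *v v) = 1 * eval_at (Xd_plus_YZ_form d) v" for v
  proof -
    have "eval_at F (Q *v v) = (\<alpha> * p ^ d) * (v $ 1) ^ d + (\<beta> * (q ^ (e + 1) * r)) * ((v $ 2) ^ (e + 1) * v $ 3)
        + (\<gamma> * (q * r ^ (e + 1))) * (v $ 2 * (v $ 3) ^ (e + 1))"
      unfolding F Qv de(2) power_mult_distrib by (simp only: mult_ac)
    then show ?thesis
      unfolding 1 2 p eval_at_Xd_plus_YZ_form de(2) using nz by simp
  qed
  ultimately have "carries Q (Xd_plus_YZ_form d) F"
    unfolding carries_iff by (intro conjI exI[of _ 1]) auto
  then show ?thesis by (rule isomorphic_curves_if_carries)
qed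

text \<open>Smoothness supplies a map \<open>f\<close> on the variables such that
  \<open>X_i^(d-1) X_(f i)\<close> occurs for each \<open>i\<close>. Its shape is pinned down by the
  order, and the weights then exclude every monomial beyond these three.\<close>

lemma isomorphic_if_diagonal_automorphism:
  fixes F :: "'k::{alg_closed_field, field_char_0} ternary"
  assumes d: "d \<ge> 4" and F: "homogeneous d F" "nonsingular F" and aut: "diag_matrix a \<in> auts F"
    and ord: "\<And>n c. diag_matrix a [^]\<^bsub>GL3\<^esub> (n::nat) = mat c \<Longrightarrow> d * (d - 2) dvd n"
  shows "isomorphic_curves F (Xd_plus_YZ_form d)"
proof -
  define e where "e = d - 2"
  have d_e: "d = e + 2" and e: "e \<ge> 2" using d by (auto simp: e_def)
  have de: "d = e + 2" "d - 1 = e + 1" "d * (d - 2) = (e + 2) * e" by (simp_all add: d_e)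
  have a0: "a i \<noteq> 0" for i
    using auts_invertible[OF aut] by (simp add: invertible_diag_matrix)
  obtain c where c: "\<And>m. m \<in> keys F \<Longrightarrow> monom_at m (\<chi> i. a i) = c"
    using monom_at_diagonal_automorphism[OF aut] by blast
  let ?m = "\<lambda>i j. Poly_Mapping.single i (d - 1) + Poly_Mapping.single j 1 :: 3 \<Rightarrow>\<^sub>0 nat"
  have "\<exists>j. ?m i j \<in> keys F" for i
    using nonsingular_coordinate_point[OF F, of i] d by force
  then obtain f where f: "\<And>i. ?m i (f i) \<in> keys F" by metis
  have fc: "a i ^ (e + 1) * a (f i) = c" for i
    using c[OF f[of i]] by (simp add: monom_at_add monom_at_single de)
  obtain i j k where U: "UNIV = {i, j, k}" and ne: "i \<noteq> j" "i \<noteq> k" "j \<noteq> k" and shape: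
    "f i = i \<and> f j = j \<and> f k = k \<or> f i = i \<and> f j = j \<and> f k = i \<or> f i = i \<and> f j = i \<and> f k = i \<or>
     f i = i \<and> f j = i \<and> f k = j \<or> f i = j \<and> f j = k \<and> f k = i \<or> f i = j \<and> f j = i \<and> f k = i \<or>
     f i = i \<and> f j = k \<and> f k = j"
    using shape_of_map_on_3[of f] .
  have cov: "l \<in> {i, j, k}" for l unfolding U[symmetric] by simp
  \<comment> \<open>Only ratios matter modulo scalars: the matrix becomes
    \<open>diag(1, x, y)\<close>, and \<open>c'\<close> is the factor by which this normalized
    matrix multiplies \<open>F\<close>.\<close>
  define x y c' where "x = a j / a i" and "y = a k / a i" and "c' = c / a i ^ (e + 2)"
  have x0: "x \<noteq> 0" "y \<noteq> 0" using a0 by (auto simp: x_def y_def)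
  have ax: "a j = a i * x" "a k = a i * y" using a0 by (simp_all add: x_def y_def)
  have norm: "u ^ (e + 1) * w = c'" if "(a i * u) ^ (e + 1) * (a i * w) = c" for u w
    using that[symmetric] a0[of i] by (simp add: c'_def power_mult_distrib)
  have ordxy: "(e + 2) * e dvd n" if "x ^ n = 1" "y ^ n = 1" for n
  proof -
    have "a l ^ n = a i ^ n" for l
      using cov[of l] that by (auto simp: ax power_mult_distrib)
    then have "(\<lambda>l. a l ^ n) = (\<lambda>_. a i ^ n)" by blast
    then have "diag_matrix a [^]\<^bsub>GL3\<^esub> n = mat (a i ^ n)"
      by (simp only: pow_diag_matrix diag_matrix_const)
    from ord[OF this] show ?thesis unfolding de(3) .
  qed
  have to_i: "u ^ (e + 1) = c'" if "(a i * u) ^ (e + 1) * a i = c" for u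
    using norm[of u 1] that by simp
  have from_i: "w = c'" if "a i ^ (e + 1) * (a i * w) = c" for w
    using norm[of 1 w] that by simp
  have loop_i: "c' = 1" if "a i ^ (e + 1) * a i = c"
    using norm[of 1 1] that by simp
  have ii: "c' = 1" if "f i = i"
    by (rule loop_i) (use fc[of i] that in \<open>simp only: ax\<close>)
  have ij: "x = c'" if "f i = j"
    by (rule from_i) (use fc[of i] that in \<open>simp only: ax\<close>)
  have ji: "x ^ (e + 1) = c'" if "f j = i"
    by (rule to_i) (use fc[of j] that in \<open>simp only: ax\<close>)
  have jj: "x ^ (e + 1) * x = c'" if "f j = j"
    by (rule norm) (use fc[of j] that in \<open>simp only: ax\<close>)
  have jk: "x ^ (e + 1) * y = c'" if "f j = k"
    by (rule norm) (use fc[of j] that in \<open>simp only: ax\<close>)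
  have ki: "y ^ (e + 1) = c'" if "f k = i"
    by (rule to_i) (use fc[of k] that in \<open>simp only: ax\<close>)
  have kj: "y ^ (e + 1) * x = c'" if "f k = j"
    by (rule norm) (use fc[of k] that in \<open>simp only: ax\<close>)
  have kk: "y ^ (e + 1) * y = c'" if "f k = k"
    by (rule norm) (use fc[of k] that in \<open>simp only: ax\<close>)
  have "f i = i \<and> f j = k \<and> f k = j"
    using shape
  proof (elim disjE conjE, goal_cases)
    case 1
    then show ?case using excluded_shapes(1)[OF e ordxy ii jj kk] by blast
  next
    case 2
    then show ?case using excluded_shapes(2)[OF e ordxy ii jj ki] by blast
  next
    case 3
    then show ?case using excluded_shapes(3)[OF e ordxy ii ji ki] by blast
  next
    case 4
    then show ?case using excluded_shapes(4)[OF e ordxy ii ji kj] by blast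
  next
    case 5
    then show ?case using excluded_shapes(5)[OF e ordxy x0(1) ij jk ki] by blast
  next
    case 6
    then show ?case using excluded_shapes(6)[OF e ordxy x0(1) ij ji ki] by blast
  next
    case 7
    then show ?case by simp
  qed
  then have fi: "f i = i" "f j = k" "f k = j" by auto
  have c1: "c' = 1" using fc[of i] fi by (intro loop_i) simp
  have c_i: "c = a i ^ (e + 2)" using c1 a0[of i] by (simp add: c'_def)
  have xy: "x ^ (e + 1) * y = 1"
    using norm[of x y] fc[of j] by (simp only: fi ax c1)
  define m0 m1 m2 where "m0 = ?m i i" and "m1 = ?m j k" and "m2 = ?m k j"
  have lookup_m: "lookup (?m p q) l = (if l = p then d - 1 else 0) + (if l = q then 1 else 0)" for p q l :: 3
    by (simp add: lookup_add lookup_single when_def)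
  have sum_ijk: "sum g UNIV = g i + g j + g k" for g :: "3 \<Rightarrow> nat"
    using ne by (subst U) (simp add: add.assoc)
  have prod_ijk: "prod g UNIV = g i * g j * g k" for g :: "3 \<Rightarrow> 'k"
    using ne by (subst U) (simp add: mult.assoc)
  have keys: "keys F \<subseteq> {m0, m1, m2}"
  proof
    fix m assume m: "m \<in> keys F"
    let ?l = "lookup m"
    have tot: "?l i + ?l j + ?l k = e + 2"
      using F(1) m by (simp add: homogeneous_def sum_ijk de)
    have "a i ^ ?l i * (a i * x) ^ ?l j * (a i * y) ^ ?l k = c"
      using c[OF m] by (simp add: monom_at_def prod_ijk ax)
    then have "a i ^ (?l i + ?l j + ?l k) * (x ^ ?l j * y ^ ?l k) = c"
      by (simp add: power_mult_distrib power_add mult_ac)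
    then have "a i ^ (e + 2) * (x ^ ?l j * y ^ ?l k) = a i ^ (e + 2)"
      by (simp only: tot c_i)
    then have mon1: "x ^ ?l j * y ^ ?l k = 1"
      by (simp only: mult_cancel_left2 power_eq_0_iff a0) simp
    have "x ^ ?l j = x ^ ?l j * (x ^ (e + 1) * y) ^ ?l k" by (simp only: xy power_one mult_1_right)
    also have "\<dots> = (x ^ ?l j * y ^ ?l k) * x ^ ((e + 1) * ?l k)"
      by (simp only: power_mult_distrib power_mult mult_ac)
    finally have pw: "x ^ ?l j = x ^ ((e + 1) * ?l k)" by (simp only: mon1 mult_1_left)
    \<comment> \<open>Since \<open>y\<close> is the inverse of \<open>x^(e+1)\<close>, every
      exponent that kills \<open>x\<close> also kills \<open>y\<close>, so \<open>x\<close> alone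
      carries the full order.\<close>
    have x1: "x ^ n = 1 \<Longrightarrow> (e + 2) * e dvd n" for n
    proof (rule ordxy)
      assume "x ^ n = 1"
      have "(x ^ (e + 1) * y) ^ n = (x ^ n) ^ (e + 1) * y ^ n"
        by (simp only: power_mult_distrib mult.commute flip: power_mult)
      with \<open>x ^ n = 1\<close> show "y ^ n = 1" by (simp only: xy power_one mult_1_left)
    qed
    have diff: "int ((e + 2) * e) dvd int v - int u" if "x ^ u = x ^ v" "u \<le> v" for u v
    proof -
      have "x ^ v = x ^ u * x ^ (v - u)" using that(2) by (simp only: power_add[symmetric] le_add_diff_inverse)
      with that x0 have "x ^ (v - u) = 1" by simp
      from x1[OF this] have "int ((e + 2) * e) dvd int (v - u)" by (simp only: of_nat_dvd_iff)
      with that show ?thesis by (simp only: of_nat_diff)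
    qed
    have "int ((e + 2) * e) dvd int (?l j) - int ((e + 1) * ?l k)"
    proof (cases "?l j \<le> (e + 1) * ?l k")
      case True
      then show ?thesis using diff[OF pw] by (subst dvd_diff_commute) simp
    next
      case False
      then show ?thesis using diff[OF pw[symmetric]] by simp
    qed
    then have "(int e + 2) * int e dvd int (?l j) - (int e + 1) * int (?l k)"
      by (simp only: of_nat_mult of_nat_add of_nat_numeral of_nat_1)
    moreover have "?l j + ?l k \<le> e + 2" using tot by simp
    ultimately have exps: "?l j = 0 \<and> ?l k = 0 \<or> ?l j = e + 1 \<and> ?l k = 1 \<or> ?l j = 1 \<and> ?l k = e + 1"
      by (intro surviving_monomials[OF e])
    have eqI: "m = ?m p q" if "\<And>l. l \<in> {i, j, k} \<Longrightarrow> ?l l = lookup (?m p q) l" for p q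
      by (rule poly_mapping_eqI) (use that cov in blast)
    have "m = ?m i i \<or> m = ?m j k \<or> m = ?m k j"
      using exps
    proof (elim disjE conjE, goal_cases)
      case 1
      have "m = ?m i i" by (rule eqI) (use 1 tot ne in \<open>auto simp: lookup_add lookup_single when_def de\<close>)
      then show ?case by simp
    next
      case 2
      have "m = ?m j k" by (rule eqI) (use 2 tot ne in \<open>auto simp: lookup_add lookup_single when_def de\<close>)
      then show ?case by simp
    next
      case 3
      have "m = ?m k j" by (rule eqI) (use 3 tot ne in \<open>auto simp: lookup_add lookup_single when_def de\<close>)
      then show ?case by simp
    qed
    then show "m \<in> {m0, m1, m2}" by (simp add: m0_def m1_def m2_def)
  qed
  have "lookup m0 i \<noteq> lookup m1 i" "lookup m0 i \<noteq> lookup m2 i"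
      "lookup m1 j \<noteq> lookup m2 j"
    unfolding m0_def m1_def m2_def lookup_m using ne d by auto
  then have distinct: "m0 \<noteq> m1" "m0 \<noteq> m2" "m1 \<noteq> m2" by auto
  have "eval_at F v = lookup F m0 * (v $ i) ^ d + lookup F m1 * ((v $ j) ^ (d - 1) * v $ k)
      + lookup F m2 * (v $ j * (v $ k) ^ (d - 1))" for v
  proof -
    have "eval_at F v = lookup F m0 * monom_at m0 v + lookup F m1 * monom_at m1 v
        + lookup F m2 * monom_at m2 v"
      using distinct by (subst eval_at_superset[OF _ keys]) (simp_all add: add.assoc)
    moreover have "monom_at m0 v = (v $ i) ^ d"
      using power_Suc2[of "v $ i" "d - 1"] d by (simp add: m0_def monom_at_add monom_at_single)
    ultimately show ?thesis
      by (simp add: m1_def m2_def monom_at_add monom_at_single mult_ac)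
  qed
  moreover have "lookup F m0 \<noteq> 0" "lookup F m1 \<noteq> 0" "lookup F m2 \<noteq> 0"
    using f[of i] f[of j] f[of k] unfolding fi m0_def m1_def m2_def in_keys_iff by auto
  ultimately show ?thesis
    using isomorphic_if_three_monomials[OF U ne d] by blast
qed

text \<open>Finite order in \<open>PGL3\<close> makes some power of a representative scalar, hence
  the representative diagonalizable. The curve is moved to eigenvector coordinates; a power that is
  scalar there is scalar in the old coordinates, so the order is kept.\<close>

lemma isomorphic_if_order:
  fixes F :: "'k::{alg_closed_field, field_char_0} ternary"
  assumes d: "d \<ge> 4" and F: "homogeneous d F" "nonsingular F"
    and \<sigma>: "\<sigma> \<in> carrier (Aut_curve F)" "group.ord (Aut_curve F) \<sigma> = d * (d - 2)"
  shows "isomorphic_curves F (Xd_plus_YZ_form d)"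
proof -
  obtain A where A: "\<sigma> = proj_class A" "A \<in> auts F" using \<sigma>(1) by (auto simp: carrier_Aut_curve)
  have ord: "d * (d - 2) dvd n \<longleftrightarrow> (\<exists>c. c \<noteq> 0 \<and> A [^]\<^bsub>GL3\<^esub> n = mat c)" for n
    using proj_class_pow_eq_one_iff[OF A(2), of n] \<sigma>(2) A(1) by simp
  obtain c where c: "c \<noteq> 0" "A [^]\<^bsub>GL3\<^esub> (d * (d - 2)) = mat c" using ord dvd_refl by blast
  obtain P :: "'k^3^3" and a where P: "invertible P" "A ** P = P ** diag_matrix a"
    using diagonalizable[OF c(2)] c(1) d by auto
  obtain R where R: "R ** P = mat 1" "P ** R = mat 1" using P(1) unfolding invertible_def by blast
  define G where "G = lin_subst P F"
  have PG: "carries P G F"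
    unfolding carries_iff G_def using P(1) by (auto intro!: exI[of _ 1])
  have D: "diag_matrix a = R ** A ** P"
    by (simp add: P(2) R matrix_mul_assoc flip: matrix_mul_assoc[of R A P])
  have "R ** A ** P \<in> auts G"
    using carries_mult[OF carries_mult[OF carries_inverse[OF PG R(2)]] PG] A(2) by (simp add: auts_def)
  then have aut: "diag_matrix a \<in> auts G" by (simp only: D)
  have pw: "A [^]\<^bsub>GL3\<^esub> n ** P = P ** diag_matrix a [^]\<^bsub>GL3\<^esub> n" for n :: nat
  proof (induction n)
    case (Suc n)
    have "A [^]\<^bsub>GL3\<^esub> Suc n ** P = A [^]\<^bsub>GL3\<^esub> n ** P ** diag_matrix a"
      by (simp add: P(2) flip: matrix_mul_assoc)
    then show ?case by (simp add: Suc matrix_mul_assoc)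
  qed simp
  have "isomorphic_curves G (Xd_plus_YZ_form d)"
  proof (rule isomorphic_if_diagonal_automorphism[OF d _ _ aut])
    show "homogeneous d G" "nonsingular G"
      using carries_homogeneous[OF PG F(1)] carries_nonsingular[OF PG F(2)] .
    fix n c assume Dn: "diag_matrix a [^]\<^bsub>GL3\<^esub> (n::nat) = mat c"
    have "A [^]\<^bsub>GL3\<^esub> n = (A [^]\<^bsub>GL3\<^esub> n ** P) ** R" by (simp add: R flip: matrix_mul_assoc)
    also have "\<dots> = mat c ** (P ** R)" by (simp add: pw Dn mat_mult_right matrix_mul_assoc)
    finally have "A [^]\<^bsub>GL3\<^esub> n = mat c" by (simp add: R)
    moreover from this have "c \<noteq> 0"
      using invertible_pow_GL3[OF auts_invertible[OF A(2)], of n] invertible_diag_matrix[of "\<lambda>_::3. c"]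
      by (simp add: diag_matrix_const)
    ultimately show "d * (d - 2) dvd n" using ord by blast
  qed
  then obtain Q where "carries Q G (Xd_plus_YZ_form d)" by (auto simp: isomorphic_curves_def)
  from carries_mult[OF this carries_inverse[OF PG R(2)]] show ?thesis
    by (auto simp: isomorphic_curves_def)
qed

section \<open>The converse: exhibiting an automorphism of order \<open>d (d - 2)\<close>\<close>

lemma iso_ord:
  assumes "h \<in> iso G H" "group G" "group H" "x \<in> carrier G"
  shows "group.ord H (h x) = group.ord G x"
proof -
  have hom: "h \<in> hom G H" and inj: "inj_on h (carrier G)" and hx: "h x \<in> carrier H"
    using assms by (auto simp: iso_def hom_def bij_betw_def)
  have "h x [^]\<^bsub>H\<^esub> n = \<one>\<^bsub>H\<^esub> \<longleftrightarrow> x [^]\<^bsub>G\<^esub> n = \<one>\<^bsub>G\<^esub>" for n :: nat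
  proof -
    have one: "h \<one>\<^bsub>G\<^esub> = \<one>\<^bsub>H\<^esub>" using hom_one[OF hom assms(2,3)] .
    have "h x [^]\<^bsub>H\<^esub> n = h (x [^]\<^bsub>G\<^esub> n)"
      by (induction n)
        (use hom assms in \<open>simp_all add: one hom_mult group.is_monoid monoid.nat_pow_closed\<close>)
    moreover note one
    ultimately show ?thesis
      using inj assms by (metis group.is_monoid inj_onD monoid.nat_pow_closed monoid.one_closed)
  qed
  then show ?thesis
    using group.ord_unique[OF assms(3) hx] group.pow_eq_id[OF assms(2,4)] by metis
qed

lemma order_if_isomorphic:
  fixes F :: "'k::{alg_closed_field, field_char_0} ternary"
  assumes d: "d \<ge> 4" and "isomorphic_curves F (Xd_plus_YZ_form d)"
  shows "\<exists>\<sigma>\<in>carrier (Aut_curve F). group.ord (Aut_curve F) \<sigma> = d * (d - 2)"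
proof -
  let ?F = "Xd_plus_YZ_form d :: 'k ternary"
  have N: "d * (d - 2) > 0" using d by simp
  obtain w :: 'k where w: "primitive_root (d * (d - 2)) w" using primitive_root_exists[OF N] .
  have w0: "w \<noteq> 0" using primitive_root_nz[OF w N] .
  \<comment> \<open>The last entry is forced by the invariance of \<open>Y^(d-1) Z\<close>; that of
    \<open>Y Z^(d-1)\<close> then follows from \<open>(d - 1)^2 = d (d - 2) + 1\<close> and the
    order of \<open>w\<close>.\<close>
  define a where "a i = (if i = 1 then 1 else if i = 2 then w else inverse w ^ (d - 1))" for i :: 3
  have 1: "w ^ (d - 1) * inverse w ^ (d - 1) = 1" using w0 by (simp flip: power_mult_distrib)
  have "(inverse w ^ (d - 1)) ^ (d - 1) = inverse w"
  proof -
    obtain e where e: "d = e + 2" using d by (metis le_add_diff_inverse2 add_leD2 numeral_Bit0 add.commute le_trans one_le_numeral le_Suc_ex)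
    have "inverse w ^ ((d - 1) * (d - 1)) = inverse w ^ (d * (d - 2) + 1)"
      by (simp add: e algebra_simps)
    also have "\<dots> = inverse w" using primitive_rootD[OF w, of "d * (d - 2)"] by (simp add: power_inverse)
    finally show ?thesis by (simp only: power_mult)
  qed
  then have 2: "w * (inverse w ^ (d - 1)) ^ (d - 1) = 1" using w0 by simp
  have "eval_at ?F (diag_matrix a *v v) = 1 * eval_at ?F v" for v
  proof -
    have "eval_at ?F (diag_matrix a *v v) = (v $ 1) ^ d + (w ^ (d - 1) * inverse w ^ (d - 1)) * ((v $ 2) ^ (d - 1) * v $ 3)
        + (w * (inverse w ^ (d - 1)) ^ (d - 1)) * (v $ 2 * (v $ 3) ^ (d - 1))"
      by (simp add: eval_at_Xd_plus_YZ_form diag_matrix_mult_vector a_def power_mult_distrib mult_ac del: power_inverse)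
    then show ?thesis by (simp only: 1 2 eval_at_Xd_plus_YZ_form mult_1_left)
  qed
  then have D: "diag_matrix a \<in> auts ?F"
    unfolding auts_def carries_iff using w0
    by (auto simp: invertible_diag_matrix a_def intro!: exI[of _ 1])
  have "(\<exists>c. c \<noteq> 0 \<and> diag_matrix a [^]\<^bsub>GL3\<^esub> n = mat c) \<longleftrightarrow> d * (d - 2) dvd n" for n
  proof
    assume "\<exists>c. c \<noteq> 0 \<and> diag_matrix a [^]\<^bsub>GL3\<^esub> n = mat c"
    then obtain c where "(\<lambda>i. a i ^ n) = (\<lambda>_. c)"
      by (auto simp: pow_diag_matrix diag_matrix_inject simp flip: diag_matrix_const)
    then have "a 1 ^ n = a 2 ^ n" by metis
    then have "w ^ n = 1" by (simp add: a_def)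
    then show "d * (d - 2) dvd n" using primitive_rootD[OF w] by blast
  next
    assume "d * (d - 2) dvd n"
    then have "w ^ n = 1" using primitive_rootD[OF w] by blast
    moreover have "(inverse w ^ (d - 1)) ^ n = inverse (w ^ n) ^ (d - 1)"
      by (simp add: power_inverse mult.commute flip: power_mult)
    ultimately have "(\<lambda>i. a i ^ n) = (\<lambda>_. 1)" by (auto simp: a_def)
    then show "\<exists>c. c \<noteq> 0 \<and> diag_matrix a [^]\<^bsub>GL3\<^esub> n = mat c"
      by (intro exI[of _ 1]) (simp add: pow_diag_matrix diag_matrix_const)
  qed
  then have "group.ord (Aut_curve ?F) (proj_class (diag_matrix a)) dvd n \<longleftrightarrow> d * (d - 2) dvd n" for n
    using proj_class_pow_eq_one_iff[OF D] by blast
  then have ord: "group.ord (Aut_curve ?F) (proj_class (diag_matrix a)) = d * (d - 2)"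
    by (meson dvd_antisym dvd_refl)
  obtain A where "carries A F ?F" using assms(2) by (auto simp: isomorphic_curves_def)
  from isomorphic_Aut_curve[OF this] obtain g where "g \<in> iso (Aut_curve F) (Aut_curve ?F)"
    by (auto simp: is_iso_def)
  from group.iso_set_sym[OF group_Aut_curve this] obtain h where h: "h \<in> iso (Aut_curve ?F) (Aut_curve F)" by blast
  have x: "proj_class (diag_matrix a) \<in> carrier (Aut_curve ?F)" using D by (auto simp: carrier_Aut_curve)
  show ?thesis
  proof (rule bexI)
    show "group.ord (Aut_curve F) (h (proj_class (diag_matrix a))) = d * (d - 2)"
      using iso_ord[OF h group_Aut_curve group_Aut_curve x] ord by simp
    show "h (proj_class (diag_matrix a)) \<in> carrier (Aut_curve F)"
      using h x by (auto simp: iso_def hom_def)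
  qed
qed


section \<open>Automorphisms of \<open>X^d + Y^(d-1) Z + e Y Z^(d-1)\<close>\<close>

text \<open>The coefficient keeps two normal forms together: \<open>e = 1\<close> is the curve of
  the theorem, \<open>e = -1\<close> the sextic in octahedral position.\<close>

definition YZ_form :: "nat \<Rightarrow> 'k::field \<Rightarrow> 'k ternary" where
  "YZ_form d e = Var 1 ^ d + Var 2 ^ (d - 1) * Var 3 + Const e * (Var 2 * Var 3 ^ (d - 1))"

lemma eval_at_YZ_form:
  "eval_at (YZ_form d e) v = (v $ 1) ^ d + (v $ 2) ^ (d - 1) * v $ 3 + e * (v $ 2 * (v $ 3) ^ (d - 1))"
  by (simp add: YZ_form_def)

lemma YZ_form_1: "YZ_form d 1 = (Xd_plus_YZ_form d :: 'k::field_char_0 ternary)"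
  by (simp add: eval_at_inject[symmetric] eval_at_YZ_form eval_at_Xd_plus_YZ_form)

lemma homogeneous_YZ_form: "d \<ge> 1 \<Longrightarrow> homogeneous d (YZ_form d e :: 'k::field_char_0 ternary)"
proof (rule homogeneousI)
  fix s and v :: "'k^3" assume "d \<ge> 1"
  then obtain n where "d = Suc n" by (cases d) auto
  then show "eval_at (YZ_form d e) (s *s v) = s ^ d * eval_at (YZ_form d e) v"
    by (simp add: eval_at_YZ_form power_mult_distrib algebra_simps)
qed

lemma coeff_on_line_YZ_form:
  fixes v w :: "'k::field_char_0^3"
  shows "Polynomial.coeff (on_line (YZ_form d e) v w) 1 = of_nat d * (v $ 1) ^ (d - 1) * w $ 1
    + (of_nat (d - 1) * (v $ 2) ^ (d - 2) * w $ 2 * v $ 3 + (v $ 2) ^ (d - 1) * w $ 3)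
    + e * (w $ 2 * (v $ 3) ^ (d - 1) + v $ 2 * (of_nat (d - 1) * (v $ 3) ^ (d - 2) * w $ 3))"
proof -
  let ?l = "\<lambda>i. [:v $ i, w $ i:]"
  have "on_line (YZ_form d e) v w = ?l 1 ^ d + ?l 2 ^ (d - 1) * ?l 3 + Polynomial.smult e (?l 2 * ?l 3 ^ (d - 1))"
    unfolding poly_eq_poly_eq_iff[symmetric]
    by (rule ext) (simp add: poly_on_line eval_at_YZ_form algebra_simps)
  moreover have "Polynomial.coeff [:a, b:] 0 = a" "Polynomial.coeff [:a, b:] 1 = b" for a b :: 'k by simp_all
  ultimately show ?thesis
    by (simp add: coeff_1_mult coeff_1_linear_power coeff_0_power algebra_simps numeral_2_eq_2 del: mult_pCons_left mult_pCons_right One_nat_def)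
qed

lemma invertible_mult_vector_nz: "invertible A \<Longrightarrow> v \<noteq> 0 \<Longrightarrow> A *v v \<noteq> 0" for A :: "'a::field^'n^'n"
  using matrix_left_invertible_ker[of A] invertible_left_inverse[of A] by blast

text \<open>The partial derivatives of the form in the directions \<open>(a, b, c)\<close> that are \<open>(d - 1)\<close>-th
  powers of a linear form are multiples of the one in the direction \<open>(1, 0, 0)\<close>, so an
  automorphism fixes this direction.\<close>

lemma YZ_form_derivative_power:
  fixes a b c e k \<alpha> \<beta> \<gamma> :: "'k::field_char_0"
  assumes d: "d \<ge> 5" and e: "e \<noteq> 0" and k: "k \<noteq> 0" and abc: "a \<noteq> 0 \<or> b \<noteq> 0 \<or> c \<noteq> 0"
    and eq: "\<And>x y z. of_nat d * x ^ (d - 1) * a + (of_nat (d - 1) * y ^ (d - 2) * b * z + y ^ (d - 1) * c)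
      + e * (b * z ^ (d - 1) + y * (of_nat (d - 1) * z ^ (d - 2) * c)) = k * (\<alpha> * x + \<beta> * y + \<gamma> * z) ^ (d - 1)"
  shows "b = 0" "c = 0" "\<beta> = 0" "\<gamma> = 0" "\<alpha> \<noteq> 0"
proof -
  define N M where "N = d - 1" and "M = d - 2"
  have N: "d - 1 = N" "d - 2 = M" "N \<ge> 4" "M \<ge> 3" "N - M = 1" "N - Suc 0 = M" "N \<noteq> M"
    using d by (auto simp: N_def M_def)
  then have Nne: "N \<noteq> 0" "N \<noteq> 1" "N \<noteq> 2" "M \<noteq> 0" "M \<noteq> 1" "M \<noteq> 2" "N \<noteq> Suc 0" "M \<noteq> Suc 0" "M \<le> N" by auto
  have pow_0: "(0::'k) ^ N = 0" "(0::'k) ^ M = 0" using Nne by (simp_all add: power_0_left)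
  note eq = eq[unfolded N(1,2)]
  have polys: "p = q" if "\<And>t. poly p t = poly q t" for p q :: "'k poly"
    using that unfolding poly_eq_poly_eq_iff[symmetric] by blast
  have coeff_power: "Polynomial.coeff (Polynomial.smult k ([:g, h:] ^ N)) i = k * (of_nat (N choose i) * h ^ i * g ^ (N - i))"
    if "i \<le> N" for g h i
    using that by (simp add: coeff_linear_poly_power)
  have nz: "of_nat (N choose i) \<noteq> (0::'k)" if "i \<le> N" for i
    using that by simp
  \<comment> \<open>On the line \<open>y = 1\<close>, \<open>z = 0\<close> only \<open>x^N\<close>
    and a constant occur. As \<open>N > 1\<close>, the linear coefficient of the power vanishes, so
    \<open>\<alpha>\<close> or \<open>\<beta>\<close> is zero; the line \<open>y = 0\<close>,
    \<open>z = 1\<close> treats \<open>\<gamma>\<close> alike.\<close>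
  have "Polynomial.monom (of_nat d * a) N + [:c:] = Polynomial.smult k ([:\<beta>, \<alpha>:] ^ N)"
    by (rule polys, insert eq[of _ 1 0]) (simp add: poly_monom pow_0 algebra_simps)
  from arg_cong[OF this, of "\<lambda>p. Polynomial.coeff p 1"] k nz[of 1] N(3) have "\<alpha> = 0 \<or> \<beta> = 0"
    by (subst (asm) coeff_power) (auto simp: Nne)
  moreover have "Polynomial.monom (of_nat d * a) N + [:e * b:] = Polynomial.smult k ([:\<gamma>, \<alpha>:] ^ N)"
    by (rule polys, insert eq[of _ 0 1]) (simp add: poly_monom pow_0 algebra_simps)
  from arg_cong[OF this, of "\<lambda>p. Polynomial.coeff p 1"] k nz[of 1] N(3) have "\<alpha> = 0 \<or> \<gamma> = 0"
    by (subst (asm) coeff_power) (auto simp: Nne)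
  moreover have "\<alpha> \<noteq> 0"
  proof
    assume \<alpha>: "\<alpha> = 0"
    have "a = 0" using eq[of 1 0 0] d by (simp add: \<alpha> pow_0)
    \<comment> \<open>If \<open>\<alpha> = 0\<close>, what remains is binary, with exponents 0, 1,
      \<open>M\<close>, \<open>N\<close> of \<open>y\<close> only. Because \<open>M \<ge> 3\<close>,
      which is where \<open>d \<ge> 5\<close> enters, there is no term \<open>y^2\<close>; hence
      \<open>\<beta>\<close> or \<open>\<gamma>\<close> is zero, and the exponents 1 and
      \<open>M\<close> give \<open>c = 0\<close> and \<open>b = 0\<close>.\<close>
    have P: "Polynomial.monom (of_nat N * b) M + Polynomial.monom c N + [:e * b, e * (of_nat N * c):]
        = Polynomial.smult k ([:\<gamma>, \<beta>:] ^ N)"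
      by (rule polys, insert eq[of 0 _ 1]) (simp add: \<alpha> \<open>a = 0\<close> poly_monom pow_0 algebra_simps)
    have lin2: "Polynomial.coeff [:g, h:] 2 = 0" for g h :: 'k
      by (simp add: coeff_pCons numeral_2_eq_2)
    have "of_nat (N choose 2) * \<beta> ^ 2 * \<gamma> ^ (N - 2) = 0"
      using arg_cong[OF P, of "\<lambda>p. Polynomial.coeff p 2"] N(3) k
      by (subst (asm) coeff_power) (simp_all add: Nne lin2)
    with nz[of 2] N(3) have \<beta>\<gamma>: "\<beta> = 0 \<or> \<gamma> = 0" by auto
    have "e * (of_nat N * c) = k * (of_nat N * \<beta> * \<gamma> ^ M)"
      using arg_cong[OF P, of "\<lambda>p. Polynomial.coeff p 1"] N(3)
      by (subst (asm) coeff_power) (simp_all add: Nne N(6))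
    with \<beta>\<gamma> have c: "c = 0" using e Nne(1) by (auto simp: pow_0)
    have lin: "Polynomial.coeff [:g, h:] M = 0" for g h :: 'k
      by (rule coeff_eq_0) (use N(4) in \<open>simp add: degree_pCons_eq_if\<close>)
    have "of_nat N * b = k * (of_nat (N choose M) * \<beta> ^ M * \<gamma>)"
      using arg_cong[OF P, of "\<lambda>p. Polynomial.coeff p M"]
      by (subst (asm) coeff_power) (simp_all add: Nne N lin)
    with \<beta>\<gamma> have "b = 0" using Nne(1) by (auto simp: pow_0)
    with abc \<open>a = 0\<close> c show False by simp
  qed
  ultimately show "\<alpha> \<noteq> 0" and \<beta>: "\<beta> = 0" and \<gamma>: "\<gamma> = 0" by auto
  show "c = 0" using eq[of 0 1 0] by (simp add: pow_0 \<beta>)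
  show "b = 0" using eq[of 0 0 1] e by (simp add: pow_0 \<gamma>)
qed

section \<open>Block matrices: projectivities fixing the point \<open>(1 : 0 : 0)\<close> and the
  line \<open>X = 0\<close>\<close>

definition block_matrix :: "'a::zero \<Rightarrow> 'a \<Rightarrow> 'a \<Rightarrow> 'a \<Rightarrow> 'a \<Rightarrow> 'a^3^3" where
  "block_matrix a p q r s = (\<chi> i j.
     if i = 1 then (if j = 1 then a else 0)
     else if i = 2 then (if j = 1 then 0 else if j = 2 then p else q)
     else (if j = 1 then 0 else if j = 2 then r else s))"

lemma block_matrix_mult_vector:
  fixes a :: "'a::comm_ring_1"
  shows "(block_matrix a p q r s *v v) $ 1 = a * v $ 1"
    "(block_matrix a p q r s *v v) $ 2 = p * v $ 2 + q * v $ 3"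
    "(block_matrix a p q r s *v v) $ 3 = r * v $ 2 + s * v $ 3"
  by (simp_all add: block_matrix_def matrix_vector_mult_def sum_3)

lemma block_matrix_mult:
  fixes a :: "'a::comm_ring_1"
  shows "block_matrix a p q r s ** block_matrix a' p' q' r' s'
    = block_matrix (a * a') (p * p' + q * r') (p * q' + q * s') (r * p' + s * r') (r * q' + s * s')"
  by (simp add: block_matrix_def matrix_matrix_mult_def vec_eq_iff forall_3 sum_3)

lemma mat_block_matrix: "mat c = block_matrix c c 0 0 c"
  by (simp add: block_matrix_def mat_def vec_eq_iff forall_3)

lemma scale_block_matrix: "mat c ** block_matrix a p q r s = block_matrix (c * a) (c * p) (c * q) (c * r) (c * s)"
  for a :: "'a::comm_ring_1"
  by (simp add: mat_block_matrix block_matrix_mult)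

lemma block_matrix_inject: "block_matrix a p q r s = block_matrix a' p' q' r' s' \<longleftrightarrow>
    a = a' \<and> p = p' \<and> q = q' \<and> r = r' \<and> s = s'"
  by (auto simp: block_matrix_def vec_eq_iff forall_3)

lemma invertible_block_matrix:
  fixes a :: "'a::field"
  shows "invertible (block_matrix a p q r s) \<longleftrightarrow> a \<noteq> 0 \<and> p * s - q * r \<noteq> 0"
proof
  assume inv: "invertible (block_matrix a p q r s)"
  have "block_matrix a p q r s *v axis 1 1 \<noteq> 0"
    by (rule invertible_mult_vector_nz[OF inv]) (simp add: axis_eq_0_iff)
  then have "a \<noteq> 0" by (auto simp: vec_eq_iff forall_3 block_matrix_mult_vector axis_def)
  moreover have "p * s - q * r \<noteq> 0"
  proof
    assume det: "p * s - q * r = 0"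
    have "v = 0" if "p * v $ 2 + q * v $ 3 = 0" "r * v $ 2 + s * v $ 3 = 0" "v $ 1 = 0" for v :: "'a^3"
      using invertible_mult_vector_nz[OF inv, of v] that
      by (auto simp: vec_eq_iff forall_3 block_matrix_mult_vector)
    \<comment> \<open>The two vectors are the columns of the adjugate of the lower block, which that
      block annihilates when its determinant is zero.\<close>
    from this[of "\<chi> i. if i = 1 then 0 else if i = 2 then s else - r"]
      this[of "\<chi> i. if i = 1 then 0 else if i = 2 then - q else p"] det
    have "p = 0" "q = 0" "r = 0" "s = 0"
      by (simp_all add: vec_eq_iff forall_3 algebra_simps)
    with inv invertible_mult_vector_nz[OF inv, of "axis 2 1"] show False
      by (simp add: vec_eq_iff forall_3 block_matrix_mult_vector axis_def)
  qed
  ultimately show "a \<noteq> 0 \<and> p * s - q * r \<noteq> 0" by blast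
next
  assume nz: "a \<noteq> 0 \<and> p * s - q * r \<noteq> 0"
  show "invertible (block_matrix a p q r s)"
  proof (rule invertible_if_ker_trivial)
    fix v :: "'a^3" assume "block_matrix a p q r s *v v = 0"
    then have v: "a * v $ 1 = 0" "p * v $ 2 + q * v $ 3 = 0" "r * v $ 2 + s * v $ 3 = 0"
      by (metis block_matrix_mult_vector zero_index)+
    have "(p * s - q * r) * v $ 2 = s * (p * v $ 2 + q * v $ 3) - q * (r * v $ 2 + s * v $ 3)"
      and "(p * s - q * r) * v $ 3 = p * (r * v $ 2 + s * v $ 3) - r * (p * v $ 2 + q * v $ 3)"
      by (simp_all add: algebra_simps)
    then have "(p * s - q * r) * v $ 2 = 0" "(p * s - q * r) * v $ 3 = 0"
      by (simp_all only: v mult_zero_right diff_self)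
    with v(1) nz show "v = 0" by (auto simp: vec_eq_iff forall_3)
  qed
qed

lemma block_matrixI:
  assumes "A $ 1 $ 2 = 0" "A $ 1 $ 3 = 0" "A $ 2 $ 1 = 0" "A $ 3 $ 1 = 0"
  shows "A = block_matrix (A $ 1 $ 1) (A $ 2 $ 2) (A $ 2 $ 3) (A $ 3 $ 2) (A $ 3 $ 3)"
  using assms by (simp add: block_matrix_def vec_eq_iff forall_3)

text \<open>The polar in the direction \<open>A e_1\<close> corresponds under \<open>A\<close> to a
  multiple of the polar in the direction \<open>e_1\<close>, which is a multiple of
  \<open>X^(d-1)\<close>. In the original variables it is therefore a power of the linear form given
  by the first row of \<open>B\<close>, the inverse of \<open>A\<close>.\<close>

lemma auts_YZ_form_block:
  fixes e :: "'k::field_char_0"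
  assumes d: "d \<ge> 5" and e: "e \<noteq> 0" and A: "A \<in> auts (YZ_form d e)"
  obtains a p q r s where "A = block_matrix a p q r s" "a \<noteq> 0" "p * s - q * r \<noteq> 0"
proof -
  let ?F = "YZ_form d e"
  obtain c0 where c0: "invertible A" "c0 \<noteq> 0" "\<And>v. eval_at ?F (A *v v) = c0 * eval_at ?F v"
    using A unfolding auts_def carries_iff by blast
  obtain B where B: "B ** A = mat 1" "A ** B = mat 1" using c0(1) unfolding invertible_def by blast
  let ?w = "A *v axis 1 1"
  have w: "?w $ i = A $ i $ 1" for i
    by (simp add: matrix_vector_mult_def axis_def if_distrib[of "\<lambda>x. _ * x"] cong: if_cong)
  have "?w \<noteq> 0" by (rule invertible_mult_vector_nz[OF c0(1)]) (simp add: axis_eq_0_iff)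
  then have w0: "A $ 1 $ 1 \<noteq> 0 \<or> A $ 2 $ 1 \<noteq> 0 \<or> A $ 3 $ 1 \<noteq> 0"
    by (auto simp: vec_eq_iff forall_3 w)
  have line: "Polynomial.coeff (on_line ?F (A *v v) ?w) 1 = c0 * Polynomial.coeff (on_line ?F v (axis 1 1)) 1" for v
    unfolding on_line_substitution[OF c0(3)] by simp
  have eq: "of_nat d * x ^ (d - 1) * A $ 1 $ 1 + (of_nat (d - 1) * y ^ (d - 2) * A $ 2 $ 1 * z + y ^ (d - 1) * A $ 3 $ 1)
      + e * (A $ 2 $ 1 * z ^ (d - 1) + y * (of_nat (d - 1) * z ^ (d - 2) * A $ 3 $ 1))
      = (c0 * of_nat d) * (B $ 1 $ 1 * x + B $ 1 $ 2 * y + B $ 1 $ 3 * z) ^ (d - 1)" for x y z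
  proof -
    let ?u = "(\<chi> i. if i = 1 then x else if i = 2 then y else z) :: 'k^3"
    have u: "?u $ 1 = x" "?u $ 2 = y" "?u $ 3 = z" by simp_all
    have "A *v (B *v ?u) = ?u" by (simp only: matrix_vector_mul_assoc B matrix_vector_mul_lid)
    moreover have "(B *v ?u) $ 1 = B $ 1 $ 1 * x + B $ 1 $ 2 * y + B $ 1 $ 3 * z"
      by (simp add: matrix_vector_mult_def sum_3)
    moreover have "axis 1 1 $ 1 = (1::'k)" "axis 1 1 $ (2::3) = (0::'k)" "axis 1 1 $ (3::3) = (0::'k)"
      by (simp_all add: axis_def)
    ultimately show ?thesis
      using line[of "B *v ?u"] unfolding coeff_on_line_YZ_form by (simp only: u w) (simp add: mult_ac)
  qed
  have "c0 * of_nat d \<noteq> 0" using c0(2) d by simp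
  from YZ_form_derivative_power[OF d e this w0 eq]
  have z: "A $ 2 $ 1 = 0" "A $ 3 $ 1 = 0" "B $ 1 $ 2 = 0" "B $ 1 $ 3 = 0" "B $ 1 $ 1 \<noteq> 0" .
  \<comment> \<open>Only the corner entry of the first row of \<open>B\<close> is nonzero, so
    \<open>B ** A = mat 1\<close> clears the rest of the first row of \<open>A\<close>.\<close>
  have "(B ** A) $ 1 $ j = B $ 1 $ 1 * A $ 1 $ j" for j
    by (simp add: matrix_matrix_mult_def sum_3 z)
  then have "B $ 1 $ 1 * A $ 1 $ j = mat 1 $ 1 $ j" for j using B by simp
  from this[of 2] this[of 3] z(5) have "A $ 1 $ 2 = 0" "A $ 1 $ 3 = 0"
    by (simp_all add: mat_def)
  from block_matrixI[OF this z(1,2)] c0(1) show thesis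
    using invertible_block_matrix that by metis
qed

section \<open>Binary substitutions preserving \<open>Y Z (Y^n + e Z^n)\<close> up to a
  factor\<close>

definition binary_YZ :: "nat \<Rightarrow> 'a::comm_ring_1 \<Rightarrow> 'a \<Rightarrow> 'a \<Rightarrow> 'a" where
  "binary_YZ d e y z = y ^ (d - 1) * z + e * (y * z ^ (d - 1))"

text \<open>The multiplier of an automorphism is read off at \<open>(1, 0, 0)\<close>, where it must
  equal \<open>a^d\<close>; the binary part then has to have the same multiplier.\<close>

lemma block_matrix_in_auts_iff:
  fixes e :: "'k::field_char_0"
  assumes d: "d \<ge> 2"
  shows "block_matrix a p q r s \<in> auts (YZ_form d e) \<longleftrightarrow> a \<noteq> 0 \<and> p * s - q * r \<noteq> 0 \<and>
    (\<forall>y z. binary_YZ d e (p * y + q * z) (r * y + s * z) = a ^ d * binary_YZ d e y z)"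
proof -
  let ?F = "YZ_form d e" and ?B = "block_matrix a p q r s"
  have ev: "eval_at ?F v = (v $ 1) ^ d + binary_YZ d e (v $ 2) (v $ 3)" for v
    by (simp add: eval_at_YZ_form binary_YZ_def)
  have G0: "binary_YZ d e 0 0 = 0" using d by (simp add: binary_YZ_def)
  show ?thesis
  proof (intro iffI conjI allI)
    assume B: "?B \<in> auts ?F"
    then show nz: "a \<noteq> 0" "p * s - q * r \<noteq> 0"
      using auts_invertible invertible_block_matrix by blast+
    obtain c where c: "\<And>v. eval_at ?F (?B *v v) = c * eval_at ?F v"
      using B unfolding auts_def carries_iff by blast
    have c: "(a * x) ^ d + binary_YZ d e (p * y + q * z) (r * y + s * z) = c * (x ^ d + binary_YZ d e y z)" for x y z
      using c[of "\<chi> i. if i = 1 then x else if i = 2 then y else z"]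
      by (simp add: ev block_matrix_mult_vector)
    have "c = a ^ d" using c[of 1 0 0] by (simp add: G0)
    then show "binary_YZ d e (p * y + q * z) (r * y + s * z) = a ^ d * binary_YZ d e y z" for y z
      using c[of 0 y z] d by (simp add: power_0_left)
  next
    assume r: "a \<noteq> 0 \<and> p * s - q * r \<noteq> 0 \<and>
      (\<forall>y z. binary_YZ d e (p * y + q * z) (r * y + s * z) = a ^ d * binary_YZ d e y z)"
    then show "?B \<in> auts ?F"
      unfolding auts_def carries_iff
      by (auto simp: invertible_block_matrix ev block_matrix_mult_vector power_mult_distrib distrib_left intro!: exI[of _ "a ^ d"])
  qed
qed

text \<open>The quotient of the two binomial coefficients is \<open>(m - 2) / 3\<close>. Since
  \<open>m\<close> will be \<open>d - 1\<close>, this is what singles out degree six.\<close>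

lemma choose_3_eq_choose_2:
  assumes C: "m choose 3 = m choose 2" and m: "m \<ge> 3"
  shows "m = 5"
proof -
  have B3: "3 * (m choose 3) = m * (m - 1 choose 2)"
    using binomial_absorption[of 2 m] by (simp only: numeral_3_eq_3 numeral_2_eq_2)
  have B2: "2 * (m choose 2) = m * (m - 1)" for m :: nat
    using binomial_absorption[of 1 m] by (simp only: Suc_1 choose_one)
  have "m * ((m - 1) * (m - 1 - 1)) = m * (2 * (m - 1 choose 2))" by (simp only: B2)
  also have "\<dots> = 2 * (3 * (m choose 2))" by (simp only: B3[symmetric] C mult.left_commute[of m])
  also have "\<dots> = m * ((m - 1) * 3)" by (simp only: mult.left_commute[of 2] B2 mult_ac)
  finally have "m = 0 \<or> m - 1 = 0 \<or> m - 1 - 1 = 3" by (simp only: mult_cancel1) blast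
  with m show ?thesis by linarith
qed

text \<open>If \<open>p\<close> or \<open>r\<close> is zero, the coefficient of \<open>t^2\<close>
  already forces a monomial substitution. Otherwise the ratios \<open>u = q / p\<close> and
  \<open>w = s / r\<close> satisfy \<open>u^2 = w^2\<close> by the coefficient of
  \<open>t^2\<close>, so \<open>w = - u\<close>, and the coefficient of \<open>t^3\<close> leaves
  only \<open>m = 5\<close>.\<close>

lemma binary_YZ_automorphism:
  fixes p q r s e \<kappa> :: "'k::field_char_0" and n :: nat
  assumes n: "n \<ge> 3" and e: "e * e = 1" and \<kappa>: "\<kappa> \<noteq> 0" and det: "p * s - q * r \<noteq> 0"
    and eq: "\<And>y z. binary_YZ (n + 2) e (p * y + q * z) (r * y + s * z) = \<kappa> * binary_YZ (n + 2) e y z"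
  shows "q = 0 \<and> r = 0 \<and> p ^ n = s ^ n \<or> p = 0 \<and> s = 0 \<and> q ^ n = r ^ n \<or>
    n = 4 \<and> p ^ 4 = - e * r ^ 4 \<and> (\<exists>u. u ^ 4 = - e \<and> q = u * p \<and> s = - u * r)"
proof -
  define m where "m = n + 1"
  have m: "m \<ge> 4" "m \<noteq> 0" "m \<noteq> 1" "m \<noteq> 2" "m \<noteq> 3" "n + 2 - 1 = m" using n by (auto simp: m_def)
  have e0: "e \<noteq> 0" using e by auto
  \<comment> \<open>Dehomogenized at \<open>y = 1\<close>, \<open>z = t\<close>.\<close>
  have P: "[:p, q:] ^ m * [:r, s:] + Polynomial.smult e ([:r, s:] ^ m * [:p, q:])
      = Polynomial.smult \<kappa> (Polynomial.monom 1 1 + Polynomial.monom e m)" (is "?L = ?R")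
    unfolding poly_eq_poly_eq_iff[symmetric]
  proof
    fix t
    show "poly ?L t = poly ?R t"
      using eq[of 1 t, unfolded binary_YZ_def m(6)]
      by (simp add: poly_monom mult_ac del: mult_pCons_left mult_pCons_right)
  qed
  have coeff_mult_linear: "Polynomial.coeff (Q * [:a, b:]) (Suc k) = a * Polynomial.coeff Q (Suc k) + b * Polynomial.coeff Q k"
    for Q and a b :: 'k and k by simp
  have coeffs: "r * (of_nat (m choose Suc k) * q ^ Suc k * p ^ (m - Suc k)) + s * (of_nat (m choose k) * q ^ k * p ^ (m - k))
      + e * (p * (of_nat (m choose Suc k) * s ^ Suc k * r ^ (m - Suc k)) + q * (of_nat (m choose k) * s ^ k * r ^ (m - k)))
      = \<kappa> * ((if k = 0 then 1 else 0) + (if Suc k = m then e else 0))" if "Suc k \<le> m" for k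
    using arg_cong[OF P, of "\<lambda>P. Polynomial.coeff P (Suc k)"] that m(2)
    by (simp add: coeff_mult_linear coeff_linear_poly_power del: mult_pCons_left mult_pCons_right power_Suc binomial_Suc_Suc)
  have coeff_0: "p ^ m * r + e * (r ^ m * p) = 0"
    using arg_cong[OF P, of "\<lambda>P. Polynomial.coeff P 0"] m(2)
    by (simp add: coeff_mult_0 coeff_0_power del: mult_pCons_left mult_pCons_right)
  have pow_0: "(0::'k) ^ m = 0" "(0::'k) ^ (m - Suc 0) = 0" "(0::'k) ^ (m - 2) = 0" "(0::'k) ^ (m - Suc (Suc 0)) = 0"
    using m by (auto simp: power_0_left)
  have c1: "r * (of_nat m * q * p ^ (m - 1)) + s * p ^ m + e * (p * (of_nat m * s * r ^ (m - 1)) + q * r ^ m) = \<kappa>"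
    using coeffs[of 0] m by simp
  have c2: "r * (of_nat (m choose 2) * q ^ 2 * p ^ (m - 2)) + s * (of_nat m * q * p ^ (m - 1))
      + e * (p * (of_nat (m choose 2) * s ^ 2 * r ^ (m - 2)) + q * (of_nat m * s * r ^ (m - 1))) = 0"
    using coeffs[of 1] m by (simp add: numeral_2_eq_2)
  have cm: "r * q ^ m + s * (of_nat m * q ^ (m - 1) * p) + e * (p * s ^ m + q * (of_nat m * s ^ (m - 1) * r)) = \<kappa> * e"
    using coeffs[of "m - 1"] m binomial_symmetric[of 1 m] by (simp del: power_Suc)
  have pow_m: "x ^ m = x * x ^ n" for x :: 'k by (simp add: m_def)
  consider "p = 0" | "r = 0" | "p \<noteq> 0" "r \<noteq> 0" by blast
  then show ?thesis
  proof cases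
    case 1
    with det have qr: "q \<noteq> 0" "r \<noteq> 0" by auto
    from c2 have "e * (q * (of_nat m * s * r ^ (m - 1))) = 0" by (simp add: 1 pow_0)
    then have "s = 0" using qr e0 m by simp
    moreover from c1 cm have "r * q ^ m = e * (q * r ^ m) * e" by (simp add: 1 \<open>s = 0\<close> pow_0)
    \<comment> \<open>Exchanging \<open>Y\<close> and \<open>Z\<close> moves the coefficient
      \<open>e\<close> to the other monomial; comparing both monomials produces the factor
      \<open>e * e = 1\<close>.\<close>
    then have "r * q * q ^ n = (e * e) * (r * q * r ^ n)" by (simp add: pow_m mult_ac)
    then have "q ^ n = r ^ n" using qr by (simp add: e)
    ultimately show ?thesis using 1 by simp
  next
    case 2
    with det have ps: "p \<noteq> 0" "s \<noteq> 0" by auto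
    from c2 have "s * (of_nat m * q * p ^ (m - 1)) = 0" by (simp add: 2 pow_0)
    then have "q = 0" using ps m by simp
    moreover from c1 cm have "e * (p * s ^ m) = s * p ^ m * e" by (simp add: 2 \<open>q = 0\<close> pow_0)
    then have "(e * p * s) * s ^ n = (e * p * s) * p ^ n" by (simp add: pow_m mult_ac)
    then have "p ^ n = s ^ n" using ps e0 by simp
    ultimately show ?thesis using 2 by simp
  next
    case 3
    define u w where "u = q / p" and "w = s / r"
    have qs: "q = u * p" "s = w * r" using 3 by (simp_all add: u_def w_def)
    have uw: "u \<noteq> w" using det by (auto simp: qs algebra_simps)
    \<comment> \<open>The vanishing constant coefficient makes the leading constants of the two
      products, \<open>p^m r\<close> and \<open>e r^m p\<close>, opposite to each other, so
      \<open>T\<close> factors out of every coefficient.\<close>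
    define T where "T = p ^ m * r"
    have T: "T \<noteq> 0" "e * (r ^ m * p) = - T"
      using 3 coeff_0 unfolding T_def add_eq_0_iff by simp_all
    have pw: "(x * y) ^ k * y ^ (m - k) = x ^ k * y ^ m" if "k \<le> m" for x y :: 'k and k
      using that by (simp add: power_mult_distrib mult.assoc flip: power_add)
    have K: "T * (of_nat (m choose Suc k) * (u ^ Suc k - w ^ Suc k) + of_nat (m choose k) * (w * u ^ k - u * w ^ k))
        = \<kappa> * ((if k = 0 then 1 else 0) + (if Suc k = m then e else 0))" if k: "Suc k \<le> m" for k
    proof -
      let ?a = "of_nat (m choose Suc k) :: 'k" and ?b = "of_nat (m choose k) :: 'k"
      have "\<kappa> * ((if k = 0 then 1 else 0) + (if Suc k = m then e else 0))
        = r * (?a * (u ^ Suc k * p ^ m)) + w * r * (?b * (u ^ k * p ^ m))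
          + e * (p * (?a * (w ^ Suc k * r ^ m)) + u * p * (?b * (w ^ k * r ^ m)))"
        unfolding coeffs[OF k, symmetric] qs mult.assoc[of ?a] mult.assoc[of ?b] by (simp only: pw[OF k] pw[OF Suc_leD[OF k]])
      also have "\<dots> = (p ^ m * r) * (?a * u ^ Suc k + ?b * (w * u ^ k)) + (e * (r ^ m * p)) * (?a * w ^ Suc k + ?b * (u * w ^ k))"
        by (simp only: distrib_left distrib_right mult_ac)
      also have "\<dots> = T * (?a * (u ^ Suc k - w ^ Suc k) + ?b * (w * u ^ k - u * w ^ k))"
        unfolding T(2) unfolding T_def[symmetric]
        by (simp only: right_diff_distrib distrib_left mult_minus_left mult_minus_right diff_conv_add_uminus minus_add_distrib add_ac)
      finally show ?thesis by simp
    qed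
    have "of_nat (m choose 2) * (u ^ 2 - w ^ 2) = 0"
      using K[of 1] m T(1) by (simp add: numeral_2_eq_2 mult.commute)
    then have "u ^ 2 = w ^ 2" using m by simp
    then have w: "w = - u" using uw by (simp add: power2_eq_iff)
    have u0: "u \<noteq> 0" using uw w by auto
    have Suc2: "Suc 2 = 3" by simp
    have rhs0: "\<kappa> * ((if (2::nat) = 0 then 1 else 0) + (if 3 = m then e else 0)) = 0" using m by simp
    have "T * (of_nat (m choose 3) * (u ^ 3 - w ^ 3) + of_nat (m choose 2) * (w * u ^ 2 - u * w ^ 2)) = 0"
      by (rule K[of 2, unfolded Suc2 rhs0]) (use m in simp)
    moreover have "u ^ 3 - w ^ 3 = 2 * u ^ 3" "w * u ^ 2 - u * w ^ 2 = - (2 * u ^ 3)"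
      by (simp_all add: w power3_eq_cube power2_eq_square)
    ultimately have "T * (of_nat (m choose 3) * (2 * u ^ 3) - of_nat (m choose 2) * (2 * u ^ 3)) = 0"
      by simp
    then have "of_nat (m choose 3) * (2 * u ^ 3) = of_nat (m choose 2) * (2 * u ^ 3)"
      using T(1) by (simp only: mult_eq_0_iff right_minus_eq) blast
    \<comment> \<open>With \<open>w = - u\<close> both differences of powers become
      \<open>2 u^3\<close> up to sign, and only the binomial coefficients remain.\<close>
    then have "of_nat (m choose 3) = (of_nat (m choose 2) :: 'k)" using u0 by simp
    then have C: "m choose 3 = m choose 2" by (simp only: of_nat_eq_iff)
    have "m = 5" using choose_3_eq_choose_2 C m(1) by simp
    then have n4: "n = 4" by (simp add: m_def)
    have choose5: "(5::nat) choose Suc 0 = 5" "(5::nat) choose 5 = 1" "(5::nat) choose 4 = 5"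
      using choose_one[of 5] binomial_n_n[of 5] binomial_symmetric[of 4 5] by simp_all
    have Suc4: "Suc 4 = 5" by simp
    have "T * (of_nat 5 * (u ^ Suc 0 - w ^ Suc 0) + of_nat (5 choose 0) * (w * u ^ 0 - u * w ^ 0))
        = \<kappa> * ((if (0::nat) = 0 then 1 else 0) + (if Suc 0 = 5 then e else 0))"
      by (rule K[of 0, unfolded \<open>m = 5\<close> choose5]) simp
    then have "T * (5 * (u - w) + (w - u)) = \<kappa>" by (simp del: mult_eq_0_iff)
    moreover have "5 * (u - w) + (w - u) = 8 * u" by (simp add: w)
    \<comment> \<open>The coefficients of \<open>t\<close> and \<open>t^5\<close> are
      \<open>8 T u = \<kappa>\<close> and \<open>- 8 T u^5 = \<kappa> e\<close>; dividing them gives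
      \<open>u^4 = - e\<close>.\<close>
    ultimately have k1: "T * (8 * u) = \<kappa>" by metis
    have "T * (of_nat 1 * (u ^ 5 - w ^ 5) + of_nat 5 * (w * u ^ 4 - u * w ^ 4))
        = \<kappa> * ((if (4::nat) = 0 then 1 else 0) + (if (5::nat) = 5 then e else 0))"
      by (rule K[of 4, unfolded \<open>m = 5\<close> Suc4 choose5]) simp
    moreover have "of_nat 1 * (u ^ 5 - w ^ 5) + of_nat 5 * (w * u ^ 4 - u * w ^ 4) = - 8 * (u * u ^ 4)"
      by (simp add: w flip: power_Suc)
    moreover have "(if (4::nat) = 0 then 1 else 0) + (if (5::nat) = 5 then e else 0) = e" by simp
    ultimately have k5: "T * (- 8 * (u * u ^ 4)) = \<kappa> * e" by metis
    have "(8 * T * u) * (- (u ^ 4)) = (8 * T * u) * e"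
      using k5 unfolding k1[symmetric] by (simp only: mult_ac mult_minus_left mult_minus_right)
    then have "- (u ^ 4) = e" using T(1) u0 by (simp only: mult_cancel_left) simp
    then have "u ^ 4 = - e" by (metis minus_minus)
    moreover have "p ^ 4 = - e * r ^ 4"
    proof -
      have p5: "x ^ 5 = x * x ^ 4" for x :: 'k by (simp flip: power_Suc)
      have "(p * r) * p ^ 4 = T" by (simp add: T_def \<open>m = 5\<close> p5 mult_ac)
      also have "\<dots> = - (e * (r ^ m * p))" by (simp only: T(2) minus_minus)
      also have "\<dots> = (p * r) * (- e * r ^ 4)" by (simp add: \<open>m = 5\<close> p5 mult_ac)
      finally have "(p * r) * p ^ 4 = (p * r) * (- e * r ^ 4)" .
      then show ?thesis using 3 by (simp only: mult_cancel_left) simp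
    qed
    moreover have "s = - u * r" using qs(2) w by simp
    ultimately show ?thesis using n4 qs(1) by blast
  qed
qed


section \<open>Discrete logarithms of roots of unity\<close>

lemma powi_eq_1_iff:
  fixes w :: "'a::field"
  assumes "primitive_root n w"
  shows "w powi j = 1 \<longleftrightarrow> int n dvd j"
proof (cases j)
  case (nonneg m)
  then show ?thesis using primitive_rootD[OF assms, of m] by (simp add: power_int_of_nat)
next
  case (neg m)
  have "w powi j = inverse (w ^ Suc m)"
    using neg power_int_minus[of w "int (Suc m)"] by (simp add: power_int_of_nat del: power_Suc of_nat_Suc)
  moreover have "int n dvd j \<longleftrightarrow> n dvd Suc m"
    using neg by (simp only: dvd_minus_iff of_nat_dvd_iff)
  ultimately show ?thesis using primitive_rootD[OF assms, of "Suc m"] by (simp del: power_Suc)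
qed

lemma powi_eq_powi_iff:
  fixes w :: "'a::field"
  assumes "primitive_root n w" "n > 0"
  shows "w powi i = w powi j \<longleftrightarrow> i mod int n = j mod int n"
proof -
  have w: "w \<noteq> 0" using primitive_root_nz[OF assms] .
  have "w powi i = w powi j \<longleftrightarrow> w powi (i - j) = 1"
    using w by (simp add: power_int_diff)
  also have "\<dots> \<longleftrightarrow> i mod int n = j mod int n"
    by (simp add: powi_eq_1_iff[OF assms(1)] mod_eq_dvd_iff)
  finally show ?thesis .
qed

text \<open>The logarithm to the base \<open>w\<close>, taken in the range that
  \<open>integer_mod_group n\<close> uses as its carrier; meaningful for \<open>n\<close>-th roots
  of unity.\<close>

definition root_log :: "nat \<Rightarrow> 'a::field \<Rightarrow> 'a \<Rightarrow> int" where
  "root_log n w x = (THE k. k \<in> {0..<int n} \<and> x = w powi k)"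

lemma root_log_powi:
  assumes "primitive_root n w" "n > 0"
  shows "root_log n w (w powi j) = j mod int n"
  unfolding root_log_def
proof (rule the_equality)
  show "j mod int n \<in> {0..<int n} \<and> w powi j = w powi (j mod int n)"
    using assms(2) by (simp add: powi_eq_powi_iff[OF assms])
qed (use assms(2) in \<open>auto simp: powi_eq_powi_iff[OF assms]\<close>)

lemma root_of_unity_powi:
  fixes x :: "'a::field"
  assumes "primitive_root n w" "n > 0" "x ^ n = 1"
  obtains j where "x = w powi j"
proof -
  obtain k where "x = w ^ k" using primitive_root_power_of_unity[OF assms] by blast
  then have "x = w powi int k" by (simp add: power_int_of_nat)
  with that show thesis by blast
qed

lemma powi_pow_n: "primitive_root n w \<Longrightarrow> (w powi j) ^ n = 1" for w :: "'a::field"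
  using powi_eq_1_iff[of n w "j * int n"] by (simp add: power_int_mult power_int_of_nat)

lemma root_log_range:
  fixes x :: "'a::field"
  assumes "primitive_root n w" "n > 0" "x ^ n = 1"
  shows "root_log n w x \<in> {0..<int n}" "w powi (root_log n w x) = x"
proof -
  obtain j where "x = w powi j" using root_of_unity_powi[OF assms] .
  then show "root_log n w x \<in> {0..<int n}" "w powi (root_log n w x) = x"
    using assms by (simp_all add: root_log_powi powi_eq_powi_iff)
qed

text \<open>The nested \<open>mod\<close> in the quotient rule is the inverse in
  \<open>integer_mod_group n\<close>, in the shape in which it occurs in a dihedral product with a
  reflection on the left.\<close>

lemma root_log_mult:
  fixes x y :: "'a::field"
  assumes w: "primitive_root n w" "n > 0" and "x ^ n = 1" "y ^ n = 1"
  shows "root_log n w (x * y) = (root_log n w x + root_log n w y) mod int n"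
    and "root_log n w (x / y) = (root_log n w x + (- root_log n w y) mod int n) mod int n"
proof -
  have w0: "w \<noteq> 0" using primitive_root_nz[OF w] .
  obtain i j where "x = w powi i" "y = w powi j" using root_of_unity_powi[OF w] assms by metis
  then show "root_log n w (x * y) = (root_log n w x + root_log n w y) mod int n"
    "root_log n w (x / y) = (root_log n w x + (- root_log n w y) mod int n) mod int n"
    by (simp_all add: root_log_powi[OF w] mod_simps flip: power_int_add[OF disjI1[OF w0]] power_int_diff[OF disjI1[OF w0]])
qed

section \<open>The central extension of the dihedral group\<close>

lemma carrier_dihedral_group: "n > 0 \<Longrightarrow> carrier (dihedral_group n) = {0..<int n} \<times> {0, 1}"
  by (auto simp: dihedral_group_def semidirect_product_def carrier_integer_mod_group)

lemma one_dihedral_group: "\<one>\<^bsub>dihedral_group n\<^esub> = (0, 0)"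
  by (simp add: dihedral_group_def semidirect_product_def)

lemma mult_dihedral_group:
  assumes "n > 0" "k' \<in> {0..<int n}"
  shows "(k, s) \<otimes>\<^bsub>dihedral_group n\<^esub> (k', s') = ((k + (if s = 0 then k' else (- k') mod int n)) mod int n, (s + s') mod 2)"
  using assms by (simp add: dihedral_group_def semidirect_product_def carrier_integer_mod_group)

lemma group_dihedral_group:
  assumes n: "n > 0"
  shows "group (dihedral_group n)"
proof (rule groupI)
  note [simp] = carrier_dihedral_group[OF n] one_dihedral_group
  fix x assume "x \<in> carrier (dihedral_group n)"
  then obtain k s where x: "x = (k, s)" "k \<in> {0..<int n}" "s = 0 \<or> s = 1" by auto
  show "\<exists>y\<in>carrier (dihedral_group n). y \<otimes>\<^bsub>dihedral_group n\<^esub> x = \<one>\<^bsub>dihedral_group n\<^esub>"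
    \<comment> \<open>Reflections are involutions, hence their own inverses.\<close>
    by (rule bexI[of _ "if s = 0 then ((- k) mod int n, 0) else x"])
      (use x n in \<open>auto simp: mult_dihedral_group mod_simps\<close>)
next
  note [simp] = carrier_dihedral_group[OF n]
  fix x y z assume "x \<in> carrier (dihedral_group n)" "y \<in> carrier (dihedral_group n)" "z \<in> carrier (dihedral_group n)"
  then obtain k s k' s' k'' s'' where xyz: "x = (k, s)" "y = (k', s')" "z = (k'', s'')"
    "k \<in> {0..<int n}" "k' \<in> {0..<int n}" "k'' \<in> {0..<int n}" "s = 0 \<or> s = 1" "s' = 0 \<or> s' = 1" "s'' = 0 \<or> s'' = 1"
    by auto
  have rng: "j mod int n \<in> {0..<int n}" for j using n by simp
  show "x \<otimes>\<^bsub>dihedral_group n\<^esub> y \<otimes>\<^bsub>dihedral_group n\<^esub> z = x \<otimes>\<^bsub>dihedral_group n\<^esub> (y \<otimes>\<^bsub>dihedral_group n\<^esub> z)"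
    unfolding xyz(1-3) mult_dihedral_group[OF n xyz(5)] mult_dihedral_group[OF n xyz(6)] mult_dihedral_group[OF n rng]
    using xyz(7-9)
    by (elim disjE; simp add: mod_add_left_eq mod_add_right_eq mod_diff_left_eq mod_diff_right_eq)
      (simp_all add: algebra_simps)
qed (use n in \<open>auto simp: carrier_dihedral_group one_dihedral_group mult_dihedral_group\<close>)

text \<open>These are the homologies with centre \<open>(1 : 0 : 0)\<close> and axis
  \<open>X = 0\<close>; they make up the central subgroup of order \<open>d\<close>.\<close>

lemma homology_in_auts:
  fixes e :: "'k::field_char_0"
  assumes "d \<ge> 2" "x ^ d = 1"
  shows "block_matrix x 1 0 0 1 \<in> auts (YZ_form d e)"
  using assms by (auto simp: block_matrix_in_auts_iff power_0_left)

text \<open>Equality of the \<open>(d-2)\<close>-th powers says that \<open>Y^(d-1) Z\<close> and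
  \<open>Y Z^(d-1)\<close> are scaled by the same factor; the antidiagonal case follows because the
  binary form is symmetric.\<close>

lemma monomial_block_in_auts_iff:
  fixes a p s :: "'k::field_char_0"
  assumes d: "d \<ge> 2"
  shows "p ^ (d - 2) = s ^ (d - 2) \<Longrightarrow> block_matrix a p 0 0 s \<in> auts (YZ_form d 1) \<longleftrightarrow>
      a \<noteq> 0 \<and> p \<noteq> 0 \<and> s \<noteq> 0 \<and> a ^ d = p ^ (d - 1) * s"
    and "p ^ (d - 2) = s ^ (d - 2) \<Longrightarrow> block_matrix a 0 p s 0 \<in> auts (YZ_form d 1) \<longleftrightarrow>
      a \<noteq> 0 \<and> p \<noteq> 0 \<and> s \<noteq> 0 \<and> a ^ d = p ^ (d - 1) * s"
proof -
  assume "p ^ (d - 2) = s ^ (d - 2)"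
  moreover have "x ^ (d - 1) = x * x ^ (d - 2)" for x :: 'k
  proof -
    have "d - 1 = Suc (d - 2)" using d by simp
    then show ?thesis by simp
  qed
  ultimately have ps: "p * s ^ (d - 1) = p ^ (d - 1) * s" by (simp add: mult_ac)
  have 1: "binary_YZ d 1 (p * y) (s * z) = p ^ (d - 1) * s * binary_YZ d 1 y z" for y z
  proof -
    have "binary_YZ d 1 (p * y) (s * z) = p ^ (d - 1) * s * (y ^ (d - 1) * z) + p * s ^ (d - 1) * (y * z ^ (d - 1))"
      by (simp add: binary_YZ_def power_mult_distrib mult_ac)
    then show ?thesis unfolding ps by (simp add: binary_YZ_def distrib_left)
  qed
  have 2: "binary_YZ d 1 (p * z) (s * y) = p ^ (d - 1) * s * binary_YZ d 1 y z" for y z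
    unfolding 1 by (simp add: binary_YZ_def mult.commute add.commute)
  \<comment> \<open>A point where the binary form is nonzero, needed to cancel the form and read off
    \<open>a^d\<close>.\<close>
  have 3: "binary_YZ d 1 1 1 = (2::'k)" by (simp add: binary_YZ_def)
  show "block_matrix a p 0 0 s \<in> auts (YZ_form d 1) \<longleftrightarrow> a \<noteq> 0 \<and> p \<noteq> 0 \<and> s \<noteq> 0 \<and> a ^ d = p ^ (d - 1) * s"
    using block_matrix_in_auts_iff[OF d, of a p 0 0 s 1] 3 by (auto simp: 1)
  show "block_matrix a 0 p s 0 \<in> auts (YZ_form d 1) \<longleftrightarrow> a \<noteq> 0 \<and> p \<noteq> 0 \<and> s \<noteq> 0 \<and> a ^ d = p ^ (d - 1) * s"
    using block_matrix_in_auts_iff[OF d, of a 0 p s 0 1] 3 by (auto simp: 2)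
qed

text \<open>Excluding \<open>d = 6\<close> discards precisely the octahedral alternative of the
  binary classification.\<close>

lemma auts_YZ_form_monomial:
  fixes A :: "'k::field_char_0^3^3"
  assumes d: "d \<ge> 5" "d \<noteq> 6" and A: "A \<in> auts (YZ_form d 1)"
  obtains (diag) a p s where "A = block_matrix a p 0 0 s" "a \<noteq> 0" "p \<noteq> 0" "s \<noteq> 0" "p ^ (d - 2) = s ^ (d - 2)" "a ^ d = p ^ (d - 1) * s"
  | (anti) a q r where "A = block_matrix a 0 q r 0" "a \<noteq> 0" "q \<noteq> 0" "r \<noteq> 0" "q ^ (d - 2) = r ^ (d - 2)" "a ^ d = q ^ (d - 1) * r"
proof -
  obtain a p q r s where B: "A = block_matrix a p q r s" "a \<noteq> 0" "p * s - q * r \<noteq> 0"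
    using auts_YZ_form_block[OF d(1) one_neq_zero A] .
  have d2: "d \<ge> 2" "d - 2 + 2 = d" "d - 2 \<ge> 3" "d - 2 \<noteq> 4" using d by auto
  have eq: "a \<noteq> 0" "p * s - q * r \<noteq> 0" "\<And>y z. binary_YZ d 1 (p * y + q * z) (r * y + s * z) = a ^ d * binary_YZ d 1 y z"
    using A block_matrix_in_auts_iff[OF d2(1)] unfolding B(1) by blast+
  have "a ^ d \<noteq> 0" using eq(1) by simp
  from binary_YZ_automorphism[OF d2(3) _ this eq(2), of 1, unfolded d2(2), OF _ eq(3)] d2(4)
  consider "q = 0" "r = 0" "p ^ (d - 2) = s ^ (d - 2)" | "p = 0" "s = 0" "q ^ (d - 2) = r ^ (d - 2)" by auto
  then show thesis
  proof cases
    case 1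
    then show thesis
      using diag[of a p s] A monomial_block_in_auts_iff(1)[OF d2(1) 1(3), of a] unfolding B(1) by simp
  next
    case 2
    then show thesis
      using anti[of a q r] A monomial_block_in_auts_iff(2)[OF d2(1) 2(3), of a] unfolding B(1) by simp
  qed
qed

lemma block_matrix_nth:
  "block_matrix a p q r s $ 2 $ 2 = p" "block_matrix a p q r s $ 2 $ 3 = q"
  "block_matrix a p q r s $ 3 $ 2 = r" "block_matrix a p q r s $ 3 $ 3 = s"
  by (simp_all add: block_matrix_def)

lemma homology_kernel:
  fixes a p w :: "'k::field"
  assumes "primitive_root d w" "d > 0" "p \<noteq> 0" "a ^ d = p ^ d"
  obtains k where "k \<in> {0..<int d}" "block_matrix a p 0 0 p = mat p ** block_matrix (w powi k) 1 0 0 1"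
proof -
  have "(a / p) ^ d = 1" using assms by (simp add: power_divide)
  from root_log_range[OF assms(1,2) this] show thesis
    using assms(3) by (intro that[of "root_log d w (a / p)"]) (simp_all add: scale_block_matrix)
qed

lemma central_extension_dihedral:
  fixes d :: nat
  assumes d: "d \<ge> 5" "d \<noteq> 6"
  shows "central_extension (Aut_curve (YZ_form d 1 :: 'k::{alg_closed_field, field_char_0} ternary))
    (dihedral_group (d - 2)) (integer_mod_group d)"
proof -
  let ?F = "YZ_form d 1 :: 'k ternary" and ?n = "d - 2"
  have d0: "d > 0" "?n > 0" "d \<ge> 2" "d \<ge> 1" using d by auto
  obtain w :: 'k where w: "primitive_root ?n w" using primitive_root_exists[OF d0(2)] .
  obtain z :: 'k where z: "primitive_root d z" using primitive_root_exists[OF d0(1)] .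
  let ?log = "root_log ?n w"
  \<comment> \<open>\<open>\<Phi>\<close> records the action on the lines through
    \<open>(1 : 0 : 0)\<close>: the ratio of the two entries is an \<open>n\<close>-th root of unity
    giving the rotation, and a nonzero off-diagonal entry marks a reflection.\<close>
  define \<Phi> where "\<Phi> A = (if A $ 2 $ 3 = 0 then (?log (A $ 2 $ 2 / A $ 3 $ 3), 0) else (?log (A $ 2 $ 3 / A $ 3 $ 2), 1 :: int))"
    for A :: "'k^3^3"
  define \<psi> where "\<psi> k = block_matrix (z powi k) 1 0 0 (1::'k)" for k
  have \<Phi>_diag: "\<Phi> (block_matrix a p 0 0 s) = (?log (p / s), 0)" for a p s
    by (simp add: \<Phi>_def block_matrix_nth)
  have \<Phi>_anti: "q \<noteq> 0 \<Longrightarrow> \<Phi> (block_matrix a 0 q r 0) = (?log (q / r), 1)" for a q r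
    by (simp add: \<Phi>_def block_matrix_nth)
  note logm = root_log_mult[OF w d0(2)]
  note log_range = root_log_range[OF w d0(2)]
  show ?thesis
  proof (rule central_extension_Aut_curve[where \<Phi> = \<Phi> and \<psi> = \<psi>])
    show "homogeneous d ?F" by (rule homogeneous_YZ_form[OF d0(4)])
    show "group (dihedral_group ?n)" by (rule group_dihedral_group[OF d0(2)])
    show "group (integer_mod_group d)" by simp
  next
    fix A assume "A \<in> auts ?F"
    with d show "\<Phi> A \<in> carrier (dihedral_group ?n)"
    proof (cases rule: auts_YZ_form_monomial)
      case (diag a p s)
      then have "(p / s) ^ ?n = 1" by (simp add: power_divide)
      then show ?thesis using log_range by (simp add: diag(1) \<Phi>_diag carrier_dihedral_group[OF d0(2)])
    next
      case (anti a q r)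
      then have "(q / r) ^ ?n = 1" by (simp add: power_divide)
      then show ?thesis using log_range anti(3) by (simp add: anti(1) \<Phi>_anti carrier_dihedral_group[OF d0(2)])
    qed
  next
    fix A and c :: 'k assume "A \<in> auts ?F" and c: "c \<noteq> 0"
    with d show "\<Phi> (mat c ** A) = \<Phi> A"
      by (cases rule: auts_YZ_form_monomial) (auto simp: scale_block_matrix \<Phi>_diag \<Phi>_anti)
  next
    fix A B assume A: "A \<in> auts ?F" and B: "B \<in> auts ?F"
    have unit: "(x / y) ^ ?n = 1" if "x ^ ?n = y ^ ?n" "y \<noteq> 0" for x y :: 'k
      using that by (simp add: power_divide)
    from d A show "\<Phi> (A ** B) = \<Phi> A \<otimes>\<^bsub>dihedral_group ?n\<^esub> \<Phi> B"
    proof (cases rule: auts_YZ_form_monomial)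
      case (diag a p s)
      note A = this
      from d B show ?thesis
      proof (cases rule: auts_YZ_form_monomial)
        case (diag a' p' s')
        have "p * p' / (s * s') = (p / s) * (p' / s')" by simp
        then show ?thesis
          using logm(1)[OF unit[OF A(5,4)] unit[OF diag(5,4)]] log_range(1)[OF unit[OF diag(5,4)]]
          by (simp add: A(1) diag(1) block_matrix_mult \<Phi>_diag mult_dihedral_group[OF d0(2)])
      next
        case (anti a' q' r')
        have "p * q' / (s * r') = (p / s) * (q' / r')" by simp
        then show ?thesis
          using logm(1)[OF unit[OF A(5,4)] unit[OF anti(5,4)]] log_range(1)[OF unit[OF anti(5,4)]] A(3) anti(3)
          by (simp add: A(1) anti(1) block_matrix_mult \<Phi>_diag \<Phi>_anti mult_dihedral_group[OF d0(2)])
      qed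
    next
      case (anti a q r)
      note A = this
      from d B show ?thesis
      proof (cases rule: auts_YZ_form_monomial)
        case (diag a' p' s')
        \<comment> \<open>A reflection on the left inverts the ratio of the right factor, matching
          the action in the dihedral group.\<close>
        have "q * s' / (r * p') = (q / r) / (p' / s')" by simp
        then show ?thesis
          using logm(2)[OF unit[OF A(5,4)] unit[OF diag(5,4)]] log_range(1)[OF unit[OF diag(5,4)]] A(3) diag(4)
          by (simp add: A(1) diag(1) block_matrix_mult \<Phi>_diag \<Phi>_anti mult_dihedral_group[OF d0(2)])
      next
        case (anti a' q' r')
        have "q * r' / (r * q') = (q / r) / (q' / r')" by simp
        then show ?thesis
          using logm(2)[OF unit[OF A(5,4)] unit[OF anti(5,4)]] log_range(1)[OF unit[OF anti(5,4)]] A(3) anti(3)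
          by (simp add: A(1) anti(1) block_matrix_mult \<Phi>_diag \<Phi>_anti mult_dihedral_group[OF d0(2)])
      qed
    qed
  next
    fix x assume "x \<in> carrier (dihedral_group ?n)"
    then obtain k t where x: "x = (k, t)" "k \<in> {0..<int ?n}" "t = 0 \<or> t = 1"
      by (auto simp: carrier_dihedral_group[OF d0(2)])
    have w0: "w powi k \<noteq> 0" using primitive_root_nz[OF w d0(2)] by simp
    \<comment> \<open>Lifting a binary substitution to the curve requires a \<open>d\<close>-th root
      of its multiplier as the scaling of \<open>X\<close>.\<close>
    obtain a :: 'k where a: "a ^ d = (w powi k) ^ (d - 1)" using nth_root_exists[OF d0(1)] by blast
    have a0: "a \<noteq> 0" using a w0 d0(1) by (metis power_not_zero zero_power)
    have wn: "(w powi k) ^ ?n = 1 ^ ?n" using powi_pow_n[OF w] by simp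
    have log: "?log (w powi k) = k" using root_log_powi[OF w d0(2), of k] x(2) by simp
    show "\<exists>A\<in>auts ?F. \<Phi> A = x"
    proof (cases "t = 0")
      case True
      then show ?thesis
        using monomial_block_in_auts_iff(1)[OF d0(3) wn, of a] a a0 w0 log x(1)
        by (intro bexI[of _ "block_matrix a (w powi k) 0 0 1"]) (simp_all add: \<Phi>_diag)
    next
      case False
      then show ?thesis
        using monomial_block_in_auts_iff(2)[OF d0(3) wn, of a] a a0 w0 log x(1,3)
        by (intro bexI[of _ "block_matrix a 0 (w powi k) 1 0"]) (simp_all add: \<Phi>_anti)
    qed
  next
    fix k show "\<psi> k \<in> auts ?F"
      unfolding \<psi>_def by (rule homology_in_auts[OF d0(3) powi_pow_n[OF z]])
  next
    fix k l :: int
    have "z powi ((k + l) mod int d) = z powi (k + l)" by (simp add: powi_eq_powi_iff[OF z d0(1)])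
    then show "\<psi> (k \<otimes>\<^bsub>integer_mod_group d\<^esub> l) = \<psi> k ** \<psi> l"
      using primitive_root_nz[OF z d0(1)] by (simp add: \<psi>_def block_matrix_mult power_int_add)
  next
    fix k l :: int and c :: 'k
    assume kl: "k \<in> carrier (integer_mod_group d)" "l \<in> carrier (integer_mod_group d)" and "\<psi> k = mat c ** \<psi> l"
    then have "z powi k = z powi l" by (simp add: \<psi>_def scale_block_matrix block_matrix_inject)
    with kl d0(1) show "k = l" by (simp add: powi_eq_powi_iff[OF z d0(1)] carrier_integer_mod_group)
  next
    fix k :: int and A assume "A \<in> auts ?F"
    then obtain a p q r s where "A = block_matrix a p q r s" "a \<noteq> 0" "p * s - q * r \<noteq> 0"
      using auts_YZ_form_block[OF d(1) one_neq_zero] by blast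
    then show "\<psi> k ** A = A ** \<psi> k" by (simp add: \<psi>_def block_matrix_mult mult.commute)
  next
    fix A assume A: "A \<in> auts ?F"
    show "\<Phi> A = \<one>\<^bsub>dihedral_group ?n\<^esub> \<longleftrightarrow> (\<exists>k\<in>carrier (integer_mod_group d). \<exists>c. c \<noteq> 0 \<and> A = mat c ** \<psi> k)"
    proof
      assume \<Phi>: "\<Phi> A = \<one>\<^bsub>dihedral_group ?n\<^esub>"
      from d A show "\<exists>k\<in>carrier (integer_mod_group d). \<exists>c. c \<noteq> 0 \<and> A = mat c ** \<psi> k"
      proof (cases rule: auts_YZ_form_monomial)
        case (diag a p s)
        have "(p / s) ^ ?n = 1" using diag by (simp add: power_divide)
        from log_range(2)[OF this] \<Phi> diag have "p = s"
          by (simp add: diag(1) \<Phi>_diag one_dihedral_group)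
        moreover have "p ^ (d - 1) * p = p ^ d" using d0(1) by (simp add: power_Suc2[symmetric] del: power_Suc)
        ultimately obtain k where "k \<in> {0..<int d}" "A = mat p ** \<psi> k"
          using homology_kernel[OF z d0(1) diag(3), of a] diag(1,6) unfolding \<psi>_def by metis
        with diag(3) d0(1) show ?thesis by (auto simp: carrier_integer_mod_group)
      next
        case (anti a q r)
        with \<Phi> show ?thesis by (simp add: \<Phi>_anti one_dihedral_group)
      qed
    next
      assume "\<exists>k\<in>carrier (integer_mod_group d). \<exists>c. c \<noteq> 0 \<and> A = mat c ** \<psi> k"
      then obtain k c where "c \<noteq> 0" "A = mat c ** \<psi> k" by blast
      then have "\<Phi> A = (?log (w powi 0), 0)" by (simp add: \<psi>_def scale_block_matrix \<Phi>_diag)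
      also have "?log (w powi 0) = 0" using root_log_powi[OF w d0(2), of 0] by simp
      finally show "\<Phi> A = \<one>\<^bsub>dihedral_group ?n\<^esub>" by (simp add: one_dihedral_group)
    qed
  qed
qed


section \<open>The sextic: the octahedral group acting on the four diagonals of a cube\<close>

text \<open>The zeros of \<open>Y^5 Z - Y Z^5\<close> on the Riemann sphere are the vertices of an octahedron, i.e.
  the centres of the faces of a cube.  The pairs of opposite vertices of the cube are the zeros of
  the quadrics \<open>\<plusminus>(Y^2 - Z^2) \<plusminus> \<i>(Y^2 + Z^2) \<plusminus> 2 Y Z\<close>.\<close>

definition cube_diagonal :: "'a::comm_ring_1 \<Rightarrow> nat \<Rightarrow> 'a^3 \<Rightarrow> 'a" where
  "cube_diagonal i j v = (if j = 2 then - 1 else 1) * ((v $ 2)^2 - (v $ 3)^2)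
     + (if j = 3 then - 1 else 1) * (i * ((v $ 2)^2 + (v $ 3)^2)) + (if j = 4 then - 1 else 1) * (2 * v $ 2 * v $ 3)"

text \<open>The condition says that \<open>A\<close> carries the zeros of quadric \<open>j\<close>
  to those of quadric \<open>\<sigma> j\<close>; with this direction products of matrices correspond
  to compositions in the same order.\<close>

definition permutes_diagonals :: "'a::comm_ring_1 \<Rightarrow> 'a^3^3 \<Rightarrow> (nat \<Rightarrow> nat) \<Rightarrow> bool" where
  "permutes_diagonals i A \<sigma> \<longleftrightarrow> \<sigma> permutes {1..4} \<and>
     (\<forall>j\<in>{1..4}. \<exists>l. l \<noteq> 0 \<and> (\<forall>v. cube_diagonal i (\<sigma> j) (A *v v) = l * cube_diagonal i j v))"

lemma set_1_4: "j \<in> {1..4} \<longleftrightarrow> j = 1 \<or> j = 2 \<or> j = 3 \<or> j = (4::nat)"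
  by auto

lemma permutes_diagonalsI:
  assumes "\<sigma> permutes {1..4}" "l1 \<noteq> 0" "l2 \<noteq> 0" "l3 \<noteq> 0" "l4 \<noteq> 0"
    "\<And>v. cube_diagonal i (\<sigma> 1) (A *v v) = l1 * cube_diagonal i 1 v"
    "\<And>v. cube_diagonal i (\<sigma> 2) (A *v v) = l2 * cube_diagonal i 2 v"
    "\<And>v. cube_diagonal i (\<sigma> 3) (A *v v) = l3 * cube_diagonal i 3 v"
    "\<And>v. cube_diagonal i (\<sigma> 4) (A *v v) = l4 * cube_diagonal i 4 v"
  shows "permutes_diagonals i A \<sigma>"
  unfolding permutes_diagonals_def set_1_4 Ball_def using assms by metis

lemma permutes_diagonals_mult:
  fixes A B :: "'a::field^3^3"
  assumes A: "permutes_diagonals i A \<sigma>" and B: "permutes_diagonals i B \<tau>"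
  shows "permutes_diagonals i (A ** B) (\<sigma> \<circ> \<tau>)"
  unfolding permutes_diagonals_def
proof (intro conjI ballI)
  have p: "\<sigma> permutes {1..4}" "\<tau> permutes {1..4}"
    using A B by (simp_all add: permutes_diagonals_def)
  then show "(\<sigma> \<circ> \<tau>) permutes {1..4}" by (simp add: permutes_compose)
  fix j :: nat assume j: "j \<in> {1..4}"
  then have tj: "\<tau> j \<in> {1..4}" using permutes_in_image[OF p(2)] by blast
  obtain l where l: "l \<noteq> 0" "\<And>v. cube_diagonal i (\<tau> j) (B *v v) = l * cube_diagonal i j v"
    using B j unfolding permutes_diagonals_def by blast
  obtain k where k: "k \<noteq> 0" "\<And>v. cube_diagonal i (\<sigma> (\<tau> j)) (A *v v) = k * cube_diagonal i (\<tau> j) v"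
    using A tj unfolding permutes_diagonals_def by blast
  show "\<exists>l. l \<noteq> 0 \<and> (\<forall>v. cube_diagonal i ((\<sigma> \<circ> \<tau>) j) (A ** B *v v) = l * cube_diagonal i j v)"
    by (rule exI[of _ "k * l"]) (simp add: k l flip: matrix_vector_mul_assoc)
qed

text \<open>The quadrics \<open>Y^2 - Z^2\<close>, \<open>Y^2 + Z^2\<close> and \<open>Y Z\<close>
  are independent, and the four sign triples, with at most one minus sign each, are pairwise
  different even up to a common sign.\<close>

lemma cube_diagonal_proportional:
  fixes i :: "'a::field_char_0"
  assumes i: "i * i = - 1" and ab: "a \<in> {1..4}" "b \<in> {1..4}" and l: "\<And>v. cube_diagonal i a v = l * cube_diagonal i b v"
  shows "a = b"
proof -
  have i0: "i \<noteq> 0" using i by auto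
  define s where "s m j = (if j = m then - 1 else 1 :: 'a)" for m j :: nat
  have eq: "s 2 a * (y^2 - z^2) + s 3 a * (i * (y^2 + z^2)) + s 4 a * (2 * y * z)
    = l * (s 2 b * (y^2 - z^2) + s 3 b * (i * (y^2 + z^2)) + s 4 b * (2 * y * z))" for y z
    using l[of "\<chi> k. if k = 2 then y else z"] unfolding cube_diagonal_def s_def by simp
  have 10: "s 2 a + s 3 a * i = l * (s 2 b + s 3 b * i)" using eq[of 1 0] by simp
  have 01: "- s 2 a + s 3 a * i = l * (- s 2 b + s 3 b * i)" using eq[of 0 1] by simp
  have 11: "s 3 a * (i * 2) + s 4 a * 2 = l * (s 3 b * (i * 2) + s 4 b * 2)" using eq[of 1 1] by simp
  have "(s 2 a + s 3 a * i) + (- s 2 a + s 3 a * i) = l * (s 2 b + s 3 b * i) + l * (- s 2 b + s 3 b * i)"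
    by (simp only: 10 01)
  then have "2 * (i * s 3 a) = 2 * (i * (l * s 3 b))" by (simp add: algebra_simps)
  then have Y: "s 3 a = l * s 3 b" using i0 by simp
  have "(s 2 a + s 3 a * i) - (- s 2 a + s 3 a * i) = l * (s 2 b + s 3 b * i) - l * (- s 2 b + s 3 b * i)"
    by (simp only: 10 01)
  then have "2 * s 2 a = 2 * (l * s 2 b)" by (simp add: algebra_simps)
  then have X: "s 2 a = l * s 2 b" by simp
  have "2 * s 4 a = 2 * (l * s 4 b)" using 11 Y by (simp add: algebra_simps)
  then have Z: "s 4 a = l * s 4 b" by simp
  have "l = 1 \<or> l = - 1" using X by (auto simp: s_def minus_equation_iff[of l] split: if_splits)
  then show ?thesis using X Y Z ab[unfolded set_1_4] by (elim disjE) (simp_all add: s_def)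
qed

lemma permutes_diagonals_unique:
  fixes A :: "'a::field_char_0^3^3"
  assumes i: "i * i = - 1" and A: "invertible A" and \<sigma>: "permutes_diagonals i A \<sigma>" and \<tau>: "permutes_diagonals i A \<tau>"
  shows "\<sigma> = \<tau>"
proof
  fix j
  obtain B where B: "A ** B = mat 1" using A unfolding invertible_def by blast
  have p: "\<sigma> permutes {1..4}" "\<tau> permutes {1..4}"
    using \<sigma> \<tau> by (simp_all add: permutes_diagonals_def)
  show "\<sigma> j = \<tau> j"
  proof (cases "j \<in> {1..4}")
    case True
    obtain l where l: "l \<noteq> 0" "\<And>v. cube_diagonal i (\<sigma> j) (A *v v) = l * cube_diagonal i j v"
      using \<sigma> True unfolding permutes_diagonals_def by blast
    obtain k where k: "k \<noteq> 0" "\<And>v. cube_diagonal i (\<tau> j) (A *v v) = k * cube_diagonal i j v"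
      using \<tau> True unfolding permutes_diagonals_def by blast
    have "cube_diagonal i (\<sigma> j) v = (l / k) * cube_diagonal i (\<tau> j) v" for v
      using l(2)[of "B *v v"] k(2)[of "B *v v"] k(1) by (simp add: matrix_vector_mul_assoc B)
    from cube_diagonal_proportional[OF i _ _ this] show ?thesis
      using True permutes_in_image[OF p(1)] permutes_in_image[OF p(2)] by blast
  next
    case False
    then show ?thesis using p by (simp add: permutes_not_in)
  qed
qed

lemma permutes_diagonals_scalar:
  fixes a p :: "'a::field"
  assumes "p \<noteq> 0"
  shows "permutes_diagonals i (block_matrix a p 0 0 p) id"
proof -
  have "cube_diagonal i j (block_matrix a p 0 0 p *v v) = p^2 * cube_diagonal i j v" for j v
    by (simp add: cube_diagonal_def block_matrix_mult_vector power2_eq_square algebra_simps)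
  then show ?thesis
    using assms unfolding permutes_diagonals_def by (auto intro!: permutes_id exI[of _ "p^2"])
qed

text \<open>The four-cycle (1 2 4 3), in the numbering of diagonals fixed by
  \<open>cube_diagonal\<close>: the effect of a quarter turn.\<close>

definition diagonal_cycle :: "nat \<Rightarrow> nat" where
  "diagonal_cycle = Transposition.transpose 1 2 \<circ> Transposition.transpose 2 4 \<circ> Transposition.transpose 4 3"

lemma diagonal_cycle_simps:
  "diagonal_cycle 1 = 2" "diagonal_cycle 2 = 4" "diagonal_cycle 4 = 3" "diagonal_cycle 3 = 1"
  "j \<noteq> 1 \<Longrightarrow> j \<noteq> 2 \<Longrightarrow> j \<noteq> 3 \<Longrightarrow> j \<noteq> 4 \<Longrightarrow> diagonal_cycle j = j"
  by (simp_all add: diagonal_cycle_def Transposition.transpose_def)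

lemma transpose_permutes_1_4:
  "a \<in> {1..4} \<Longrightarrow> b \<in> {1..4} \<Longrightarrow> Transposition.transpose a b permutes {1..4::nat}"
  by (rule permutes_swap_id)

lemma diagonal_cycle_permutes: "diagonal_cycle permutes {1..4}"
  unfolding diagonal_cycle_def by (intro permutes_compose transpose_permutes_1_4) auto

text \<open>Three rotations of the octahedron: the quarter turn \<open>(Y : Z) -> (Y : i Z)\<close>
  about the axis through 0 and infinity, the half turn \<open>(Y + Z : Y - Z)\<close> about an axis
  through midpoints of edges, and the half turn exchanging \<open>Y\<close> and
  \<open>Z\<close>.\<close>

lemma permutes_diagonals_generators:
  fixes i a :: "'a::field_char_0"
  assumes i: "i * i = - 1"
  shows "permutes_diagonals i (block_matrix a 1 0 0 i) diagonal_cycle"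
    and "permutes_diagonals i (block_matrix a 1 1 1 (- 1)) (Transposition.transpose 2 4)"
    and "permutes_diagonals i (block_matrix a 0 1 1 0) (Transposition.transpose 1 2 \<circ> Transposition.transpose 3 4)"
proof -
  have i0: "i \<noteq> 0" "- i \<noteq> 0" using i by auto
  have ii: "i * (i * x) = - x" for x using i by (simp flip: mult.assoc)
  note diagonal_simps = diagonal_cycle_simps cube_diagonal_def block_matrix_mult_vector power2_eq_square
  show "permutes_diagonals i (block_matrix a 1 0 0 i) diagonal_cycle"
    by (rule permutes_diagonalsI[OF diagonal_cycle_permutes i0 i0]; simp only: diagonal_simps)
      (simp_all add: algebra_simps i ii)
  show "permutes_diagonals i (block_matrix a 1 1 1 (- 1)) (Transposition.transpose 2 4)"
    by (rule permutes_diagonalsI[where ?l1.0 = 2 and ?l2.0 = 2 and ?l3.0 = 2 and ?l4.0 = 2])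
      (use transpose_permutes_1_4[of 2 4] in \<open>simp_all add: Transposition.transpose_def cube_diagonal_def block_matrix_mult_vector
        power2_eq_square algebra_simps\<close>)
  show "permutes_diagonals i (block_matrix a 0 1 1 0) (Transposition.transpose 1 2 \<circ> Transposition.transpose 3 4)"
    by (rule permutes_diagonalsI[where ?l1.0 = 1 and ?l2.0 = 1 and ?l3.0 = "-1" and ?l4.0 = "-1"])
      (use permutes_compose[OF transpose_permutes_1_4[of 3 4] transpose_permutes_1_4[of 1 2]] in
        \<open>simp_all add: Transposition.transpose_def cube_diagonal_def block_matrix_mult_vector algebra_simps\<close>)
qed

lemma auts_sextic_block:
  assumes A: "A \<in> auts (YZ_form 6 (- 1 :: 'k::field_char_0))"
  obtains a p q r s where "A = block_matrix a p q r s" "a \<noteq> 0" "p * s - q * r \<noteq> 0"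
proof -
  have "5 \<le> (6::nat)" "- 1 \<noteq> (0::'k)" by simp_all
  from auts_YZ_form_block[OF this A] show thesis using that .
qed

text \<open>The property is closed under products, so it is enough to factor every automorphism
  given by the binary classification into matrices acting trivially on the diagonals and the three
  rotations.\<close>

lemma permutes_diagonals_auts:
  fixes i :: "'k::field_char_0"
  assumes i: "i * i = - 1" and A: "A \<in> auts (YZ_form 6 (- 1))"
  obtains \<sigma> where "permutes_diagonals i A \<sigma>"
proof -
  define good where "good A \<longleftrightarrow> (\<exists>\<sigma>. permutes_diagonals i A \<sigma>)" for A
  have mult: "good (A ** B)" if "good A" "good B" for A B
    using that permutes_diagonals_mult unfolding good_def by blast
  have scal: "good (block_matrix a p 0 0 p)" if "p \<noteq> 0" for a p
    using permutes_diagonals_scalar[OF that] unfolding good_def by blast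
  have D: "good (block_matrix 1 1 0 0 i)" and H: "good (block_matrix 1 1 1 1 (- 1))" and J: "good (block_matrix 1 0 1 1 0)"
    using permutes_diagonals_generators[OF i] unfolding good_def by blast+
  have diag: "good (block_matrix 1 1 0 0 t)" if "t ^ 4 = 1" for t
  proof -
    \<comment> \<open>The fourth roots of unity are 1, -1, \<open>i\<close> and \<open>- i\<close>,
      so every such \<open>t\<close> comes from a power of the quarter turn.\<close>
    have "(t * t - 1) * (t * t - i * i) = t ^ 4 - 1"
      by (simp add: i eval_nat_numeral algebra_simps)
    with that have "t * t = 1 \<or> t * t = i * i" by simp
    then have "t = 1 \<or> t = - 1 \<or> t = i \<or> t = - i"
      by (simp only: square_eq_1_iff square_eq_iff) blast
    moreover have "good (block_matrix 1 1 0 0 (- 1))"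
      using mult[OF D D] by (simp add: block_matrix_mult i)
    moreover from mult[OF this D] have "good (block_matrix 1 1 0 0 (- i))"
      by (simp add: block_matrix_mult)
    ultimately show ?thesis using scal[of 1 1] D by (elim disjE) simp_all
  qed
  obtain a p q r s where B: "A = block_matrix a p q r s" "a \<noteq> 0" "p * s - q * r \<noteq> 0"
    using auts_sextic_block[OF A] .
  have eq: "binary_YZ 6 (- 1) (p * y + q * z) (r * y + s * z) = a ^ 6 * binary_YZ 6 (- 1) y z" for y z
    using A block_matrix_in_auts_iff[of 6 a p q r s "- 1"] unfolding B(1) by simp
  have "a ^ 6 \<noteq> 0" using B(2) by simp
  from binary_YZ_automorphism[of 4 "- 1", OF _ _ this B(3)] eq
  consider "q = 0" "r = 0" "p ^ 4 = s ^ 4" | "p = 0" "s = 0" "q ^ 4 = r ^ 4"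
    | u where "p ^ 4 = r ^ 4" "u ^ 4 = 1" "q = u * p" "s = - u * r"
    by auto
  then have "good A"
  proof cases
    case 1
    then have ps: "p \<noteq> 0" "s \<noteq> 0" using B(3) by auto
    then have "(s / p) ^ 4 = 1" using 1 by (simp add: power_divide)
    moreover have "A = block_matrix a p 0 0 p ** block_matrix 1 1 0 0 (s / p)"
      using 1 ps by (simp add: B(1) block_matrix_mult)
    ultimately show ?thesis using mult[OF scal diag] ps by simp
  next
    case 2
    then have qr: "q \<noteq> 0" "r \<noteq> 0" using B(3) by auto
    then have "(r / q) ^ 4 = 1" using 2 by (simp add: power_divide)
    moreover have "A = block_matrix a q 0 0 q ** block_matrix 1 1 0 0 (r / q) ** block_matrix 1 0 1 1 0"
      using 2 qr by (simp add: B(1) block_matrix_mult)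
    ultimately show ?thesis using mult[OF mult[OF scal diag] J] qr by simp
  next
    case 3
    then have pr: "p \<noteq> 0" "r \<noteq> 0" using B(3) by auto
    then have "(r / p) ^ 4 = 1" using 3 by (simp add: power_divide)
    \<comment> \<open>The nonmonomial case is the half turn \<open>(Y + Z : Y - Z)\<close> between
      two diagonal matrices: the left one scales the rows, the right one the second column by
      \<open>u\<close>.\<close>
    moreover have "A = block_matrix a p 0 0 p ** block_matrix 1 1 0 0 (r / p)
        ** block_matrix 1 1 1 1 (- 1) ** block_matrix 1 1 0 0 u"
      using 3(3,4) pr by (simp add: B(1) block_matrix_mult mult.commute)
    ultimately show ?thesis using mult[OF mult[OF mult[OF scal diag] H] diag] pr 3(2) by simp
  qed
  with that show thesis unfolding good_def by blast
qed

text \<open>The four quadrics satisfy one linear relation with all coefficients nonzero, which makes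
  their four multipliers equal. Then \<open>Y^2 - Z^2\<close>, \<open>Y^2 + Z^2\<close> and
  \<open>Y Z\<close> share this multiplier, and the lower block must be scalar.\<close>

lemma permutes_diagonals_id:
  fixes i :: "'k::field_char_0"
  assumes i: "i * i = - 1" and id: "permutes_diagonals i (block_matrix a p q r s) id" and det: "p * s - q * r \<noteq> 0"
  shows "p = s \<and> q = 0 \<and> r = 0"
proof -
  have i0: "i \<noteq> 0" using i by auto
  define X Y Z where "X y z = y^2 - z^2" and "Y y z = i * (y^2 + z^2)" and "Z y z = 2 * y * z" for y z :: 'k
  let ?u = "\<lambda>y z. p * y + q * z" and ?v = "\<lambda>y z. r * y + s * z"
  have ex: "\<exists>l. \<forall>y z. cube_diagonal i j (block_matrix a p q r s *v (\<chi> k. if k = 2 then y else z))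
      = l * cube_diagonal i j (\<chi> k. if k = 2 then y else z)" if "j \<in> {1..4}" for j
    using id that unfolding permutes_diagonals_def id_apply by blast
  obtain l1 where l1: "\<And>y z. X (?u y z) (?v y z) + Y (?u y z) (?v y z) + Z (?u y z) (?v y z) = l1 * (X y z + Y y z + Z y z)"
    using ex[of 1] by (auto simp: cube_diagonal_def block_matrix_mult_vector X_def Y_def Z_def)
  obtain l2 where l2: "\<And>y z. - X (?u y z) (?v y z) + Y (?u y z) (?v y z) + Z (?u y z) (?v y z) = l2 * (- X y z + Y y z + Z y z)"
    using ex[of 2] by (auto simp: cube_diagonal_def block_matrix_mult_vector X_def Y_def Z_def)
  obtain l3 where l3: "\<And>y z. X (?u y z) (?v y z) - Y (?u y z) (?v y z) + Z (?u y z) (?v y z) = l3 * (X y z - Y y z + Z y z)"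
    using ex[of 3] by (auto simp: cube_diagonal_def block_matrix_mult_vector X_def Y_def Z_def)
  obtain l4 where l4: "\<And>y z. X (?u y z) (?v y z) + Y (?u y z) (?v y z) - Z (?u y z) (?v y z) = l4 * (X y z + Y y z - Z y z)"
    using ex[of 4] by (auto simp: cube_diagonal_def block_matrix_mult_vector X_def Y_def Z_def)
  \<comment> \<open>The first quadric is the sum of the other three, before and after the
    substitution.\<close>
  have rel: "l1 * (X y z + Y y z + Z y z) = l2 * (- X y z + Y y z + Z y z) + l3 * (X y z - Y y z + Z y z) + l4 * (X y z + Y y z - Z y z)" for y z
    unfolding l1[symmetric] l2[symmetric] l3[symmetric] l4[symmetric] by simp
  have vals: "X 1 0 = 1" "Y 1 0 = i" "Z 1 0 = 0" "X 0 1 = - 1" "Y 0 1 = i" "Z 0 1 = 0" "X 1 1 = 0" "Y 1 1 = 2 * i" "Z 1 1 = 2"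
    by (simp_all add: X_def Y_def Z_def)
  define c1 c2 c3 where "c1 = l1 + l2 - l3 - l4" and "c2 = l1 - l2 + l3 - l4" and "c3 = l1 - l2 - l3 + l4"
  have lin: "c1 * X y z + c2 * Y y z + c3 * Z y z = 0" for y z
    using rel[of y z] by (simp add: c1_def c2_def c3_def algebra_simps)
  have "c1 + c2 * i = 0" "- c1 + c2 * i = 0" using lin[of 1 0] lin[of 0 1] by (simp_all add: vals)
  then have "c1 + c2 * i + (- c1 + c2 * i) = 0" "c1 + c2 * i = 0" by simp_all
  then have "c2 = 0" "c1 = 0" using i0 by simp_all
  with lin[of 1 1] have "c3 = 0" by (simp add: vals)
  have "2 * (l1 - l4) = c1 + c2" "2 * (l1 - l3) = c1 + c3" "2 * (l1 - l2) = c2 + c3"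
    by (simp_all add: c1_def c2_def c3_def algebra_simps)
  then have l: "l4 = l1" "l3 = l1" "l2 = l1" using \<open>c1 = 0\<close> \<open>c2 = 0\<close> \<open>c3 = 0\<close> by simp_all
  have "2 * X (?u y z) (?v y z) = 2 * (l1 * X y z)" "2 * Y (?u y z) (?v y z) = 2 * (l1 * Y y z)"
      "2 * Z (?u y z) (?v y z) = 2 * (l1 * Z y z)" for y z
  proof -
    let ?X = "X (?u y z) (?v y z)" and ?Y = "Y (?u y z) (?v y z)" and ?Z = "Z (?u y z) (?v y z)"
    have "2 * ?X = (?X + ?Y + ?Z) - (- ?X + ?Y + ?Z)" "2 * ?Y = (?X + ?Y + ?Z) - (?X - ?Y + ?Z)"
        "2 * ?Z = (?X + ?Y + ?Z) - (?X + ?Y - ?Z)" by simp_all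
    then show "2 * ?X = 2 * (l1 * X y z)" "2 * ?Y = 2 * (l1 * Y y z)" "2 * ?Z = 2 * (l1 * Z y z)"
      unfolding l1 l2 l3 l4 l by (simp_all add: algebra_simps)
  qed
  then have XYZ: "X (?u y z) (?v y z) = l1 * X y z" "Y (?u y z) (?v y z) = l1 * Y y z" "Z (?u y z) (?v y z) = l1 * Z y z" for y z
    by simp_all
  have sum: "(?u y z)^2 + (?v y z)^2 = l1 * (y^2 + z^2)" for y z
  proof -
    have "i * ((?u y z)^2 + (?v y z)^2) = i * (l1 * (y^2 + z^2))"
      using XYZ(2)[of y z] by (simp only: Y_def mult_ac)
    then show ?thesis using i0 by simp
  qed
  have diff: "(?u y z)^2 - (?v y z)^2 = l1 * (y^2 - z^2)" for y z
    using XYZ(1)[of y z] by (simp only: X_def)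
  have 10: "p^2 + r^2 = l1" "p^2 - r^2 = l1" using sum[of 1 0] diff[of 1 0] by simp_all
  have 01: "q^2 + s^2 = l1" "q^2 - s^2 = - l1" using sum[of 0 1] diff[of 0 1] by simp_all
  have "2 * r^2 = (p^2 + r^2) - (p^2 - r^2)" "2 * q^2 = (q^2 + s^2) + (q^2 - s^2)" by simp_all
  then have "2 * r^2 = 0" "2 * q^2 = 0" unfolding 10 01 by simp_all
  then have qr: "q = 0" "r = 0" by simp_all
  with det have "p \<noteq> 0" by auto
  have "2 * (p * s) = 2 * l1" using XYZ(3)[of 1 1] by (simp add: Z_def qr)
  with 10 have "p * s = p * p" by (simp add: qr power2_eq_square)
  with \<open>p \<noteq> 0\<close> qr show ?thesis by simp
qed

text \<open>A four-cycle and a transposition of neighbours in it generate the symmetric group: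
  conjugates under powers of the cycle give the transpositions of neighbours, and conjugation by the
  given one yields the remaining two.\<close>

lemma permutations_of_diagonals_generated:
  assumes \<sigma>: "\<sigma> permutes {1..4::nat}"
    and comp: "\<And>\<sigma> \<tau>. P \<sigma> \<Longrightarrow> P \<tau> \<Longrightarrow> P (\<sigma> \<circ> \<tau>)"
    and gen: "P diagonal_cycle" "P (Transposition.transpose 2 4)" and id: "P id"
  shows "P \<sigma>"
proof -
  let ?c = diagonal_cycle and ?t = "Transposition.transpose :: nat \<Rightarrow> _"
  have eqI: "\<sigma> = \<tau>" if "\<sigma> 1 = \<tau> 1" "\<sigma> 2 = \<tau> 2" "\<sigma> 3 = \<tau> 3" "\<sigma> 4 = \<tau> 4"
    "\<And>j. j \<noteq> 1 \<Longrightarrow> j \<noteq> 2 \<Longrightarrow> j \<noteq> 3 \<Longrightarrow> j \<noteq> 4 \<Longrightarrow> \<sigma> j = \<tau> j" for \<sigma> \<tau> :: "nat \<Rightarrow> nat"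
    using that by (intro ext) metis
  note simps = diagonal_cycle_simps diagonal_cycle_simps(1)[simplified] Transposition.transpose_def
  have "?t 3 4 = ?c \<circ> ?t 2 4 \<circ> (?c \<circ> ?c \<circ> ?c)" by (rule eqI) (simp_all add: simps)
  then have 34: "P (?t 3 4)" using comp gen by metis
  have "?t 1 3 = (?c \<circ> ?c) \<circ> ?t 2 4 \<circ> (?c \<circ> ?c)" by (rule eqI) (simp_all add: simps)
  then have 13: "P (?t 1 3)" using comp gen by metis
  have "?t 1 2 = (?c \<circ> ?c \<circ> ?c) \<circ> ?t 2 4 \<circ> ?c" by (rule eqI) (simp_all add: simps)
  then have 12: "P (?t 1 2)" using comp gen by metis
  have "?t 2 3 = ?t 2 4 \<circ> ?t 3 4 \<circ> ?t 2 4" by (rule eqI) (simp_all add: simps)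
  then have 23: "P (?t 2 3)" using comp gen 34 by metis
  have "?t 1 4 = ?t 2 4 \<circ> ?t 1 2 \<circ> ?t 2 4" by (rule eqI) (simp_all add: simps)
  then have 14: "P (?t 1 4)" using comp gen 12 by metis
  have sym: "P (?t b a)" if "P (?t a b)" for a b using that by (simp only: transpose_commute)
  show ?thesis
    using \<sigma> finite_atLeastAtMost[of 1 "4::nat"]
  proof (induction \<sigma> rule: permutes_induct)
    case id
    show ?case by (rule \<open>P id\<close>)
  next
    case (swap a b \<tau>)
    from swap(1-3) have "P (?t a b)"
      unfolding set_1_4 using 12 13 14 23 34 gen(2) sym by (elim disjE) simp_all
    then show ?case using swap comp by blast
  qed
qed

lemma central_extension_octahedral:
  "central_extension (Aut_curve (YZ_form 6 (- 1) :: 'k::{alg_closed_field, field_char_0} ternary))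
    (sym_group 4) (integer_mod_group 6)"
proof -
  let ?F = "YZ_form 6 (- 1) :: 'k ternary"
  obtain i :: 'k where "i ^ 2 = - 1" using nth_root_exists[of 2 "- 1 :: 'k"] by auto
  then have i: "i * i = - 1" by (simp add: power2_eq_square)
  have i0: "i \<noteq> 0" using i by auto
  obtain z :: 'k where z: "primitive_root 6 z" using primitive_root_exists[of 6] by auto
  \<comment> \<open>Well defined because an invertible matrix induces at most one permutation of the
    diagonals.\<close>
  define \<Phi> where "\<Phi> A = (THE \<sigma>. permutes_diagonals i A \<sigma>)" for A :: "'k^3^3"
  define \<psi> where "\<psi> k = block_matrix (z powi k) 1 0 0 (1::'k)" for k
  have \<Phi>_eq: "\<Phi> A = \<sigma>" if "A \<in> auts ?F" "permutes_diagonals i A \<sigma>" for A \<sigma>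
    unfolding \<Phi>_def using permutes_diagonals_unique[OF i auts_invertible[OF that(1)]] that(2)
    by (intro the_equality)
  have \<Phi>: "permutes_diagonals i A (\<Phi> A)" if "A \<in> auts ?F" for A
    using permutes_diagonals_auts[OF i that] \<Phi>_eq[OF that] by metis
  have homog: "homogeneous 6 ?F" by (rule homogeneous_YZ_form) simp
  have scale: "permutes_diagonals i (mat c ** A) \<sigma>" if "c \<noteq> 0" "permutes_diagonals i A \<sigma>" for c A \<sigma>
    using permutes_diagonals_mult[OF permutes_diagonals_scalar[OF that(1)] that(2)]
    by (simp add: mat_block_matrix)
  show ?thesis
  proof (rule central_extension_Aut_curve[where \<Phi> = \<Phi> and \<psi> = \<psi>])
    show "homogeneous 6 ?F" by (rule homog)
    show "group (sym_group 4)" by (rule sym_group_is_group)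
    show "group (integer_mod_group 6)" by simp
  next
    fix A assume "A \<in> auts ?F"
    from \<Phi>[OF this] show "\<Phi> A \<in> carrier (sym_group 4)"
      by (simp add: permutes_diagonals_def sym_group_carrier)
  next
    fix A and c :: 'k assume A: "A \<in> auts ?F" and c: "c \<noteq> 0"
    show "\<Phi> (mat c ** A) = \<Phi> A"
      by (rule \<Phi>_eq[OF auts_mult[OF mat_in_auts[OF homog c] A] scale[OF c \<Phi>[OF A]]])
  next
    fix A B assume A: "A \<in> auts ?F" and B: "B \<in> auts ?F"
    show "\<Phi> (A ** B) = \<Phi> A \<otimes>\<^bsub>sym_group 4\<^esub> \<Phi> B"
      unfolding sym_group_mult
      by (rule \<Phi>_eq[OF auts_mult[OF A B] permutes_diagonals_mult[OF \<Phi>[OF A] \<Phi>[OF B]]])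
  next
    fix \<sigma> assume "\<sigma> \<in> carrier (sym_group 4)"
    then have \<sigma>: "\<sigma> permutes {1..4}" by (simp add: sym_group_carrier)
    have "\<exists>A\<in>auts ?F. permutes_diagonals i A \<sigma>"
    proof (rule permutations_of_diagonals_generated[OF \<sigma>])
      fix \<sigma> \<tau> assume "\<exists>A\<in>auts ?F. permutes_diagonals i A \<sigma>" "\<exists>A\<in>auts ?F. permutes_diagonals i A \<tau>"
      then show "\<exists>A\<in>auts ?F. permutes_diagonals i A (\<sigma> \<circ> \<tau>)"
        using auts_mult permutes_diagonals_mult by blast
    next
      \<comment> \<open>Because \<open>i^5 = i\<close>, replacing \<open>Z\<close> by
        \<open>i Z\<close> multiplies both monomials of the binary sextic by
        \<open>i\<close>.\<close>
      obtain a where a: "a ^ 6 = i" using nth_root_exists[of 6 i] by auto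
      then have a0: "a \<noteq> 0" using i0 by auto
      have i5: "i ^ 5 = i" using i by (simp add: eval_nat_numeral)
      have "block_matrix a 1 0 0 i \<in> auts ?F"
        using a0 i0 by (subst block_matrix_in_auts_iff)
          (auto simp: binary_YZ_def power_mult_distrib a i5 algebra_simps)
      then show "\<exists>A\<in>auts ?F. permutes_diagonals i A diagonal_cycle"
        using permutes_diagonals_generators(1)[OF i] by blast
    next
      \<comment> \<open>The value 8 is the multiplier of the substitution
        \<open>(Y + Z, Y - Z)\<close>, from
        \<open>(Y^2 - Z^2) ((Y + Z)^4 - (Y - Z)^4) = 8 Y Z (Y^4 - Z^4)\<close>.\<close>
      obtain a where a: "a ^ 6 = (8 :: 'k)" using nth_root_exists[of 6 "8 :: 'k"] by auto
      then have a0: "a \<noteq> 0" by auto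
      have "binary_YZ 6 (- 1) (1 * x + 1 * y) (1 * x + (- 1) * y) = (8 :: 'k) * binary_YZ 6 (- 1) x y" for x y
      proof -
        have "6 - 1 = (5::nat)" by simp
        then show ?thesis unfolding binary_YZ_def by (simp add: eval_nat_numeral) (simp add: algebra_simps)
      qed
      then have "block_matrix a 1 1 1 (- 1) \<in> auts ?F"
        using a0 by (subst block_matrix_in_auts_iff) (simp_all add: a)
      then show "\<exists>A\<in>auts ?F. permutes_diagonals i A (Transposition.transpose 2 4)"
        using permutes_diagonals_generators(2)[OF i] by blast
    next
      show "\<exists>A\<in>auts ?F. permutes_diagonals i A id"
        using permutes_diagonals_scalar[of 1 i 1] mat_in_auts[OF homog, of 1]
        by (metis mat_block_matrix zero_neq_one)
    qed
    then show "\<exists>A\<in>auts ?F. \<Phi> A = \<sigma>" using \<Phi>_eq by blast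
  next
    fix k show "\<psi> k \<in> auts ?F"
      unfolding \<psi>_def by (rule homology_in_auts) (simp_all add: powi_pow_n[OF z])
  next
    fix k l :: int
    have "z powi ((k + l) mod int 6) = z powi (k + l)" by (subst powi_eq_powi_iff[OF z]) simp_all
    then show "\<psi> (k \<otimes>\<^bsub>integer_mod_group 6\<^esub> l) = \<psi> k ** \<psi> l"
      using primitive_root_nz[OF z] by (simp add: \<psi>_def block_matrix_mult power_int_add)
  next
    fix k l :: int and c :: 'k
    assume kl: "k \<in> carrier (integer_mod_group 6)" "l \<in> carrier (integer_mod_group 6)" and "\<psi> k = mat c ** \<psi> l"
    then have "z powi k = z powi l" by (simp add: \<psi>_def scale_block_matrix block_matrix_inject)
    then have "k mod int 6 = l mod int 6" by (subst (asm) powi_eq_powi_iff[OF z]) simp_all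
    with kl show "k = l" by (simp add: carrier_integer_mod_group)
  next
    fix k :: int and A assume "A \<in> auts ?F"
    then obtain a p q r s where "A = block_matrix a p q r s" "a \<noteq> 0" "p * s - q * r \<noteq> 0"
      using auts_sextic_block by blast
    then show "\<psi> k ** A = A ** \<psi> k" by (simp add: \<psi>_def block_matrix_mult mult.commute)
  next
    fix A assume A: "A \<in> auts ?F"
    show "\<Phi> A = \<one>\<^bsub>sym_group 4\<^esub> \<longleftrightarrow> (\<exists>k\<in>carrier (integer_mod_group 6). \<exists>c. c \<noteq> 0 \<and> A = mat c ** \<psi> k)"
    proof
      assume "\<Phi> A = \<one>\<^bsub>sym_group 4\<^esub>"
      with \<Phi>[OF A] have id: "permutes_diagonals i A id" by (simp add: sym_group_one)
      obtain a p q r s where B: "A = block_matrix a p q r s" "a \<noteq> 0" "p * s - q * r \<noteq> 0"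
        using auts_sextic_block[OF A] .
      have "p = s \<and> q = 0 \<and> r = 0"
        using permutes_diagonals_id[OF i id[unfolded B(1)] B(3)] .
      then have ps: "p = s" "q = 0" "r = 0" "p \<noteq> 0" using B(3) by auto
      have "binary_YZ 6 (- 1) (p * y + q * z) (r * y + s * z) = a ^ 6 * binary_YZ 6 (- 1) y z" for y z
        using A block_matrix_in_auts_iff[of 6 a p q r s "- 1"] unfolding B(1) by simp
      \<comment> \<open>The form vanishes at \<open>(1, 1)\<close>; at \<open>(1, 2)\<close> its
        value is -30 and can be cancelled.\<close>
      from this[of 1 2] have "binary_YZ 6 (- 1) p (p * 2) = a ^ 6 * binary_YZ 6 (- 1) 1 2"
        by (simp add: ps(1)[symmetric] ps(2,3))
      moreover have "binary_YZ 6 (- 1) p (p * 2) = p ^ 6 * binary_YZ 6 (- 1) 1 2"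
        by (simp add: binary_YZ_def power_mult_distrib eval_nat_numeral algebra_simps)
      moreover have "binary_YZ 6 (- 1) 1 2 \<noteq> (0 :: 'k)" by (simp add: binary_YZ_def)
      ultimately have "a ^ 6 = p ^ 6" by simp
      then obtain k where "k \<in> {0..<int 6}" "A = mat p ** \<psi> k"
        using homology_kernel[OF z _ ps(4), of a] unfolding \<psi>_def B(1) ps by auto
      with ps(4) show "\<exists>k\<in>carrier (integer_mod_group 6). \<exists>c. c \<noteq> 0 \<and> A = mat c ** \<psi> k"
        by (auto simp: carrier_integer_mod_group)
    next
      assume "\<exists>k\<in>carrier (integer_mod_group 6). \<exists>c. c \<noteq> 0 \<and> A = mat c ** \<psi> k"
      then obtain k c where "c \<noteq> 0" "A = mat c ** \<psi> k" by blast
      then show "\<Phi> A = \<one>\<^bsub>sym_group 4\<^esub>"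
        unfolding sym_group_one using permutes_diagonals_scalar[of 1 i "z powi k"]
        by (intro \<Phi>_eq[OF A]) (simp add: \<psi>_def scale)
    qed
  qed
qed


section \<open>The quartic: automorphisms of the Fermat curve\<close>

definition fermat_quartic :: "'k::field ternary" where
  "fermat_quartic = (\<Sum>i\<in>UNIV. Var i ^ 4)"

lemma eval_at_fermat_quartic: "eval_at fermat_quartic v = (\<Sum>i\<in>UNIV. (v $ i) ^ 4)"
  by (simp add: fermat_quartic_def)

lemma coeff_on_line_fermat_quartic:
  fixes v w :: "'k::field_char_0^3"
  shows "Polynomial.coeff (on_line fermat_quartic v w) 1 = 4 * (\<Sum>i\<in>UNIV. (v $ i) ^ 3 * w $ i)"
proof -
  have "on_line fermat_quartic v w = (\<Sum>i\<in>UNIV. [:v $ i, w $ i:] ^ 4)"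
    unfolding poly_eq_poly_eq_iff[symmetric]
    by (rule ext) (simp add: poly_on_line eval_at_fermat_quartic poly_sum)
  then show ?thesis
    by (simp only: coeff_sum coeff_1_linear_power) (simp add: sum_distrib_left mult.assoc)
qed

text \<open>The entry of column \<open>i\<close> sits in row \<open>s i\<close>, and
  \<open>\<delta>\<close> is indexed by the row: coordinates are permuted before they are
  scaled.\<close>

definition monomial_matrix :: "(3 \<Rightarrow> 3) \<Rightarrow> (3 \<Rightarrow> 'a) \<Rightarrow> 'a::zero^3^3" where
  "monomial_matrix s \<delta> = (\<chi> j i. if j = s i then \<delta> j else 0)"

lemma monomial_matrix_mult_vector:
  fixes \<delta> :: "3 \<Rightarrow> 'a::comm_ring_1"
  assumes "bij s"
  shows "(monomial_matrix s \<delta> *v v) $ j = \<delta> j * v $ (inv_into UNIV s j)"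
proof -
  have "(j = s i) = (i = inv_into UNIV s j)" for i
    using assms by (metis bij_inv_eq_iff)
  moreover have "s (inv_into UNIV s j) = j" using assms by (simp add: bij_is_surj surj_f_inv_f)
  ultimately show ?thesis
    by (simp add: monomial_matrix_def matrix_vector_mult_def if_distrib[of "\<lambda>x. x * _"] cong: if_cong)
qed

lemma monomial_matrix_mult:
  fixes \<delta> :: "3 \<Rightarrow> 'a::comm_ring_1"
  assumes s: "bij s" "bij s'"
  shows "monomial_matrix s \<delta> ** monomial_matrix s' \<delta>' = monomial_matrix (s \<circ> s') (\<lambda>j. \<delta> j * \<delta>' (inv_into UNIV s j))"
proof (rule matrix_eq_if_mult_vector_eq)
  fix v :: "'a^3"
  show "(monomial_matrix s \<delta> ** monomial_matrix s' \<delta>') *v v = monomial_matrix (s \<circ> s') (\<lambda>j. \<delta> j * \<delta>' (inv_into UNIV s j)) *v v"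
    using s by (simp add: vec_eq_iff monomial_matrix_mult_vector bij_comp o_inv_distrib mult.assoc flip: matrix_vector_mul_assoc)
qed

lemma scale_monomial_matrix: "mat c ** monomial_matrix s \<delta> = monomial_matrix s (\<lambda>j. c * \<delta> j)"
  for c :: "'a::comm_ring_1"
  by (simp add: mat_mult_left monomial_matrix_def vec_eq_iff)

lemma monomial_matrix_inject:
  assumes "monomial_matrix s \<delta> = monomial_matrix s' \<delta>'" "\<And>j. \<delta> j \<noteq> 0" "bij s"
  shows "s = s'" "\<delta> = \<delta>'"
proof -
  have entry: "(if j = s i then \<delta> j else 0) = (if j = s' i then \<delta>' j else 0)" for i j
    using assms(1) by (simp add: monomial_matrix_def vec_eq_iff)
  show s: "s = s'"
  proof
    fix i show "s i = s' i" using entry[of "s i" i] assms(2)[of "s i"] by (simp split: if_splits)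
  qed
  show "\<delta> = \<delta>'"
  proof
    fix j
    obtain i where "j = s i" using assms(3) by (metis bij_pointE)
    with entry[of j i] s show "\<delta> j = \<delta>' j" by simp
  qed
qed

lemma monomial_matrix_in_auts:
  fixes \<delta> :: "3 \<Rightarrow> 'k::field_char_0"
  assumes s: "bij s" and \<delta>: "\<And>j. \<delta> j ^ 4 = c" and c: "c \<noteq> 0"
  shows "monomial_matrix s \<delta> \<in> auts fermat_quartic"
proof -
  have \<delta>0: "\<delta> j \<noteq> 0" for j using \<delta>[of j] c by auto
  have "invertible (monomial_matrix s \<delta>)"
  proof (rule invertible_if_ker_trivial)
    fix v assume "monomial_matrix s \<delta> *v v = 0"
    then have "\<delta> j * v $ (inv_into UNIV s j) = 0" for j
      using monomial_matrix_mult_vector[OF s, of \<delta> v j] by simp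
    from this[of "s _"] have "v $ i = 0" for i using s \<delta>0 by (simp add: bij_is_inj)
    then show "v = 0" by (simp add: vec_eq_iff)
  qed
  moreover have "eval_at fermat_quartic (monomial_matrix s \<delta> *v v) = c * eval_at fermat_quartic v" for v
  proof -
    have "eval_at fermat_quartic (monomial_matrix s \<delta> *v v) = c * (\<Sum>j\<in>UNIV. (v $ (inv_into UNIV s j)) ^ 4)"
      by (simp add: eval_at_fermat_quartic monomial_matrix_mult_vector[OF s] power_mult_distrib \<delta> sum_distrib_left)
    also have "(\<Sum>j\<in>UNIV. (v $ (inv_into UNIV s j)) ^ 4) = (\<Sum>i\<in>UNIV. (v $ i) ^ 4)"
      by (rule sum.reindex_bij_betw[OF bij_imp_bij_inv[OF s]])
    finally show ?thesis by (simp add: eval_at_fermat_quartic)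
  qed
  ultimately show ?thesis
    unfolding auts_def carries_iff using c by blast
qed

text \<open>The only directional derivatives of the Fermat quartic that are cubes of linear forms are those
  along the coordinate axes, so automorphisms permute the axes.\<close>

lemma auts_fermat_quartic:
  fixes A :: "'k::field_char_0^3^3"
  assumes A: "A \<in> auts fermat_quartic"
  obtains s \<delta> c where "bij s" "A = monomial_matrix s \<delta>" "c \<noteq> 0" "\<And>j. \<delta> j ^ 4 = c"
proof -
  let ?F = "fermat_quartic :: 'k ternary"
  obtain c where c: "invertible A" "c \<noteq> 0" "\<And>v. eval_at ?F (A *v v) = c * eval_at ?F v"
    using A unfolding auts_def carries_iff by blast
  obtain B where B: "B ** A = mat 1" "A ** B = mat 1" using c(1) unfolding invertible_def by blast
  have col: "(A *v axis i 1) $ j = A $ j $ i" for i j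
    by (simp add: matrix_vector_mult_def axis_def if_distrib[of "\<lambda>x. _ * x"] cong: if_cong)
  \<comment> \<open>The polar along column \<open>i\<close> of \<open>A\<close> is, up to the factor
    \<open>c\<close>, the cube of the linear form given by row \<open>i\<close> of the inverse
    matrix \<open>B\<close>.\<close>
  have cube: "(\<Sum>j\<in>UNIV. (u $ j) ^ 3 * A $ j $ i) = c * ((B *v u) $ i) ^ 3" for u i
  proof -
    have "on_line ?F (A *v (B *v u)) (A *v axis i 1) = Polynomial.smult c (on_line ?F (B *v u) (axis i 1))"
      using c(3) by (rule on_line_substitution)
    then have "on_line ?F u (A *v axis i 1) = Polynomial.smult c (on_line ?F (B *v u) (axis i 1))"
      by (simp add: matrix_vector_mul_assoc B)
    from arg_cong[OF this, of "\<lambda>p. Polynomial.coeff p 1"]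
    have "4 * (\<Sum>j\<in>UNIV. (u $ j) ^ 3 * A $ j $ i) = c * (4 * (\<Sum>j\<in>UNIV. ((B *v u) $ j) ^ 3 * axis i 1 $ j))"
      by (simp only: coeff_smult coeff_on_line_fermat_quartic col)
    moreover have "(\<Sum>j\<in>UNIV. ((B *v u) $ j) ^ 3 * axis i 1 $ j) = ((B *v u) $ i) ^ 3"
      by (simp add: axis_def if_distrib[of "\<lambda>x. _ * x"] cong: if_cong)
    ultimately show ?thesis by simp
  qed
  \<comment> \<open>Restriction to the line joining two coordinate points, so that only two columns
    of \<open>B\<close> take part.\<close>
  have pair: "A $ k $ i + t ^ 3 * A $ j $ i = c * (B $ i $ k + t * B $ i $ j) ^ 3" if "j \<noteq> k" for i j k t
  proof -
    let ?u = "(\<chi> l. if l = k then 1 else if l = j then t else 0) :: 'k^3"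
    have two: "(\<Sum>l\<in>UNIV. g l) = g k + g j" if "\<And>l. l \<noteq> k \<Longrightarrow> l \<noteq> j \<Longrightarrow> g l = 0" for g :: "3 \<Rightarrow> 'k"
    proof -
      have "sum g UNIV = sum g {k, j}" by (rule sum.mono_neutral_right) (use that in auto)
      then show ?thesis using \<open>j \<noteq> k\<close> by simp
    qed
    have "(\<Sum>l\<in>UNIV. (?u $ l) ^ 3 * A $ l $ i) = A $ k $ i + t ^ 3 * A $ j $ i"
      using that by (subst two) auto
    moreover have "(B *v ?u) $ i = B $ i $ k + t * B $ i $ j"
      unfolding matrix_vector_mult_def using that by (simp add: two mult.commute)
    ultimately show ?thesis using cube[of ?u i] by simp
  qed
  have BA: "A $ k $ i = c * (B $ i $ k) ^ 3" for i k
  proof -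
    obtain j :: 3 where "j \<noteq> k" by (metis zero_neq_one)
    from pair[OF this, of i 0] show ?thesis by simp
  qed
  have sparse: "A $ j $ i = 0 \<or> A $ k $ i = 0" if "j \<noteq> k" for i j k
  proof -
    let ?x = "B $ i $ k" and ?y = "B $ i $ j"
    have "c * ?x ^ 3 + c * ?y ^ 3 = c * (?x + ?y) ^ 3" "c * ?x ^ 3 - c * ?y ^ 3 = c * (?x - ?y) ^ 3"
      using pair[OF that, of i 1] pair[OF that, of i "- 1"] by (simp_all add: BA)
    \<comment> \<open>Adding the cases \<open>t = 1\<close> and \<open>t = -1\<close> isolates the
      mixed term \<open>6 c x y^2\<close> of the cube, which has no counterpart on the left.\<close>
    then have "(c * ?x ^ 3 + c * ?y ^ 3) + (c * ?x ^ 3 - c * ?y ^ 3) = c * (?x + ?y) ^ 3 + c * (?x - ?y) ^ 3"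
      by (simp only:)
    then have "6 * (c * (?x * (?y * ?y))) = 0"
      by (simp add: power3_eq_cube algebra_simps)
    then have "?x = 0 \<or> ?y = 0" using c(2) by simp
    then show ?thesis by (auto simp: BA)
  qed
  have "\<exists>j. A $ j $ i \<noteq> 0" for i
  proof -
    have "A *v axis i 1 \<noteq> 0" by (rule invertible_mult_vector_nz[OF c(1)]) (simp add: axis_eq_0_iff)
    then show ?thesis by (auto simp: vec_eq_iff col)
  qed
  then obtain s where s: "\<And>i. A $ (s i) $ i \<noteq> 0" by metis
  then have off: "A $ j $ i = 0" if "j \<noteq> s i" for i j using sparse[OF that] by blast
  \<comment> \<open>An index outside the image of \<open>s\<close> would give \<open>A\<close> a
    zero row.\<close>
  have "\<exists>i. j = s i" for j
  proof (rule ccontr)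
    assume "\<nexists>i. j = s i"
    then have "(A ** B) $ j $ j = 0" by (simp add: matrix_matrix_mult_def off)
    then show False by (simp add: B mat_def)
  qed
  then have "surj s" by blast
  then have bij: "bij s" by (simp add: bij_def finite_UNIV_surj_inj)
  define \<delta> where "\<delta> j = A $ j $ (inv_into UNIV s j)" for j
  have \<delta>: "\<delta> (s i) = A $ (s i) $ i" for i using bij by (simp add: \<delta>_def bij_is_inj)
  have A_eq: "A = monomial_matrix s \<delta>"
    by (auto simp: monomial_matrix_def vec_eq_iff off \<delta>)
  have "\<delta> (s i) ^ 4 = c" for i
  proof -
    have "(\<Sum>j\<in>UNIV. (A $ j $ i) ^ 4) = c * (\<Sum>j\<in>UNIV. (axis i 1 $ j) ^ 4)"
      using c(3)[of "axis i 1"] by (simp add: eval_at_fermat_quartic col)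
    moreover have "(\<Sum>j\<in>UNIV. (axis i (1::'k) $ j) ^ 4) = 1"
      by (simp add: axis_def if_distrib[of "\<lambda>x. x ^ 4"] cong: if_cong)
    moreover have "(\<Sum>j\<in>UNIV. (A $ j $ i) ^ 4) = (A $ (s i) $ i) ^ 4"
      by (subst sum.remove[of _ "s i"]) (auto intro!: sum.neutral simp: off)
    ultimately show ?thesis by (simp add: \<delta>)
  qed
  then have "\<delta> j ^ 4 = c" for j using bij by (metis bij_pointE)
  with bij A_eq c(2) that show thesis by blast
qed

section \<open>Identifying the coordinates of type \<open>3\<close> with the points 1, 2, 3 moved by
  \<open>sym_group 3\<close>\<close>

definition coord_index :: "3 \<Rightarrow> nat" where
  "coord_index i = (if i = 1 then 1 else if i = 2 then 2 else 3)"

definition index_coord :: "nat \<Rightarrow> 3" where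
  "index_coord n = (if n = 1 then 1 else if n = 2 then 2 else 3)"

lemma coord_index_simps [simp]:
  "coord_index 1 = 1" "coord_index 2 = 2" "coord_index 3 = 3" "index_coord (coord_index i) = i"
  "coord_index i \<in> {1..3}"
  using exhaust_3[of i] by (auto simp: coord_index_def index_coord_def)

lemma coord_index_index_coord: "n \<in> {1..3} \<Longrightarrow> coord_index (index_coord n) = n"
  by (auto simp: coord_index_def index_coord_def)

definition coord_perm :: "(nat \<Rightarrow> nat) \<Rightarrow> 3 \<Rightarrow> 3" where
  "coord_perm \<sigma> = index_coord \<circ> \<sigma> \<circ> coord_index"

lemma coord_index_coord_perm:
  assumes "\<sigma> permutes {1..3}"
  shows "coord_index (coord_perm \<sigma> i) = \<sigma> (coord_index i)"
proof -
  have "\<sigma> (coord_index i) \<in> {1..3}" using permutes_in_image[OF assms] coord_index_simps(5) by blast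
  then show ?thesis by (simp only: coord_perm_def o_apply coord_index_index_coord)
qed

lemma coord_index_inject: "coord_index i = coord_index j \<longleftrightarrow> i = j"
  by (metis coord_index_simps(4))

lemma coord_perm_compose:
  assumes "\<sigma> permutes {1..3}" "\<tau> permutes {1..3}"
  shows "coord_perm (\<sigma> \<circ> \<tau>) = coord_perm \<sigma> \<circ> coord_perm \<tau>"
  by (rule ext) (simp add: coord_perm_def[of "\<sigma> \<circ> \<tau>"] coord_perm_def[of \<sigma>] coord_index_coord_perm[OF assms(2)])

lemma coord_perm_inv:
  assumes "\<sigma> permutes {1..3}"
  shows "coord_perm (inv_into UNIV \<sigma>) (coord_perm \<sigma> i) = i" "coord_perm \<sigma> (coord_perm (inv_into UNIV \<sigma>) i) = i"
  using assms permutes_inv[OF assms]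
  by (simp_all add: coord_index_coord_perm permutes_inverses flip: coord_index_inject)

lemma bij_coord_perm:
  assumes "\<sigma> permutes {1..3}"
  shows "bij (coord_perm \<sigma>)" "inv_into UNIV (coord_perm \<sigma>) = coord_perm (inv_into UNIV \<sigma>)"
proof -
  show "bij (coord_perm \<sigma>)"
    using coord_perm_inv[OF assms] by (metis bijI')
  show "inv_into UNIV (coord_perm \<sigma>) = coord_perm (inv_into UNIV \<sigma>)"
    using coord_perm_inv[OF assms] by (intro inv_unique_comp ext) auto
qed

text \<open>The logarithms of the entries of \<open>diag(\<zeta>^a, \<zeta>^b, 1)\<close>, the third
  one normalized to 0 by passing to scalar classes.\<close>

definition exponent :: "int \<Rightarrow> int \<Rightarrow> nat \<Rightarrow> int" where
  "exponent a b = (\<lambda>i. if i = 1 then a else if i = 2 then b else 0)"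

lemma coordinate_action_exponent:
  "coordinate_action n \<sigma> (a, b) = (let u = (\<lambda>i. exponent a b (inv_into UNIV \<sigma> i)) in ((u 1 - u 3) mod int n, (u 2 - u 3) mod int n))"
  unfolding coordinate_action_def exponent_def Let_def split_conv ..

lemma mult_Zn2: "((a, b), \<sigma>) \<otimes>\<^bsub>Zn2_semidirect_S3 n\<^esub> ((a', b'), \<tau>) =
   (let (c, d) = coordinate_action n \<sigma> (a', b') in ((a + c) mod int n, (b + d) mod int n), \<sigma> \<circ> \<tau>)"
  unfolding Zn2_semidirect_S3_def semidirect_product_def sym_group_def
  by (simp add: DirProd_def split_beta)
text \<open>Closure of the source suffices to invert an isomorphism, so the group axioms of the
  semidirect product can be left to the isomorphism itself.\<close>

lemma iso_sym_if_closed: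
  assumes f: "f \<in> iso G H" and closed: "\<And>x y. x \<in> carrier G \<Longrightarrow> y \<in> carrier G \<Longrightarrow> x \<otimes>\<^bsub>G\<^esub> y \<in> carrier G"
  shows "H \<cong> G"
proof -
  let ?g = "inv_into (carrier G) f"
  have hom: "f \<in> hom G H" and bij: "bij_betw f (carrier G) (carrier H)" using f by (auto simp: iso_def)
  have bij': "bij_betw ?g (carrier H) (carrier G)" using bij by (rule bij_betw_inv_into)
  have g: "?g x \<in> carrier G" "f (?g x) = x" if "x \<in> carrier H" for x
    using that bij bij' by (auto simp: bij_betw_def f_inv_into_f)
  have "?g \<in> hom H G"
  proof (rule homI)
    fix x y assume xy: "x \<in> carrier H" "y \<in> carrier H"
    have "f (?g x \<otimes>\<^bsub>G\<^esub> ?g y) = x \<otimes>\<^bsub>H\<^esub> y" using xy g hom by (simp add: hom_mult)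
    then show "?g (x \<otimes>\<^bsub>H\<^esub> y) = ?g x \<otimes>\<^bsub>G\<^esub> ?g y"
      using closed[OF g(1)[OF xy(1)] g(1)[OF xy(2)]] bij by (metis bij_betw_inv_into_left)
  qed (rule g)
  with bij' show ?thesis unfolding is_iso_def iso_def by blast
qed

lemma Aut_curve_fermat_quartic:
  "Aut_curve (fermat_quartic :: 'k::{alg_closed_field, field_char_0} ternary) \<cong> Zn2_semidirect_S3 4"
proof -
  let ?F = "fermat_quartic :: 'k ternary" and ?S = "Zn2_semidirect_S3 4"
  obtain w :: 'k where w: "primitive_root 4 w" using primitive_root_exists[of 4] by auto
  have w0: "w \<noteq> 0" using primitive_root_nz[OF w] by simp
  have powi_eq: "w powi k = w powi l \<longleftrightarrow> k mod 4 = l mod 4" for k l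
    using powi_eq_powi_iff[OF w, of k l] by simp
  \<comment> \<open>Matrix model of the semidirect product: a permutation of the coordinates
    followed by a diagonal matrix of fourth roots of unity with last entry 1.\<close>
  define M where "M x \<sigma> = monomial_matrix (coord_perm \<sigma>) (\<lambda>j. w powi exponent (fst x) (snd x) (coord_index j))"
    for x :: "int \<times> int" and \<sigma>
  define f where "f = (\<lambda>(x, \<sigma>). proj_class (M x \<sigma>))"
  have carrier: "carrier ?S = ({0..<4} \<times> {0..<4}) \<times> {\<sigma>. \<sigma> permutes {1..3}}"
    by (auto simp: Zn2_semidirect_S3_def semidirect_product_def carrier_integer_mod_group sym_group_def)
  have M_auts: "M x \<sigma> \<in> auts ?F" if "\<sigma> permutes {1..3}" for x \<sigma>
    unfolding M_def
    by (rule monomial_matrix_in_auts[OF bij_coord_perm(1)[OF that], of _ 1]) (simp_all add: powi_pow_n[OF w])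
  have M_mult: "proj_class (M x \<sigma> ** M y \<tau>) = f ((x, \<sigma>) \<otimes>\<^bsub>?S\<^esub> (y, \<tau>))"
    if \<sigma>: "\<sigma> permutes {1..3}" and \<tau>: "\<tau> permutes {1..3}" for x y \<sigma> \<tau>
  proof -
    obtain a b a' b' where xy: "x = (a, b)" "y = (a', b')" by (metis surj_pair)
    define u where "u n = exponent a' b' (inv_into UNIV \<sigma> n)" for n
    define a'' b'' where "a'' = (a + (u 1 - u 3) mod 4) mod 4" and "b'' = (b + (u 2 - u 3) mod 4) mod 4"
    have prod: "(x, \<sigma>) \<otimes>\<^bsub>?S\<^esub> (y, \<tau>) = ((a'', b''), \<sigma> \<circ> \<tau>)"
      by (simp only: xy mult_Zn2 coordinate_action_exponent Let_def split_conv a''_def b''_def u_def of_nat_numeral)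
    have "M x \<sigma> ** M y \<tau> = monomial_matrix (coord_perm (\<sigma> \<circ> \<tau>))
        (\<lambda>j. w powi exponent a b (coord_index j) * w powi u (coord_index j))"
      unfolding M_def xy monomial_matrix_mult[OF bij_coord_perm(1)[OF \<sigma>] bij_coord_perm(1)[OF \<tau>]]
      by (simp add: coord_perm_compose[OF \<sigma> \<tau>] bij_coord_perm(2)[OF \<sigma>] u_def
          coord_index_coord_perm[OF permutes_inv[OF \<sigma>]])
    \<comment> \<open>After permuting, the third exponent is \<open>u 3\<close> instead of 0. The
      scalar \<open>w powi u 3\<close> is pulled out to normalize it again, which is why differences
      with \<open>u 3\<close> occur in the action.\<close>
    also have "(\<lambda>j. w powi exponent a b (coord_index j) * w powi u (coord_index j))
        = (\<lambda>j. w powi u 3 * w powi exponent a'' b'' (coord_index j))"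
    proof
      fix j :: 3
      have "w powi (exponent a b (coord_index j) + u (coord_index j)) = w powi (u 3 + exponent a'' b'' (coord_index j))"
        unfolding powi_eq
        using exhaust_3[of j] by (elim disjE) (simp_all add: exponent_def a''_def b''_def mod_simps)
      then show "w powi exponent a b (coord_index j) * w powi u (coord_index j)
          = w powi u 3 * w powi exponent a'' b'' (coord_index j)"
        using w0 by (simp add: power_int_add)
    qed
    also have "monomial_matrix (coord_perm (\<sigma> \<circ> \<tau>)) \<dots> = mat (w powi u 3) ** M (a'', b'') (\<sigma> \<circ> \<tau>)"
      by (simp add: M_def scale_monomial_matrix)
    finally show ?thesis
      using w0 by (simp add: prod f_def proj_class_scale)
  qed
  have hom: "f \<in> hom ?S (Aut_curve ?F)"
  proof (rule homI)
    fix x assume "x \<in> carrier ?S"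
    then show "f x \<in> carrier (Aut_curve ?F)"
      by (auto simp: carrier f_def carrier_Aut_curve M_auts)
  next
    fix x y assume "x \<in> carrier ?S" "y \<in> carrier ?S"
    then obtain a \<sigma> b \<tau> where xy: "x = (a, \<sigma>)" "y = (b, \<tau>)" "\<sigma> permutes {1..3}" "\<tau> permutes {1..3}"
      unfolding carrier by blast
    show "f (x \<otimes>\<^bsub>?S\<^esub> y) = f x \<otimes>\<^bsub>Aut_curve ?F\<^esub> f y"
      using M_mult[OF xy(3,4), of a b] mult_Aut_curve[OF M_auts[OF xy(3)] M_auts[OF xy(4)], of a b]
      by (simp add: xy(1,2)) (simp add: f_def)
  qed
  have inj: "inj_on f (carrier ?S)"
  proof (rule inj_onI)
    fix x y assume x: "x \<in> carrier ?S" and y: "y \<in> carrier ?S" and eq: "f x = f y"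
    obtain a b \<sigma> where x': "x = ((a, b), \<sigma>)" "a \<in> {0..<4}" "b \<in> {0..<4}" "\<sigma> permutes {1..3}"
      using x unfolding carrier by blast
    obtain a' b' \<tau> where y': "y = ((a', b'), \<tau>)" "a' \<in> {0..<4}" "b' \<in> {0..<4}" "\<tau> permutes {1..3}"
      using y unfolding carrier by blast
    obtain c where "M (a, b) \<sigma> = mat c ** M (a', b') \<tau>"
      using eq by (auto simp: x' y' f_def proj_class_eq_iff)
    then have m: "monomial_matrix (coord_perm \<sigma>) (\<lambda>j. w powi exponent a b (coord_index j))
        = monomial_matrix (coord_perm \<tau>) (\<lambda>j. c * w powi exponent a' b' (coord_index j))"
      by (simp add: M_def scale_monomial_matrix)
    have nz: "w powi exponent a b (coord_index j) \<noteq> 0" for j using w0 by simp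
    note inj = monomial_matrix_inject[OF m nz bij_coord_perm(1)[OF x'(4)]]
    have ex: "w powi exponent a b (coord_index j) = c * w powi exponent a' b' (coord_index j)" for j
      using fun_cong[OF inj(2), of j] .
    have "c = 1" using ex[of 3] by (simp add: exponent_def)
    then have "a mod 4 = a' mod 4" "b mod 4 = b' mod 4"
      using ex[of 1] ex[of 2] by (simp_all add: exponent_def powi_eq)
    then have "a = a'" "b = b'" using x' y' by simp_all
    moreover have "\<sigma> = \<tau>"
    proof
      fix n show "\<sigma> n = \<tau> n"
      proof (cases "n \<in> {1..3}")
        case True
        then have "\<rho> n = coord_index (coord_perm \<rho> (index_coord n))" if "\<rho> permutes {1..3}" for \<rho>
          using that by (simp add: coord_index_coord_perm coord_index_index_coord)
        then show ?thesis using inj(1) x'(4) y'(4) by metis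
      qed (use x'(4) y'(4) in \<open>simp add: permutes_not_in\<close>)
    qed
    ultimately show "x = y" by (simp add: x' y')
  qed
  have onto: "carrier (Aut_curve ?F) \<subseteq> f ` carrier ?S"
  proof
    fix S assume "S \<in> carrier (Aut_curve ?F)"
    then obtain A where A: "S = proj_class A" "A \<in> auts ?F" by (auto simp: carrier_Aut_curve)
    obtain s \<delta> c where s: "bij s" "A = monomial_matrix s \<delta>" "c \<noteq> 0" "\<And>j. \<delta> j ^ 4 = c"
      using auts_fermat_quartic[OF A(2)] by blast
    have \<delta>0: "\<delta> j \<noteq> 0" for j using s(3) s(4)[of j] by auto
    have unit: "(\<delta> j / \<delta> 3) ^ 4 = 1" for j using s(3,4) by (simp add: power_divide)
    \<comment> \<open>All entries have the same fourth power, so their ratios to the third entry are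
      fourth roots of unity, and the third entry becomes the scalar.\<close>
    define a b where "a = root_log 4 w (\<delta> 1 / \<delta> 3)" and "b = root_log 4 w (\<delta> 2 / \<delta> 3)"
    have ab: "a \<in> {0..<4}" "b \<in> {0..<4}" "w powi a = \<delta> 1 / \<delta> 3" "w powi b = \<delta> 2 / \<delta> 3"
      using root_log_range[OF w _ unit[of 1]] root_log_range[OF w _ unit[of 2]] by (simp_all add: a_def b_def)
    define \<sigma> where "\<sigma> n = (if n \<in> {1..3} then coord_index (s (index_coord n)) else n)" for n
    have "inj_on \<sigma> {1..3}"
    proof (rule inj_onI)
      fix m n assume mn: "m \<in> {1..3}" "n \<in> {1..3}" "\<sigma> m = \<sigma> n"
      then have "s (index_coord m) = s (index_coord n)" by (simp add: \<sigma>_def coord_index_inject)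
      then have "index_coord m = index_coord n" using s(1) by (simp add: bij_is_inj inj_eq)
      with mn show "m = n" by (metis coord_index_index_coord)
    qed
    moreover have "\<sigma> ` {1..3} \<subseteq> {1..3}"
      using coord_index_simps(5) by (auto simp: \<sigma>_def simp del: coord_index_simps(5) atLeastAtMost_iff)
    ultimately have "bij_betw \<sigma> {1..3} {1..3}"
      by (simp add: bij_betw_def endo_inj_surj)
    then have \<sigma>: "\<sigma> permutes {1..3}"
      by (rule bij_imp_permutes) (simp only: \<sigma>_def if_False)
    have "\<sigma> (coord_index i) = coord_index (s i)" for i
      unfolding \<sigma>_def using coord_index_simps(5)[of i] by (simp only: if_True coord_index_simps(4))
    then have "s = coord_perm \<sigma>" by (intro ext) (simp add: coord_perm_def)
    moreover have "\<delta> = (\<lambda>j. \<delta> 3 * w powi exponent a b (coord_index j))"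
    proof
      fix j show "\<delta> j = \<delta> 3 * w powi exponent a b (coord_index j)"
        using exhaust_3[of j] \<delta>0[of 3] by (elim disjE) (simp_all add: exponent_def ab)
    qed
    ultimately have "monomial_matrix s \<delta> = monomial_matrix (coord_perm \<sigma>) (\<lambda>j. \<delta> 3 * w powi exponent a b (coord_index j))"
      by (rule arg_cong2)
    then have "A = mat (\<delta> 3) ** M (a, b) \<sigma>"
      by (simp only: M_def scale_monomial_matrix s(2) fst_conv snd_conv)
    then have "S = f ((a, b), \<sigma>)" by (simp add: A(1) f_def proj_class_scale \<delta>0)
    with ab(1,2) \<sigma> show "S \<in> f ` carrier ?S" unfolding carrier by blast
  qed
  have "f ` carrier ?S \<subseteq> carrier (Aut_curve ?F)" using hom by (auto simp: hom_def)
  with inj onto have "bij_betw f (carrier ?S) (carrier (Aut_curve ?F))"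
    by (simp add: bij_betw_def subset_antisym)
  with hom have iso: "f \<in> iso ?S (Aut_curve ?F)" by (rule isoI)
  have "x \<otimes>\<^bsub>?S\<^esub> y \<in> carrier ?S" if "x \<in> carrier ?S" "y \<in> carrier ?S" for x y
  proof -
    obtain a b \<sigma> a' b' \<tau> where xy: "x = ((a, b), \<sigma>)" "y = ((a', b'), \<tau>)" "\<sigma> permutes {1..3}" "\<tau> permutes {1..3}"
      using \<open>x \<in> carrier ?S\<close> \<open>y \<in> carrier ?S\<close> unfolding carrier by blast
    then show ?thesis
      by (simp add: carrier mult_Zn2 coordinate_action_exponent Let_def permutes_compose del: atLeastAtMost_iff)
  qed
  from iso_sym_if_closed[OF iso this] show ?thesis .
qed

section \<open>Normal forms of the quartic and the sextic\<close>

lemma quartic_carries_fermat: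
  "\<exists>A. carries A fermat_quartic (Xd_plus_YZ_form 4 :: 'k::{alg_closed_field, field_char_0} ternary)"
proof -
  obtain l :: 'k where l: "l ^ 4 = 1 / 2" using nth_root_exists[of 4 "1 / 2 :: 'k"] by auto
  obtain \<epsilon> :: 'k where \<epsilon>: "\<epsilon> ^ 4 = - 1" using nth_root_exists[of 4 "- 1 :: 'k"] by auto
  have nz: "l \<noteq> 0" "\<epsilon> \<noteq> 0" using l \<epsilon> by auto
  \<comment> \<open>Putting \<open>Y = u + v\<close>, \<open>Z = u - v\<close> turns
    \<open>Y^3 Z + Y Z^3\<close> into \<open>2 (u^4 - v^4)\<close>; \<open>l^4 = 1/2\<close> removes
    the 2 and \<open>\<epsilon>^4 = -1\<close> the sign.\<close>
  let ?A = "block_matrix 1 l (l * \<epsilon>) l (- (l * \<epsilon>))"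
  have "eval_at (Xd_plus_YZ_form 4) (?A *v v) = 1 * eval_at fermat_quartic v" for v
  proof -
    have id: "(l * y + l * \<epsilon> * z) ^ 3 * (l * y - l * \<epsilon> * z) + (l * y + l * \<epsilon> * z) * (l * y - l * \<epsilon> * z) ^ 3
      = 2 * l ^ 4 * (y ^ 4 - \<epsilon> ^ 4 * z ^ 4)" for y z
      by (simp add: eval_nat_numeral) (simp add: algebra_simps)
    have "4 - 1 = (3::nat)" by simp
    then show ?thesis
      using id[of "v $ 2" "v $ 3"]
      by (simp only: eval_at_Xd_plus_YZ_form block_matrix_mult_vector eval_at_fermat_quartic sum_3 l \<epsilon>) simp
  qed
  moreover have "invertible ?A" using nz by (simp add: invertible_block_matrix)
  ultimately have "carries ?A fermat_quartic (Xd_plus_YZ_form 4 :: 'k ternary)"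
    unfolding carries_iff by (intro conjI exI[of _ 1]) auto
  then show ?thesis by blast
qed

text \<open>Scaling \<open>Z\<close> against \<open>Y\<close> by \<open>\<eta>\<close> with
  \<open>\<eta>^4 = -1\<close> changes the relative sign of the two monomials;
  \<open>\<mu>^6 = 1 / \<eta>\<close> compensates the common factor.\<close>

lemma sextic_carries_octahedral:
  "\<exists>A. carries A (YZ_form 6 (- 1)) (Xd_plus_YZ_form 6 :: 'k::{alg_closed_field, field_char_0} ternary)"
proof -
  obtain \<eta> :: 'k where \<eta>: "\<eta> ^ 4 = - 1" using nth_root_exists[of 4 "- 1 :: 'k"] by auto
  obtain \<mu> :: 'k where \<mu>: "\<mu> ^ 6 = inverse \<eta>" using nth_root_exists[of 6 "inverse \<eta>"] by auto
  have nz: "\<eta> \<noteq> 0" "\<mu> \<noteq> 0" using \<eta> \<mu> by auto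
  let ?A = "block_matrix 1 \<mu> 0 0 (\<eta> * \<mu>)"
  have "eval_at (Xd_plus_YZ_form 6) (?A *v v) = 1 * eval_at (YZ_form 6 (- 1)) v" for v
  proof -
    have id: "(\<mu> * y) ^ 5 * (\<eta> * \<mu> * z) + (\<mu> * y) * (\<eta> * \<mu> * z) ^ 5
      = \<mu> ^ 6 * \<eta> * (y ^ 5 * z + \<eta> ^ 4 * (y * z ^ 5))" for y z
      by (simp add: eval_nat_numeral) (simp add: algebra_simps)
    have "6 - 1 = (5::nat)" by simp
    then show ?thesis
      using id[of "v $ 2" "v $ 3"] nz
      by (simp add: eval_at_Xd_plus_YZ_form block_matrix_mult_vector eval_at_YZ_form \<mu> \<eta>)
  qed
  moreover have "invertible ?A" using nz by (simp add: invertible_block_matrix)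
  ultimately have "carries ?A (YZ_form 6 (- 1)) (Xd_plus_YZ_form 6 :: 'k ternary)"
    unfolding carries_iff by (intro conjI exI[of _ 1]) auto
  then show ?thesis by blast
qed

section \<open>Transport of the three group computations to an arbitrary isomorphic curve\<close>

theorem proposition42:
  fixes F :: "'k::{alg_closed_field, field_char_0} ternary" and d :: nat
  assumes "d \<ge> 4" and "nonsingular_plane_curve d F"
  shows "((\<exists>\<sigma>\<in>carrier (Aut_curve F). group.ord (Aut_curve F) \<sigma> = d * (d - 2))
            \<longleftrightarrow> isomorphic_curves F (Xd_plus_YZ_form d))
       \<and> (isomorphic_curves F (Xd_plus_YZ_form d) \<longrightarrow>
            (d \<noteq> 4 \<and> d \<noteq> 6 \<longrightarrow>
               central_extension (Aut_curve F) (dihedral_group (d - 2)) (integer_mod_group d))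
          \<and> (d = 6 \<longrightarrow> central_extension (Aut_curve F) (sym_group 4) (integer_mod_group d))
          \<and> (d = 4 \<longrightarrow> Aut_curve F \<cong> Zn2_semidirect_S3 4))"
proof -
  let ?G = "Xd_plus_YZ_form d :: 'k ternary"
  have F: "homogeneous d F" "nonsingular F"
    using assms(2) by (simp_all add: nonsingular_plane_curve_def)
  have iff: "(\<exists>\<sigma>\<in>carrier (Aut_curve F). group.ord (Aut_curve F) \<sigma> = d * (d - 2)) \<longleftrightarrow> isomorphic_curves F ?G"
    using isomorphic_if_order[OF assms(1) F] order_if_isomorphic[OF assms(1)] by blast
  have to_F: "Aut_curve ?G \<cong> Aut_curve F" if iso: "isomorphic_curves F ?G"
    using iso isomorphic_Aut_curve group.iso_sym[OF group_Aut_curve]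
    unfolding isomorphic_curves_def by blast
  have dihedral: "central_extension (Aut_curve F) (dihedral_group (d - 2)) (integer_mod_group d)"
    if iso: "isomorphic_curves F ?G" and d: "d \<noteq> 4" "d \<noteq> 6"
  proof -
    have "d \<ge> 5" using assms(1) d by simp
    from central_extension_dihedral[OF this d(2), where ?'k = 'k]
    show ?thesis
      unfolding YZ_form_1 by (rule central_extension_iso[OF _ to_F[OF iso] group_Aut_curve])
  qed
  have octahedral: "central_extension (Aut_curve F) (sym_group 4) (integer_mod_group d)"
    if iso: "isomorphic_curves F ?G" and d: "d = 6"
  proof -
    obtain A where "carries A (YZ_form 6 (- 1)) ?G" using sextic_carries_octahedral unfolding d by blast
    from central_extension_iso[OF central_extension_octahedral isomorphic_Aut_curve[OF this] group_Aut_curve]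
    have "central_extension (Aut_curve ?G) (sym_group 4) (integer_mod_group d)" unfolding d .
    then show ?thesis by (rule central_extension_iso[OF _ to_F[OF iso] group_Aut_curve])
  qed
  have fermat: "Aut_curve F \<cong> Zn2_semidirect_S3 4"
    if iso: "isomorphic_curves F ?G" and d: "d = 4"
  proof -
    obtain A where "carries A fermat_quartic ?G" using quartic_carries_fermat unfolding d by blast
    from isomorphic_Aut_curve[OF this] have "Aut_curve ?G \<cong> Aut_curve (fermat_quartic :: 'k ternary)"
      by (rule group.iso_sym[OF group_Aut_curve])
    moreover have "Aut_curve F \<cong> Aut_curve ?G" by (rule group.iso_sym[OF group_Aut_curve to_F[OF iso]])
    ultimately show ?thesis using Aut_curve_fermat_quartic iso_trans by blast
  qed
  show ?thesis using iff dihedral octahedral fermat by blast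
qed

end
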